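(* Let $M$ be a smooth manifold, $\{U_\alpha\}_\alpha$ an open cover of $M$, and $\mathsf{M}$ the groupoid associated to this cover, with $\mathsf{M}_0=\bigsqcup_\alpha U_\alpha$, $\mathsf{M}_1=\bigsqcup_{(\alpha,\beta)}U_\alpha\cap U_\beta$ and the natural source and target maps. Let $\mathcal{L}M$ be the free loop space of $M$, viewed as the groupoid $\mathcal{L}M\rightrightarrows\mathcal{L}M$ with only identity arrows. Then the loop groupoid $\mathsf{L}\mathsf{M}$ is Morita equivalent to $\mathcal{L}M$.
   Context: **Groupoids.** A groupoid $\mathsf{G}$ has objects $\mathsf{G}_0$, arrows $\mathsf{G}_1$, source and target $s,t:\mathsf{G}_1\to\mathsf{G}_0$, composition $m$, inverse $i$, identities $e:\mathsf{G}_0\to\mathsf{G}_1$. Composition is written in diagrammatic order: $a\cdot b$ is defined when $t(a)=s(b)$. It is topological if everything is in topological spaces. A morphism $\Psi:\mathsf{H}\to\mathsf{G}$ is a pair of continuous maps $\Psi_0,\Psi_1$ commuting with the structure maps. It is Morita if the square formed by $\Psi_1$, $\Psi_0\times\Psi_0$ and the two maps $(s,t)$ is cartesian and $s\pi_2:\mathsf{H}_0\,{}_{\Psi_0}\!\times_t\mathsf{G}_1\to\mathsf{G}_0$ is an open surjection. $\mathsf{G},\mathsf{H}$ are Morita equivalent if there are a topological groupoid $\mathsf{K}$ and Morita morphisms $\mathsf{G}\leftarrow\mathsf{K}\to\mathsf{H}$. **Circle groupoids.** For a finite set $q_1<\dots<q_n<q_0$ in $(0,1]$ (identified with points $e^{2\pi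 i q_k}$ of $S^1$) and $\epsilon>0$, consider the cover of $S^1$ by the (images of the) intervals $V_i=(q_i-\epsilon,q_{i+1}+\epsilon)$, indices cyclic (so $V_0=(q_0-\epsilon,q_1+1+\epsilon)$). It is admissible if all triple intersections of distinct members are empty; $\mathcal{W}$ is the set of admissible covers. A cover given by $(\{p_k\},\epsilon)$ refines one given by $(\{q_k\},\epsilon')$ if $\epsilon\le\epsilon'$ and $\{q_k\}\subset\{p_k\}$; each set of the finer cover then lies canonically in a set of the coarser. $\mathcal{W}$ is directed under refinement. For $W\in\mathcal{W}$ let $\{W_\beta\}$ be the intervals $V_i+k$ ($k\in\mathbb{Z}$) of $\mathbb{R}$, and $W_\beta^l:=W_\beta+l$. Put $\underline{\mathbb{R}^W}_0=\bigsqcup_\beta W_\beta$, $\underline{\mathbb{R}^W}_1=\bigsqcup_{(\beta,\gamma)}W_\beta\cap W_\gamma$. The groupoid $\mathsf{S}^1_W$ has objects $\underline{\mathbb{R}^W}_0$, arrows $\underline{\mathbb{R}^W}_1\times\mathbb{Z}$, $s((x,W_{\beta\gamma}),l)=(x,W_\beta)$, $t((x,W_{\beta\gamma}),l)=(x+l,W_\gamma^l)$, $e(x,W_\beta)=((x,W_{\beta\beta}),0)$, $((x,W_{\beta\gamma}),l)\cdot((x+l,W^l_{\gamma\sigma}),k)=((x,W_{\beta\sigma}),l+k)$. If $W'$ refines $W$ there is a natural morphism $\rho^{W'}_W:\mathsf{S}^1_{W'}\to\mathsf{S}^1_W$. **Loop groupoid.** $\mathsf{L}\mathsf{G}(W)$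 has as objects the morphisms $\mathsf{S}^1_W\to\mathsf{G}$; an arrow from $\Psi$ to $\Phi$ is a continuous $\Lambda:\underline{\mathbb{R}^W}_1\times\mathbb{Z}\to\mathsf{G}_1$ with $s\Lambda(r)=\Psi_0(s(r))$, $t\Lambda(r)=\Phi_0(t(r))$ and $\Lambda(r)=\Psi_1(r)\cdot\Lambda(et(r))=\Lambda(es(r))\cdot\Phi_1(r)$ for all $r$. Arrows $\Lambda:\Psi\to\Phi$, $\Omega:\Phi\to\Gamma$ compose by $(\Omega\circ\Lambda)(es(r))=\Lambda(es(r))\cdot\Omega(es(r))$, $(\Omega\circ\Lambda)(r)=(\Omega\circ\Lambda)(es(r))\cdot\Gamma_1(r)$. Objects carry the compact-open topology, and arrows the compact-open topology via $\Lambda\mapsto(\Psi_1,\Lambda\circ e)$. Precomposition with $\rho^{W'}_W$ gives monomorphisms $\mathsf{L}\mathsf{G}(W)\hookrightarrow\mathsf{L}\mathsf{G}(W')$, and $\mathsf{L}\mathsf{G}:=\varinjlim_{W\in\mathcal{W}}\mathsf{L}\mathsf{G}(W)$. The free loop space $\mathcal{L}M$ is the space of continuous maps $S^1\to M$ with the compact-open topology. *)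

theory Defs
  imports "HOL-Analysis.Analysis"
begin

section \<open>Topological groupoids and Morita equivalence\<close>

record ('o, 'a) tgroupoid =
  Obj :: "'o topology"
  Arr :: "'a topology"
  src :: "'a \<Rightarrow> 'o"
  tgt :: "'a \<Rightarrow> 'o"
  cmp :: "'a \<Rightarrow> 'a \<Rightarrow> 'a"
  idt :: "'o \<Rightarrow> 'a"
  ivt :: "'a \<Rightarrow> 'a"

text \<open>Composition is in diagrammatic order: \<open>cmp G a b\<close> is meaningful when \<open>tgt G a = src G b\<close>.\<close>

definition composable :: "('o, 'a) tgroupoid \<Rightarrow> ('a \<times> 'a) set" where
  "composable G = {(a, b). a \<in> topspace (Arr G) \<and> b \<in> topspace (Arr G) \<and> tgt G a = src G b}"

definition groupoid :: "('o, 'a) tgroupoid \<Rightarrow> bool" where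
  "groupoid G \<longleftrightarrow>
     src G \<in> topspace (Arr G) \<rightarrow> topspace (Obj G) \<and>
     tgt G \<in> topspace (Arr G) \<rightarrow> topspace (Obj G) \<and>
     idt G \<in> topspace (Obj G) \<rightarrow> topspace (Arr G) \<and>
     ivt G \<in> topspace (Arr G) \<rightarrow> topspace (Arr G) \<and>
     (\<forall>(a, b) \<in> composable G. cmp G a b \<in> topspace (Arr G) \<and>
        src G (cmp G a b) = src G a \<and> tgt G (cmp G a b) = tgt G b) \<and>
     (\<forall>a b c. (a, b) \<in> composable G \<and> (b, c) \<in> composable G \<longrightarrow>
        cmp G (cmp G a b) c = cmp G a (cmp G b c)) \<and>
     (\<forall>x \<in> topspace (Obj G). src G (idt G x) = x \<and> tgt G (idt G x) = x) \<and>
     (\<forall>a \<in> topspace (Arr G). cmp G (idt G (src G a)) a = a \<and> cmp G a (idt G (tgt G a)) = a) \<and>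
     (\<forall>a \<in> topspace (Arr G). src G (ivt G a) = tgt G a \<and> tgt G (ivt G a) = src G a \<and>
        cmp G a (ivt G a) = idt G (src G a) \<and> cmp G (ivt G a) a = idt G (tgt G a))"

definition topological_groupoid :: "('o, 'a) tgroupoid \<Rightarrow> bool" where
  "topological_groupoid G \<longleftrightarrow>
     groupoid G \<and>
     continuous_map (Arr G) (Obj G) (src G) \<and>
     continuous_map (Arr G) (Obj G) (tgt G) \<and>
     continuous_map (Obj G) (Arr G) (idt G) \<and>
     continuous_map (Arr G) (Arr G) (ivt G) \<and>
     continuous_map (subtopology (prod_topology (Arr G) (Arr G)) (composable G)) (Arr G)
       (\<lambda>(a, b). cmp G a b)"

definition groupoid_morphism ::
  "('o, 'a) tgroupoid \<Rightarrow> ('p, 'b) tgroupoid \<Rightarrow> ('o \<Rightarrow> 'p) \<times> ('a \<Rightarrow> 'b) \<Rightarrow> bool" where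
  "groupoid_morphism H G \<Psi> \<longleftrightarrow>
     continuous_map (Obj H) (Obj G) (fst \<Psi>) \<and>
     continuous_map (Arr H) (Arr G) (snd \<Psi>) \<and>
     (\<forall>a \<in> topspace (Arr H). src G (snd \<Psi> a) = fst \<Psi> (src H a) \<and>
                              tgt G (snd \<Psi> a) = fst \<Psi> (tgt H a) \<and>
                              snd \<Psi> (ivt H a) = ivt G (snd \<Psi> a)) \<and>
     (\<forall>x \<in> topspace (Obj H). snd \<Psi> (idt H x) = idt G (fst \<Psi> x)) \<and>
     (\<forall>(a, b) \<in> composable H. snd \<Psi> (cmp H a b) = cmp G (snd \<Psi> a) (snd \<Psi> b))"

text \<open>The square of \<open>\<Psi>\<^sub>1\<close>, \<open>\<Psi>\<^sub>0 \<times> \<Psi>\<^sub>0\<close> and the two maps \<open>(s, t)\<close> is cartesian in topological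
  spaces, i.e. the comparison map to the fibre product is a homeomorphism.\<close>

definition morita_morphism ::
  "('o, 'a) tgroupoid \<Rightarrow> ('p, 'b) tgroupoid \<Rightarrow> ('o \<Rightarrow> 'p) \<times> ('a \<Rightarrow> 'b) \<Rightarrow> bool" where
  "morita_morphism H G \<Psi> \<longleftrightarrow>
     groupoid_morphism H G \<Psi> \<and>
     homeomorphic_map (Arr H)
       (subtopology (prod_topology (prod_topology (Obj H) (Obj H)) (Arr G))
          {((x, y), g). src G g = fst \<Psi> x \<and> tgt G g = fst \<Psi> y})
       (\<lambda>h. ((src H h, tgt H h), snd \<Psi> h)) \<and>
     (let P = subtopology (prod_topology (Obj H) (Arr G)) {(x, g). fst \<Psi> x = tgt G g};
          \<sigma> = (\<lambda>(x, g). src G g)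
      in continuous_map P (Obj G) \<sigma> \<and> open_map P (Obj G) \<sigma> \<and> \<sigma> ` topspace P = topspace (Obj G))"

text \<open>HOL cannot quantify over the types carrying \<open>K\<close>. They are fixed to be those of the action
  groupoid of a bibundle from \<open>G\<close> to \<open>H\<close>, whose points over an object of \<open>G\<close> are parametrised by
  arrows of \<open>H\<close>. Fixing them can only make the relation more restrictive.\<close>

definition morita_equivalent :: "('o, 'a) tgroupoid \<Rightarrow> ('p, 'b) tgroupoid \<Rightarrow> bool" where
  "morita_equivalent G H \<longleftrightarrow>
     topological_groupoid G \<and> topological_groupoid H \<and>
     (\<exists>(K :: ('o \<times> 'b, 'a \<times> ('o \<times> 'b) \<times> 'b) tgroupoid) \<Psi> \<Phi>.
        topological_groupoid K \<and> morita_morphism K G \<Psi> \<and> morita_morphism K H \<Phi>)"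

definition unit_groupoid :: "'o topology \<Rightarrow> ('o, 'o) tgroupoid" where
  "unit_groupoid X = \<lparr>Obj = X, Arr = X, src = (\<lambda>x. x), tgt = (\<lambda>x. x), cmp = (\<lambda>x y. x),
                      idt = (\<lambda>x. x), ivt = (\<lambda>x. x)\<rparr>"


section \<open>Direct limits of topological groupoids\<close>

text \<open>A system is a family \<open>G i\<close>, \<open>i \<in> I\<close>, directed by \<open>le\<close>, with transition morphisms
  \<open>\<tau> i j\<close> from \<open>G i\<close> to \<open>G j\<close> for \<open>le i j\<close>. The germ of \<open>x\<close> at \<open>i\<close> is its class in the direct limit of
  sets.\<close>

definition germ ::
  "'i set \<Rightarrow> ('i \<Rightarrow> 'i \<Rightarrow> bool) \<Rightarrow> ('i \<Rightarrow> 'x set) \<Rightarrow> ('i \<Rightarrow> 'i \<Rightarrow> 'x \<Rightarrow> 'x) \<Rightarrow> 'i \<Rightarrow> 'x \<Rightarrow> ('i \<times> 'x) set" where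
  "germ I le C \<tau> i x = {(j, y). j \<in> I \<and> y \<in> C j \<and> (\<exists>k\<in>I. le i k \<and> le j k \<and> \<tau> i k x = \<tau> j k y)}"

definition obj_germ ::
  "'i set \<Rightarrow> ('i \<Rightarrow> 'i \<Rightarrow> bool) \<Rightarrow> ('i \<Rightarrow> ('o, 'a) tgroupoid) \<Rightarrow>
   ('i \<Rightarrow> 'i \<Rightarrow> ('o \<Rightarrow> 'o) \<times> ('a \<Rightarrow> 'a)) \<Rightarrow> 'i \<Rightarrow> 'o \<Rightarrow> ('i \<times> 'o) set" where
  "obj_germ I le G \<tau> = germ I le (\<lambda>i. topspace (Obj (G i))) (\<lambda>i j. fst (\<tau> i j))"

definition arr_germ ::
  "'i set \<Rightarrow> ('i \<Rightarrow> 'i \<Rightarrow> bool) \<Rightarrow> ('i \<Rightarrow> ('o, 'a) tgroupoid) \<Rightarrow>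
   ('i \<Rightarrow> 'i \<Rightarrow> ('o \<Rightarrow> 'o) \<times> ('a \<Rightarrow> 'a)) \<Rightarrow> 'i \<Rightarrow> 'a \<Rightarrow> ('i \<times> 'a) set" where
  "arr_germ I le G \<tau> = germ I le (\<lambda>i. topspace (Arr (G i))) (\<lambda>i j. snd (\<tau> i j))"

text \<open>The direct limit of the underlying groupoids, with given topologies on objects and arrows.
  The unions are over representatives; each is a union of equal classes.\<close>

definition limit_groupoid ::
  "'i set \<Rightarrow> ('i \<Rightarrow> 'i \<Rightarrow> bool) \<Rightarrow> ('i \<Rightarrow> ('o, 'a) tgroupoid) \<Rightarrow>
   ('i \<Rightarrow> 'i \<Rightarrow> ('o \<Rightarrow> 'o) \<times> ('a \<Rightarrow> 'a)) \<Rightarrow>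
   ('i \<times> 'o) set topology \<Rightarrow> ('i \<times> 'a) set topology \<Rightarrow> (('i \<times> 'o) set, ('i \<times> 'a) set) tgroupoid" where
  "limit_groupoid I le G \<tau> S T =
     \<lparr>Obj = S, Arr = T,
      src = (\<lambda>A. \<Union>{obj_germ I le G \<tau> i (src (G i) a) | i a. (i, a) \<in> A}),
      tgt = (\<lambda>A. \<Union>{obj_germ I le G \<tau> i (tgt (G i) a) | i a. (i, a) \<in> A}),
      cmp = (\<lambda>A B. \<Union>{arr_germ I le G \<tau> i (cmp (G i) a b) | i a b.
                          (i, a) \<in> A \<and> (i, b) \<in> B \<and> tgt (G i) a = src (G i) b}),
      idt = (\<lambda>X. \<Union>{arr_germ I le G \<tau> i (idt (G i) x) | i x. (i, x) \<in> X}),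
      ivt = (\<lambda>A. \<Union>{arr_germ I le G \<tau> i (ivt (G i) a) | i a. (i, a) \<in> A})\<rparr>"

definition limit_topologies ::
  "'i set \<Rightarrow> ('i \<Rightarrow> 'i \<Rightarrow> bool) \<Rightarrow> ('i \<Rightarrow> ('o, 'a) tgroupoid) \<Rightarrow>
   ('i \<Rightarrow> 'i \<Rightarrow> ('o \<Rightarrow> 'o) \<times> ('a \<Rightarrow> 'a)) \<Rightarrow>
   (('i \<times> 'o) set topology \<times> ('i \<times> 'a) set topology) set" where
  "limit_topologies I le G \<tau> =
     {(S, T). topspace S = {obj_germ I le G \<tau> i x | i x. i \<in> I \<and> x \<in> topspace (Obj (G i))} \<and>
              topspace T = {arr_germ I le G \<tau> i a | i a. i \<in> I \<and> a \<in> topspace (Arr (G i))} \<and>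
              topological_groupoid (limit_groupoid I le G \<tau> S T) \<and>
              (\<forall>i\<in>I. continuous_map (Obj (G i)) S (obj_germ I le G \<tau> i)) \<and>
              (\<forall>i\<in>I. continuous_map (Arr (G i)) T (arr_germ I le G \<tau> i))}"

text \<open>The colimit in the category of topological groupoids: the limit groupoid with the finest
  topologies that make it a topological groupoid receiving all \<open>G i\<close> continuously. (The arrow
  topology can be strictly coarser than the final topology, for which composition need not be
  continuous when the index set has no countable cofinal subset.) The universal property is proved
  in \<open>colimit_cocone\<close> and \<open>colimit_universal\<close>; uniqueness is clear, as all objects and arrows are germs.\<close>

definition colimit_groupoid ::
  "'i set \<Rightarrow> ('i \<Rightarrow> 'i \<Rightarrow> bool) \<Rightarrow> ('i \<Rightarrow> ('o, 'a) tgroupoid) \<Rightarrow>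
   ('i \<Rightarrow> 'i \<Rightarrow> ('o \<Rightarrow> 'o) \<times> ('a \<Rightarrow> 'a)) \<Rightarrow> (('i \<times> 'o) set, ('i \<times> 'a) set) tgroupoid" where
  "colimit_groupoid I le G \<tau> =
     limit_groupoid I le G \<tau>
       (topology_generated_by {V. \<exists>(S, T) \<in> limit_topologies I le G \<tau>. openin S V})
       (topology_generated_by {V. \<exists>(S, T) \<in> limit_topologies I le G \<tau>. openin T V})"


section \<open>The circle groupoids\<close>

text \<open>A cover is given by \<open>W = (Q, \<epsilon>)\<close> with \<open>Q\<close> the set of the \<open>q\<^sub>k\<close>. The interval \<open>V\<^sub>i\<close> is addressed
  by its point \<open>q = q\<^sub>i\<close>, and \<open>W\<^sub>\<beta> = V\<^sub>i + k\<close> by \<open>\<beta> = (q, k)\<close>; so \<open>W\<^sub>\<beta>\<^sup>l\<close> has address \<open>(q, k + l)\<close>.\<close>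

type_synonym cover = "real set \<times> real"
type_synonym piece = "real \<times> int"

definition next_point :: "real set \<Rightarrow> real \<Rightarrow> real" where
  "next_point Q q = (if \<exists>r\<in>Q. q < r then Min {r \<in> Q. q < r} else Min Q + 1)"

definition base_interval :: "cover \<Rightarrow> real \<Rightarrow> real set" where
  "base_interval W q = {q - snd W <..< next_point (fst W) q + snd W}"

definition pieces :: "cover \<Rightarrow> piece set" where
  "pieces W = fst W \<times> UNIV"

definition interval_of :: "cover \<Rightarrow> piece \<Rightarrow> real set" where
  "interval_of W \<beta> = (\<lambda>x. x + of_int (snd \<beta>)) ` base_interval W (fst \<beta>)"

definition shift_piece :: "int \<Rightarrow> piece \<Rightarrow> piece" where
  "shift_piece l \<beta> = (fst \<beta>, snd \<beta> + l)"

definition admissible_covers :: "cover set" where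
  "admissible_covers =
     {W. finite (fst W) \<and> fst W \<noteq> {} \<and> fst W \<subseteq> {0<..1} \<and> snd W > 0 \<and>
         (\<forall>q\<in>fst W. \<forall>r\<in>fst W. \<forall>u\<in>fst W. q \<noteq> r \<and> q \<noteq> u \<and> r \<noteq> u \<longrightarrow>
            (let c = (\<lambda>q. (\<lambda>x. cis (2 * pi * x)) ` base_interval W q) in c q \<inter> c r \<inter> c u = {}))}"

definition cover_refines :: "cover \<Rightarrow> cover \<Rightarrow> bool" where
  "cover_refines W' W \<longleftrightarrow> snd W' \<le> snd W \<and> fst W \<subseteq> fst W'"

type_synonym circle_obj = "piece \<times> real"
type_synonym circle_arr = "((piece \<times> piece) \<times> real) \<times> int"

text \<open>\<open>(x, W\<^sub>\<beta>)\<close> is encoded as \<open>(\<beta>, x)\<close> and \<open>((x, W\<^sub>\<beta>\<^sub>\<gamma>), l)\<close> as \<open>(((\<beta>, \<gamma>), x), l)\<close>.\<close>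

definition circle_groupoid :: "cover \<Rightarrow> (circle_obj, circle_arr) tgroupoid" where
  "circle_groupoid W =
     \<lparr>Obj = sum_topology (\<lambda>\<beta>. top_of_set (interval_of W \<beta>)) (pieces W),
      Arr = prod_topology
              (sum_topology (\<lambda>(\<beta>, \<gamma>). top_of_set (interval_of W \<beta> \<inter> interval_of W \<gamma>))
                 (pieces W \<times> pieces W))
              (discrete_topology UNIV),
      src = (\<lambda>(((\<beta>, \<gamma>), x), l). (\<beta>, x)),
      tgt = (\<lambda>(((\<beta>, \<gamma>), x), l). (shift_piece l \<gamma>, x + of_int l)),
      cmp = (\<lambda>(((\<beta>, \<gamma>), x), l) (((\<gamma>', \<sigma>), y), k). (((\<beta>, shift_piece (- l) \<sigma>), x), l + k)),
      idt = (\<lambda>(\<beta>, x). (((\<beta>, \<beta>), x), 0)),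
      ivt = (\<lambda>(((\<beta>, \<gamma>), x), l). (((shift_piece l \<gamma>, shift_piece l \<beta>), x + of_int l), - l))\<rparr>"

text \<open>The piece of the coarser cover with points \<open>Q\<close> that canonically contains a piece of a finer one:
  the one with \<open>[p, p') + k \<subseteq> [q, q') + m\<close> before thickening by the \<open>\<epsilon>\<close>'s.\<close>

definition coarse_piece :: "real set \<Rightarrow> piece \<Rightarrow> piece" where
  "coarse_piece Q \<beta> =
     (THE (q, m). q \<in> Q \<and> q + of_int m \<le> fst \<beta> + of_int (snd \<beta>) \<and>
                  fst \<beta> + of_int (snd \<beta>) < next_point Q q + of_int m)"

definition refinement_morphism ::
  "cover \<Rightarrow> (circle_obj \<Rightarrow> circle_obj) \<times> (circle_arr \<Rightarrow> circle_arr)" where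
  "refinement_morphism W =
     (let r = coarse_piece (fst W)
      in (\<lambda>(\<beta>, x). (r \<beta>, x), \<lambda>(((\<beta>, \<gamma>), x), l). (((r \<beta>, r \<gamma>), x), l)))"


section \<open>The loop groupoid\<close>

definition continuous_maps :: "'a topology \<Rightarrow> 'b topology \<Rightarrow> ('a \<Rightarrow> 'b) set" where
  "continuous_maps X Y = {f \<in> extensional (topspace X). continuous_map X Y f}"

definition compact_open_topology :: "'a topology \<Rightarrow> 'b topology \<Rightarrow> ('a \<Rightarrow> 'b) topology" where
  "compact_open_topology X Y =
     topology_generated_by {{f \<in> continuous_maps X Y. f ` K \<subseteq> V} | K V. compactin X K \<and> openin Y V}"

type_synonym ('o, 'a) loop_obj = "(circle_obj \<Rightarrow> 'o) \<times> (circle_arr \<Rightarrow> 'a)"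
type_synonym ('o, 'a) loop_arr = "('o, 'a) loop_obj \<times> (circle_arr \<Rightarrow> 'a) \<times> ('o, 'a) loop_obj"

text \<open>An arrow \<open>\<Lambda>\<close> is stored together with its source and target as \<open>(\<Psi>, \<Lambda>, \<Phi>)\<close>. The identity and
  the inverse are the ones forced by the composition law.\<close>

definition loop_groupoid_at ::
  "('o, 'a) tgroupoid \<Rightarrow> cover \<Rightarrow> (('o, 'a) loop_obj, ('o, 'a) loop_arr) tgroupoid" where
  "loop_groupoid_at G W =
     (let S = circle_groupoid W;
          Ob = subtopology
                 (prod_topology (compact_open_topology (Obj S) (Obj G))
                                (compact_open_topology (Arr S) (Arr G)))
                 {\<Psi>. groupoid_morphism S G \<Psi>};
          Ar = {(\<Psi>, \<Lambda>, \<Phi>). \<Psi> \<in> topspace Ob \<and> \<Phi> \<in> topspace Ob \<and>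
                  \<Lambda> \<in> continuous_maps (Arr S) (Arr G) \<and>
                  (\<forall>r \<in> topspace (Arr S).
                     src G (\<Lambda> r) = fst \<Psi> (src S r) \<and> tgt G (\<Lambda> r) = fst \<Phi> (tgt S r) \<and>
                     \<Lambda> r = cmp G (snd \<Psi> r) (\<Lambda> (idt S (tgt S r))) \<and>
                     \<Lambda> r = cmp G (\<Lambda> (idt S (src S r))) (snd \<Phi> r))}
      in \<lparr>Obj = Ob,
          Arr = pullback_topology Ar
                  (\<lambda>(\<Psi>, \<Lambda>, \<Phi>). (snd \<Psi>, restrict (\<Lambda> \<circ> idt S) (topspace (Obj S))))
                  (prod_topology (compact_open_topology (Arr S) (Arr G))
                                 (compact_open_topology (Obj S) (Arr G))),
          src = (\<lambda>(\<Psi>, \<Lambda>, \<Phi>). \<Psi>),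
          tgt = (\<lambda>(\<Psi>, \<Lambda>, \<Phi>). \<Phi>),
          cmp = (\<lambda>(\<Psi>, \<Lambda>, \<Phi>) (\<Phi>', \<Omega>, \<Gamma>).
                   (\<Psi>, \<lambda>r \<in> topspace (Arr S).
                         cmp G (cmp G (\<Lambda> (idt S (src S r))) (\<Omega> (idt S (src S r)))) (snd \<Gamma> r), \<Gamma>)),
          idt = (\<lambda>\<Psi>. (\<Psi>, snd \<Psi>, \<Psi>)),
          ivt = (\<lambda>(\<Psi>, \<Lambda>, \<Phi>).
                   (\<Phi>, \<lambda>r \<in> topspace (Arr S).
                         cmp G (ivt G (\<Lambda> (idt S (src S r)))) (snd \<Psi> r), \<Psi>))\<rparr>)"

definition loop_restriction ::
  "cover \<Rightarrow> cover \<Rightarrow> (('o, 'a) loop_obj \<Rightarrow> ('o, 'a) loop_obj) \<times> (('o, 'a) loop_arr \<Rightarrow> ('o, 'a) loop_arr)" where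
  "loop_restriction W W' =
     (let S' = circle_groupoid W';
          \<rho> = refinement_morphism W;
          p1 = (\<lambda>\<Lambda>. restrict (\<Lambda> \<circ> snd \<rho>) (topspace (Arr S')));
          p = (\<lambda>\<Psi>. (restrict (fst \<Psi> \<circ> fst \<rho>) (topspace (Obj S')), p1 (snd \<Psi>)))
      in (p, \<lambda>(\<Psi>, \<Lambda>, \<Phi>). (p \<Psi>, p1 \<Lambda>, p \<Phi>)))"

definition loop_groupoid ::
  "('o, 'a) tgroupoid \<Rightarrow>
   ((cover \<times> ('o, 'a) loop_obj) set, (cover \<times> ('o, 'a) loop_arr) set) tgroupoid" where
  "loop_groupoid G =
     colimit_groupoid admissible_covers (\<lambda>W W'. cover_refines W' W)
       (loop_groupoid_at G) loop_restriction"

definition free_loop_space :: "'m topology \<Rightarrow> (complex \<Rightarrow> 'm) topology" where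
  "free_loop_space X = compact_open_topology (top_of_set (sphere 0 1)) X"


section \<open>Smooth manifolds and the groupoid of a cover\<close>

text \<open>\<open>f\<close> is \<open>C\<^sup>k\<close> on the open subset \<open>S\<close> of \<open>\<real>\<^sup>n\<close>: all iterated partial derivatives of order at
  most \<open>k\<close> exist and are continuous.\<close>

primrec Ck_on :: "nat \<Rightarrow> nat \<Rightarrow> (nat \<Rightarrow> real) set \<Rightarrow> ((nat \<Rightarrow> real) \<Rightarrow> real) \<Rightarrow> bool" where
  "Ck_on n 0 S f \<longleftrightarrow> continuous_map (subtopology (Euclidean_space n) S) euclideanreal f"
| "Ck_on n (Suc k) S f \<longleftrightarrow>
     continuous_map (subtopology (Euclidean_space n) S) euclideanreal f \<and>
     (\<forall>i<n. (\<forall>x\<in>S. (\<lambda>u. f (x(i := u))) differentiable at (x i)) \<and>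
            Ck_on n k S (\<lambda>x. deriv (\<lambda>u. f (x(i := u))) (x i)))"

definition smooth_map_on :: "nat \<Rightarrow> (nat \<Rightarrow> real) set \<Rightarrow> ((nat \<Rightarrow> real) \<Rightarrow> (nat \<Rightarrow> real)) \<Rightarrow> bool" where
  "smooth_map_on n S f \<longleftrightarrow> (\<forall>k. \<forall>j<n. Ck_on n k S (\<lambda>x. f x j))"

text \<open>The atlas \<open>A\<close> consists of charts \<open>(D, \<phi>)\<close> with \<open>\<phi>\<close> defined on the open set \<open>D\<close>.\<close>

definition smooth_manifold ::
  "nat \<Rightarrow> 'm topology \<Rightarrow> ('m set \<times> ('m \<Rightarrow> nat \<Rightarrow> real)) set \<Rightarrow> bool" where
  "smooth_manifold n X A \<longleftrightarrow>
     Hausdorff_space X \<and> second_countable X \<and>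
     (\<forall>(D, \<phi>) \<in> A. openin X D \<and> openin (Euclidean_space n) (\<phi> ` D) \<and>
        homeomorphic_map (subtopology X D) (subtopology (Euclidean_space n) (\<phi> ` D)) \<phi>) \<and>
     (\<Union>(D, \<phi>) \<in> A. D) = topspace X \<and>
     (\<forall>(D, \<phi>) \<in> A. \<forall>(E, \<psi>) \<in> A. smooth_map_on n (\<phi> ` (D \<inter> E)) (\<psi> \<circ> inv_into D \<phi>))"

definition cover_groupoid ::
  "'m topology \<Rightarrow> 'i set \<Rightarrow> ('i \<Rightarrow> 'm set) \<Rightarrow> ('i \<times> 'm, ('i \<times> 'i) \<times> 'm) tgroupoid" where
  "cover_groupoid X I U =
     \<lparr>Obj = sum_topology (\<lambda>\<alpha>. subtopology X (U \<alpha>)) I,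
      Arr = sum_topology (\<lambda>(\<alpha>, \<beta>). subtopology X (U \<alpha> \<inter> U \<beta>)) (I \<times> I),
      src = (\<lambda>((\<alpha>, \<beta>), x). (\<alpha>, x)),
      tgt = (\<lambda>((\<alpha>, \<beta>), x). (\<beta>, x)),
      cmp = (\<lambda>((\<alpha>, \<beta>), x) ((\<beta>', \<gamma>), y). ((\<alpha>, \<gamma>), x)),
      idt = (\<lambda>(\<alpha>, x). ((\<alpha>, \<alpha>), x)),
      ivt = (\<lambda>((\<alpha>, \<beta>), x). ((\<beta>, \<alpha>), x))\<rparr>"


section \<open>The direct limit is a colimit of topological groupoids\<close>

lemma topology_generated_by_family:
  fixes \<F> :: "'x topology set"
  assumes ne: "\<F> \<noteq> {}" and top: "\<And>T. T \<in> \<F> \<Longrightarrow> topspace T = C"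
  defines "T0 \<equiv> topology_generated_by {V. \<exists>T\<in>\<F>. openin T V}"
  shows "topspace T0 = C"
    and "T \<in> \<F> \<Longrightarrow> continuous_map T0 T (\<lambda>x. x)"
    and "(\<And>T. T \<in> \<F> \<Longrightarrow> continuous_map X T f) \<Longrightarrow> continuous_map X T0 f"
proof -
  have sub: "V \<subseteq> C" if "T \<in> \<F>" "openin T V" for T V
    using openin_subset[OF that(2)] top[OF that(1)] by simp
  obtain R where R: "R \<in> \<F>" using ne by blast
  have "openin R C" using openin_topspace[of R] top[OF R] by simp
  then have "C \<subseteq> \<Union>{V. \<exists>T\<in>\<F>. openin T V}" using R by (intro Union_upper) auto
  moreover have "\<Union>{V. \<exists>T\<in>\<F>. openin T V} \<subseteq> C" by (rule Union_least) (auto dest: sub)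
  ultimately have U: "\<Union>{V. \<exists>T\<in>\<F>. openin T V} = C" by simp
  then show top0: "topspace T0 = C" unfolding T0_def by simp
  show "continuous_map T0 T (\<lambda>x. x)" if T: "T \<in> \<F>"
    unfolding continuous_map_alt
  proof (intro conjI allI impI)
    fix V assume V: "openin T V"
    then have "openin T0 V" unfolding T0_def using T by (intro topology_generated_by_Basis) blast
    moreover have "(\<lambda>x. x) -` V \<inter> topspace T0 = V" using sub[OF T V] top0 by blast
    ultimately show "openin T0 ((\<lambda>x. x) -` V \<inter> topspace T0)" by simp
  qed (simp add: top0 top[OF T])
  show "continuous_map X T0 f" if f: "\<And>T. T \<in> \<F> \<Longrightarrow> continuous_map X T f"
    unfolding T0_def
  proof (rule continuous_on_generated_topo)
    fix V assume "V \<in> {V. \<exists>T\<in>\<F>. openin T V}"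
    then obtain T where "T \<in> \<F>" "openin T V" by auto
    then show "openin X (f -` V \<inter> topspace X)" using f[of T] by (simp add: continuous_map_alt)
  next
    show "f ` topspace X \<subseteq> \<Union>{V. \<exists>T\<in>\<F>. openin T V}"
      unfolding U using continuous_map_image_subset_topspace[OF f[OF R]] top[OF R] by simp
  qed
qed

lemma germ_self:
  assumes "i \<in> I" "x \<in> C i" "le i i"
  shows "(i, x) \<in> germ I le C \<tau> i x"
  using assms by (auto simp: germ_def)

locale directed_system =
  fixes I :: "'i set" and le :: "'i \<Rightarrow> 'i \<Rightarrow> bool"
    and G :: "'i \<Rightarrow> ('o, 'a) tgroupoid"
    and \<tau> :: "'i \<Rightarrow> 'i \<Rightarrow> ('o \<Rightarrow> 'o) \<times> ('a \<Rightarrow> 'a)"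
  assumes le_refl: "i \<in> I \<Longrightarrow> le i i"
    and le_trans: "\<lbrakk>i \<in> I; j \<in> I; k \<in> I; le i j; le j k\<rbrakk> \<Longrightarrow> le i k"
    and directed: "\<lbrakk>i \<in> I; j \<in> I\<rbrakk> \<Longrightarrow> \<exists>k\<in>I. le i k \<and> le j k"
    and groupoid_G: "i \<in> I \<Longrightarrow> topological_groupoid (G i)"
    and morphism_\<tau>: "\<lbrakk>i \<in> I; j \<in> I; le i j\<rbrakk> \<Longrightarrow> groupoid_morphism (G i) (G j) (\<tau> i j)"
    and obj_comp: "\<lbrakk>i \<in> I; j \<in> I; k \<in> I; le i j; le j k; x \<in> topspace (Obj (G i))\<rbrakk>
                     \<Longrightarrow> fst (\<tau> j k) (fst (\<tau> i j) x) = fst (\<tau> i k) x"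
    and arr_comp: "\<lbrakk>i \<in> I; j \<in> I; k \<in> I; le i j; le j k; a \<in> topspace (Arr (G i))\<rbrakk>
                     \<Longrightarrow> snd (\<tau> j k) (snd (\<tau> i j) a) = snd (\<tau> i k) a"
    and obj_id: "\<lbrakk>i \<in> I; x \<in> topspace (Obj (G i))\<rbrakk> \<Longrightarrow> fst (\<tau> i i) x = x"
    and arr_id: "\<lbrakk>i \<in> I; a \<in> topspace (Arr (G i))\<rbrakk> \<Longrightarrow> snd (\<tau> i i) a = a"
begin

abbreviation "ob i \<equiv> topspace (Obj (G i))"
abbreviation "ar i \<equiv> topspace (Arr (G i))"
abbreviation "og \<equiv> obj_germ I le G \<tau>"
abbreviation "ag \<equiv> arr_germ I le G \<tau>"
abbreviation "colim \<equiv> colimit_groupoid I le G \<tau>"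

lemma G_algebra: "i \<in> I \<Longrightarrow> groupoid (G i)"
  using groupoid_G unfolding topological_groupoid_def by blast

lemma \<tau>_ob: "\<lbrakk>i \<in> I; j \<in> I; le i j; x \<in> ob i\<rbrakk> \<Longrightarrow> fst (\<tau> i j) x \<in> ob j"
  using morphism_\<tau> unfolding groupoid_morphism_def continuous_map_def by blast

lemma \<tau>_ar: "\<lbrakk>i \<in> I; j \<in> I; le i j; a \<in> ar i\<rbrakk> \<Longrightarrow> snd (\<tau> i j) a \<in> ar j"
  using morphism_\<tau> unfolding groupoid_morphism_def continuous_map_def by blast

lemma germ_eqI_gen:
  assumes C: "\<And>i j x. \<lbrakk>i \<in> I; j \<in> I; le i j; x \<in> C i\<rbrakk> \<Longrightarrow> t i j x \<in> C j"
    and comp: "\<And>i j k x. \<lbrakk>i \<in> I; j \<in> I; k \<in> I; le i j; le j k; x \<in> C i\<rbrakk> \<Longrightarrow> t j k (t i j x) = t i k x"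
    and x: "i \<in> I" "x \<in> C i" and y: "(j, y) \<in> germ I le C t i x"
  shows "germ I le C t j y = germ I le C t i x"
proof -
  from y obtain k where k: "k \<in> I" "le i k" "le j k" "t i k x = t j k y" and j: "j \<in> I" "y \<in> C j"
    unfolding germ_def by auto
  have "(\<exists>l\<in>I. le i l \<and> le m l \<and> t i l x = t m l z) \<longleftrightarrow> (\<exists>l\<in>I. le j l \<and> le m l \<and> t j l y = t m l z)"
    if m: "m \<in> I" "z \<in> C m" for m z
  proof
    assume "\<exists>l\<in>I. le i l \<and> le m l \<and> t i l x = t m l z"
    then obtain l where l: "l \<in> I" "le i l" "le m l" "t i l x = t m l z" by blast
    obtain h where h: "h \<in> I" "le k h" "le l h" using directed k l by blast
    have "t j h y = t i h x" using comp[of j k h y] comp[of i k h x] k j x h by simp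
    also have "\<dots> = t m h z" using comp[of i l h x] comp[of m l h z] l m x h by simp
    finally show "\<exists>l\<in>I. le j l \<and> le m l \<and> t j l y = t m l z"
      using h k l j m le_trans by blast
  next
    assume "\<exists>l\<in>I. le j l \<and> le m l \<and> t j l y = t m l z"
    then obtain l where l: "l \<in> I" "le j l" "le m l" "t j l y = t m l z" by blast
    obtain h where h: "h \<in> I" "le k h" "le l h" using directed k l by blast
    have "t i h x = t j h y" using comp[of j k h y] comp[of i k h x] k j x h by simp
    also have "\<dots> = t m h z" using comp[of j l h y] comp[of m l h z] l m j h by simp
    finally show "\<exists>l\<in>I. le i l \<and> le m l \<and> t i l x = t m l z"
      using h k l x m le_trans by blast
  qed
  then show ?thesis unfolding germ_def by blast
qed

lemma og_eqI: "\<lbrakk>i \<in> I; x \<in> ob i; (j, y) \<in> og i x\<rbrakk> \<Longrightarrow> og j y = og i x"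
  unfolding obj_germ_def
  by (rule germ_eqI_gen[where C = "\<lambda>i. ob i"]) (simp_all add: \<tau>_ob obj_comp)

lemma ag_eqI: "\<lbrakk>i \<in> I; a \<in> ar i; (j, b) \<in> ag i a\<rbrakk> \<Longrightarrow> ag j b = ag i a"
  unfolding arr_germ_def
  by (rule germ_eqI_gen[where C = "\<lambda>i. ar i"]) (simp_all add: \<tau>_ar arr_comp)

lemma og_self: "\<lbrakk>i \<in> I; x \<in> ob i\<rbrakk> \<Longrightarrow> (i, x) \<in> og i x"
  unfolding obj_germ_def by (rule germ_self) (auto intro: le_refl)

lemma ag_self: "\<lbrakk>i \<in> I; a \<in> ar i\<rbrakk> \<Longrightarrow> (i, a) \<in> ag i a"
  unfolding arr_germ_def by (rule germ_self) (auto intro: le_refl)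

lemma og_mem: "(j, y) \<in> og i x \<Longrightarrow> j \<in> I \<and> y \<in> ob j \<and> (\<exists>k\<in>I. le i k \<and> le j k \<and> fst (\<tau> i k) x = fst (\<tau> j k) y)"
  unfolding obj_germ_def germ_def by auto

lemma ag_mem: "(j, b) \<in> ag i a \<Longrightarrow> j \<in> I \<and> b \<in> ar j \<and> (\<exists>k\<in>I. le i k \<and> le j k \<and> snd (\<tau> i k) a = snd (\<tau> j k) b)"
  unfolding arr_germ_def germ_def by auto

lemma og_memI:
  "\<lbrakk>j \<in> I; y \<in> ob j; \<exists>k\<in>I. le i k \<and> le j k \<and> fst (\<tau> i k) x = fst (\<tau> j k) y\<rbrakk> \<Longrightarrow> (j, y) \<in> og i x"
  unfolding obj_germ_def germ_def by simp

lemma og_eq_iff: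
  "\<lbrakk>i \<in> I; x \<in> ob i; j \<in> I; y \<in> ob j\<rbrakk> \<Longrightarrow>
     og i x = og j y \<longleftrightarrow> (\<exists>k\<in>I. le i k \<and> le j k \<and> fst (\<tau> i k) x = fst (\<tau> j k) y)"
  using og_eqI[of i x j y] og_self[of j y] og_mem[of j y i x] og_memI[of j y i x]
  by metis

lemma ag_memI:
  "\<lbrakk>j \<in> I; b \<in> ar j; \<exists>k\<in>I. le i k \<and> le j k \<and> snd (\<tau> i k) a = snd (\<tau> j k) b\<rbrakk> \<Longrightarrow> (j, b) \<in> ag i a"
  unfolding arr_germ_def germ_def by simp

lemma ag_eq_iff:
  "\<lbrakk>i \<in> I; a \<in> ar i; j \<in> I; b \<in> ar j\<rbrakk> \<Longrightarrow>
     ag i a = ag j b \<longleftrightarrow> (\<exists>k\<in>I. le i k \<and> le j k \<and> snd (\<tau> i k) a = snd (\<tau> j k) b)"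
  using ag_eqI[of i a j b] ag_self[of j b] ag_mem[of j b i a] ag_memI[of j b i a]
  by metis

lemma og_push: "\<lbrakk>i \<in> I; x \<in> ob i; k \<in> I; le i k\<rbrakk> \<Longrightarrow> og k (fst (\<tau> i k) x) = og i x"
  by (rule og_eqI, assumption, assumption, rule og_memI)
     (simp_all add: \<tau>_ob, rule bexI[of _ k], simp_all add: \<tau>_ob le_refl obj_id)

lemma ag_push: "\<lbrakk>i \<in> I; a \<in> ar i; k \<in> I; le i k\<rbrakk> \<Longrightarrow> ag k (snd (\<tau> i k) a) = ag i a"
  by (rule ag_eqI, assumption, assumption, rule ag_memI)
     (simp_all add: \<tau>_ar, rule bexI[of _ k], simp_all add: \<tau>_ar le_refl arr_id)

lemma UN_germ_const:
  assumes "(i, x) \<in> A" "\<And>j y. (j, y) \<in> A \<Longrightarrow> f j y = f i x"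
  shows "\<Union>{f j y | j y. (j, y) \<in> A} = f i x"
  using assms by blast

lemma G_closed:
  assumes "i \<in> I"
  shows "a \<in> ar i \<Longrightarrow> src (G i) a \<in> ob i" "a \<in> ar i \<Longrightarrow> tgt (G i) a \<in> ob i"
    "x \<in> ob i \<Longrightarrow> idt (G i) x \<in> ar i" "a \<in> ar i \<Longrightarrow> ivt (G i) a \<in> ar i"
    "\<lbrakk>a \<in> ar i; b \<in> ar i; tgt (G i) a = src (G i) b\<rbrakk> \<Longrightarrow> cmp (G i) a b \<in> ar i"
  using G_algebra[OF assms] by (simp_all add: groupoid_def composable_def Pi_iff)

lemma \<tau>_structure:
  assumes "i \<in> I" "j \<in> I" "le i j"
  shows "a \<in> ar i \<Longrightarrow> src (G j) (snd (\<tau> i j) a) = fst (\<tau> i j) (src (G i) a)"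
    "a \<in> ar i \<Longrightarrow> tgt (G j) (snd (\<tau> i j) a) = fst (\<tau> i j) (tgt (G i) a)"
    "x \<in> ob i \<Longrightarrow> snd (\<tau> i j) (idt (G i) x) = idt (G j) (fst (\<tau> i j) x)"
    "a \<in> ar i \<Longrightarrow> snd (\<tau> i j) (ivt (G i) a) = ivt (G j) (snd (\<tau> i j) a)"
    "\<lbrakk>a \<in> ar i; b \<in> ar i; tgt (G i) a = src (G i) b\<rbrakk>
       \<Longrightarrow> snd (\<tau> i j) (cmp (G i) a b) = cmp (G j) (snd (\<tau> i j) a) (snd (\<tau> i j) b)"
  using morphism_\<tau>[OF assms] by (simp_all add: groupoid_morphism_def composable_def)

text \<open>The structure maps of the limit groupoid, computed on representatives.\<close>

context
  fixes S :: "('i \<times> 'o) set topology" and T :: "('i \<times> 'a) set topology"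
begin

abbreviation "L \<equiv> limit_groupoid I le G \<tau> S T"

lemma src_L: assumes "i \<in> I" "a \<in> ar i" shows "src L (ag i a) = og i (src (G i) a)"
proof -
  have "og j (src (G j) b) = og i (src (G i) a)" if b: "(j, b) \<in> ag i a" for j b
  proof -
    obtain k where k: "j \<in> I" "b \<in> ar j" "k \<in> I" "le i k" "le j k" "snd (\<tau> i k) a = snd (\<tau> j k) b"
      using ag_mem[OF b] by blast
    then have "fst (\<tau> i k) (src (G i) a) = fst (\<tau> j k) (src (G j) b)"
      using \<tau>_structure(1)[of i k a] \<tau>_structure(1)[of j k b] assms by simp
    then show ?thesis using og_push[of i "src (G i) a" k] og_push[of j "src (G j) b" k] k assms
      by (simp add: G_closed)
  qed
  then show ?thesis unfolding limit_groupoid_def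
    by (simp add: UN_germ_const[OF ag_self[OF assms], of "\<lambda>j b. og j (src (G j) b)"])
qed

lemma tgt_L: assumes "i \<in> I" "a \<in> ar i" shows "tgt L (ag i a) = og i (tgt (G i) a)"
proof -
  have "og j (tgt (G j) b) = og i (tgt (G i) a)" if b: "(j, b) \<in> ag i a" for j b
  proof -
    obtain k where k: "j \<in> I" "b \<in> ar j" "k \<in> I" "le i k" "le j k" "snd (\<tau> i k) a = snd (\<tau> j k) b"
      using ag_mem[OF b] by blast
    then have "fst (\<tau> i k) (tgt (G i) a) = fst (\<tau> j k) (tgt (G j) b)"
      using \<tau>_structure(2)[of i k a] \<tau>_structure(2)[of j k b] assms by simp
    then show ?thesis using og_push[of i "tgt (G i) a" k] og_push[of j "tgt (G j) b" k] k assms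
      by (simp add: G_closed)
  qed
  then show ?thesis unfolding limit_groupoid_def
    by (simp add: UN_germ_const[OF ag_self[OF assms], of "\<lambda>j b. og j (tgt (G j) b)"])
qed

lemma idt_L: assumes "i \<in> I" "x \<in> ob i" shows "idt L (og i x) = ag i (idt (G i) x)"
proof -
  have "ag j (idt (G j) y) = ag i (idt (G i) x)" if y: "(j, y) \<in> og i x" for j y
  proof -
    obtain k where k: "j \<in> I" "y \<in> ob j" "k \<in> I" "le i k" "le j k" "fst (\<tau> i k) x = fst (\<tau> j k) y"
      using og_mem[OF y] by blast
    then have "snd (\<tau> i k) (idt (G i) x) = snd (\<tau> j k) (idt (G j) y)"
      using \<tau>_structure(3)[of i k x] \<tau>_structure(3)[of j k y] assms by simp
    then show ?thesis using ag_push[of i "idt (G i) x" k] ag_push[of j "idt (G j) y" k] k assms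
      by (simp add: G_closed)
  qed
  then show ?thesis unfolding limit_groupoid_def
    by (simp add: UN_germ_const[OF og_self[OF assms], of "\<lambda>j b. ag j (idt (G j) b)"])
qed

lemma ivt_L: assumes "i \<in> I" "a \<in> ar i" shows "ivt L (ag i a) = ag i (ivt (G i) a)"
proof -
  have "ag j (ivt (G j) b) = ag i (ivt (G i) a)" if b: "(j, b) \<in> ag i a" for j b
  proof -
    obtain k where k: "j \<in> I" "b \<in> ar j" "k \<in> I" "le i k" "le j k" "snd (\<tau> i k) a = snd (\<tau> j k) b"
      using ag_mem[OF b] by blast
    then have "snd (\<tau> i k) (ivt (G i) a) = snd (\<tau> j k) (ivt (G j) b)"
      using \<tau>_structure(4)[of i k a] \<tau>_structure(4)[of j k b] assms by simp
    then show ?thesis using ag_push[of i "ivt (G i) a" k] ag_push[of j "ivt (G j) b" k] k assms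
      by (simp add: G_closed)
  qed
  then show ?thesis unfolding limit_groupoid_def
    by (simp add: UN_germ_const[OF ag_self[OF assms], of "\<lambda>j b. ag j (ivt (G j) b)"])
qed

lemma cmp_L:
  assumes i: "i \<in> I" and a: "a \<in> ar i" and b: "b \<in> ar i" and ab: "tgt (G i) a = src (G i) b"
  shows "cmp L (ag i a) (ag i b) = ag i (cmp (G i) a b)"
proof -
  have "ag j (cmp (G j) c d) = ag i (cmp (G i) a b)"
    if c: "(j, c) \<in> ag i a" and d: "(j, d) \<in> ag i b" and cd: "tgt (G j) c = src (G j) d" for j c d
  proof -
    obtain k where k: "j \<in> I" "c \<in> ar j" "k \<in> I" "le i k" "le j k" "snd (\<tau> i k) a = snd (\<tau> j k) c"
      using ag_mem[OF c] by blast
    obtain l where l: "d \<in> ar j" "l \<in> I" "le i l" "le j l" "snd (\<tau> i l) b = snd (\<tau> j l) d"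
      using ag_mem[OF d] by blast
    obtain h where h: "h \<in> I" "le k h" "le l h" using directed k l by blast
    have h': "le i h" "le j h" using h k l i le_trans by blast+
    have 1: "snd (\<tau> i h) a = snd (\<tau> j h) c"
      using arr_comp[of i k h a] arr_comp[of j k h c] k h i a by simp
    have 2: "snd (\<tau> i h) b = snd (\<tau> j h) d"
      using arr_comp[of i l h b] arr_comp[of j l h d] k l h i b by simp
    have "snd (\<tau> i h) (cmp (G i) a b) = snd (\<tau> j h) (cmp (G j) c d)"
      using \<tau>_structure(5)[of i h a b] \<tau>_structure(5)[of j h c d] i a b ab k l h h' cd 1 2 by simp
    then show ?thesis
      using ag_push[of i "cmp (G i) a b" h] ag_push[of j "cmp (G j) c d" h] h h' k l cd i a b ab
      by (simp add: G_closed)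
  qed
  moreover have "(i, a) \<in> ag i a" "(i, b) \<in> ag i b" using ag_self i a b by blast+
  ultimately have "\<Union>{ag j (cmp (G j) c d) | j c d. (j, c) \<in> ag i a \<and> (j, d) \<in> ag i b \<and>
                     tgt (G j) c = src (G j) d} = ag i (cmp (G i) a b)"
    using ab by blast
  then show ?thesis unfolding limit_groupoid_def by simp
qed

lemma Obj_L [simp]: "Obj L = S" and Arr_L [simp]: "Arr L = T"
  by (simp_all add: limit_groupoid_def)

end

abbreviation "lim_obj \<equiv> {og i x | i x. i \<in> I \<and> x \<in> ob i}"
abbreviation "lim_arr \<equiv> {ag i a | i a. i \<in> I \<and> a \<in> ar i}"

lemma composable_L_common:
  assumes AB: "(A, B) \<in> composable (limit_groupoid I le G \<tau> S T)" and T: "topspace T = lim_arr"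
  obtains i a b where "i \<in> I" "a \<in> ar i" "b \<in> ar i" "tgt (G i) a = src (G i) b" "A = ag i a" "B = ag i b"
proof -
  obtain i a where i: "i \<in> I" "a \<in> ar i" "A = ag i a"
    using AB T unfolding composable_def by auto
  obtain j b where j: "j \<in> I" "b \<in> ar j" "B = ag j b"
    using AB T unfolding composable_def by auto
  have "og i (tgt (G i) a) = og j (src (G j) b)"
    using AB i j tgt_L[of i a S T] src_L[of j b S T] unfolding composable_def by simp
  then obtain k where k: "k \<in> I" "le i k" "le j k"
      "fst (\<tau> i k) (tgt (G i) a) = fst (\<tau> j k) (src (G j) b)"
    using og_eq_iff i j by (auto simp: G_closed)
  show thesis
    by (rule that[of k "snd (\<tau> i k) a" "snd (\<tau> j k) b"])
      (use i j k in \<open>simp_all add: \<tau>_structure ag_push \<tau>_ar\<close>)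
qed

lemma composable_L_common3:
  assumes AB: "(A, B) \<in> composable (limit_groupoid I le G \<tau> S T)"
    and BC: "(B, C) \<in> composable (limit_groupoid I le G \<tau> S T)" and T: "topspace T = lim_arr"
  obtains i a b c where "i \<in> I" "a \<in> ar i" "b \<in> ar i" "c \<in> ar i"
    "tgt (G i) a = src (G i) b" "tgt (G i) b = src (G i) c" "A = ag i a" "B = ag i b" "C = ag i c"
proof -
  obtain i a b where i: "i \<in> I" "a \<in> ar i" "b \<in> ar i" "tgt (G i) a = src (G i) b" "A = ag i a" "B = ag i b"
    using composable_L_common[OF AB T] by blast
  obtain j b' c where j: "j \<in> I" "b' \<in> ar j" "c \<in> ar j" "tgt (G j) b' = src (G j) c" "B = ag j b'" "C = ag j c"
    using composable_L_common[OF BC T] by blast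
  obtain k where k: "k \<in> I" "le i k" "le j k" "snd (\<tau> i k) b = snd (\<tau> j k) b'"
    using ag_eq_iff[of i b j b'] i j by auto
  show thesis
  proof (rule that[of k "snd (\<tau> i k) a" "snd (\<tau> i k) b" "snd (\<tau> j k) c"])
    show "tgt (G k) (snd (\<tau> i k) a) = src (G k) (snd (\<tau> i k) b)"
      using i k(1,2) by (simp add: \<tau>_structure(1,2))
    show "tgt (G k) (snd (\<tau> i k) b) = src (G k) (snd (\<tau> j k) c)"
      using i(1) j k by (simp add: \<tau>_structure(1,2))
  qed (use i j k in \<open>simp_all add: \<tau>_structure(1,2) \<tau>_ar ag_push\<close>)
qed

lemma lim_objI: "\<lbrakk>i \<in> I; x \<in> ob i\<rbrakk> \<Longrightarrow> og i x \<in> lim_obj"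
  and lim_arrI: "\<lbrakk>i \<in> I; a \<in> ar i\<rbrakk> \<Longrightarrow> ag i a \<in> lim_arr"
  by blast+

lemma lim_objE: "X \<in> lim_obj \<Longrightarrow> (\<And>i x. \<lbrakk>i \<in> I; x \<in> ob i; X = og i x\<rbrakk> \<Longrightarrow> P) \<Longrightarrow> P"
  and lim_arrE: "A \<in> lim_arr \<Longrightarrow> (\<And>i a. \<lbrakk>i \<in> I; a \<in> ar i; A = ag i a\<rbrakk> \<Longrightarrow> P) \<Longrightarrow> P"
  by blast+

lemma G_laws:
  assumes "i \<in> I"
  shows "\<lbrakk>a \<in> ar i; b \<in> ar i; tgt (G i) a = src (G i) b\<rbrakk> \<Longrightarrow> src (G i) (cmp (G i) a b) = src (G i) a"
    "\<lbrakk>a \<in> ar i; b \<in> ar i; tgt (G i) a = src (G i) b\<rbrakk> \<Longrightarrow> tgt (G i) (cmp (G i) a b) = tgt (G i) b"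
    "\<lbrakk>a \<in> ar i; b \<in> ar i; c \<in> ar i; tgt (G i) a = src (G i) b; tgt (G i) b = src (G i) c\<rbrakk>
       \<Longrightarrow> cmp (G i) (cmp (G i) a b) c = cmp (G i) a (cmp (G i) b c)"
    "x \<in> ob i \<Longrightarrow> src (G i) (idt (G i) x) = x" "x \<in> ob i \<Longrightarrow> tgt (G i) (idt (G i) x) = x"
    "a \<in> ar i \<Longrightarrow> cmp (G i) (idt (G i) (src (G i) a)) a = a"
    "a \<in> ar i \<Longrightarrow> cmp (G i) a (idt (G i) (tgt (G i) a)) = a"
    "a \<in> ar i \<Longrightarrow> src (G i) (ivt (G i) a) = tgt (G i) a"
    "a \<in> ar i \<Longrightarrow> tgt (G i) (ivt (G i) a) = src (G i) a"
    "a \<in> ar i \<Longrightarrow> cmp (G i) a (ivt (G i) a) = idt (G i) (src (G i) a)"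
    "a \<in> ar i \<Longrightarrow> cmp (G i) (ivt (G i) a) a = idt (G i) (tgt (G i) a)"
  using G_algebra[OF assms] by (simp_all add: groupoid_def composable_def)

lemma groupoid_L:
  assumes S: "topspace S = lim_obj" and T: "topspace T = lim_arr"
  shows "groupoid (limit_groupoid I le G \<tau> S T)" (is "groupoid ?L")
  unfolding groupoid_def Obj_L Arr_L S T
proof (intro conjI)
  note L = src_L tgt_L idt_L ivt_L cmp_L G_closed G_laws
  show "src ?L \<in> lim_arr \<rightarrow> lim_obj" "tgt ?L \<in> lim_arr \<rightarrow> lim_obj"
    "idt ?L \<in> lim_obj \<rightarrow> lim_arr" "ivt ?L \<in> lim_arr \<rightarrow> lim_arr"
    by (rule Pi_I, (erule lim_arrE | erule lim_objE), simp add: L del: mem_Collect_eq,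
        (rule lim_objI | rule lim_arrI), assumption, simp add: L)+
  show "\<forall>(A, B)\<in>composable ?L. cmp ?L A B \<in> lim_arr \<and>
          src ?L (cmp ?L A B) = src ?L A \<and> tgt ?L (cmp ?L A B) = tgt ?L B"
  proof (rule ballI, rule case_prodI2)
    fix p A B assume p: "p \<in> composable ?L" "p = (A, B)"
    then obtain i a b where i: "i \<in> I" "a \<in> ar i" "b \<in> ar i" "tgt (G i) a = src (G i) b"
        and AB: "A = ag i a" "B = ag i b"
      using composable_L_common[OF _ T] by metis
    have "ag i (cmp (G i) a b) \<in> lim_arr" using i by (intro lim_arrI G_closed)
    then show "cmp ?L A B \<in> lim_arr \<and> src ?L (cmp ?L A B) = src ?L A \<and> tgt ?L (cmp ?L A B) = tgt ?L B"
      unfolding AB using i by (simp add: L del: mem_Collect_eq)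
  qed
  show "\<forall>A B C. (A, B) \<in> composable ?L \<and> (B, C) \<in> composable ?L \<longrightarrow>
          cmp ?L (cmp ?L A B) C = cmp ?L A (cmp ?L B C)"
  proof clarify
    fix A B C assume "(A, B) \<in> composable ?L" "(B, C) \<in> composable ?L"
    from composable_L_common3[OF this T] obtain i a b c where "i \<in> I" "a \<in> ar i" "b \<in> ar i" "c \<in> ar i"
        "tgt (G i) a = src (G i) b" "tgt (G i) b = src (G i) c" "A = ag i a" "B = ag i b" "C = ag i c"
      by metis
    then show "cmp ?L (cmp ?L A B) C = cmp ?L A (cmp ?L B C)"
      by (simp add: L)
  qed
  show "\<forall>x\<in>lim_obj. src ?L (idt ?L x) = x \<and> tgt ?L (idt ?L x) = x"
    by (rule ballI, erule lim_objE) (simp add: L)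
  show "\<forall>a\<in>lim_arr. cmp ?L (idt ?L (src ?L a)) a = a \<and> cmp ?L a (idt ?L (tgt ?L a)) = a"
    by (rule ballI, erule lim_arrE) (simp add: L)
  show "\<forall>a\<in>lim_arr. src ?L (ivt ?L a) = tgt ?L a \<and> tgt ?L (ivt ?L a) = src ?L a \<and>
          cmp ?L a (ivt ?L a) = idt ?L (src ?L a) \<and> cmp ?L (ivt ?L a) a = idt ?L (tgt ?L a)"
    by (rule ballI, erule lim_arrE) (simp add: L)
qed

lemma L_types:
  assumes S: "topspace S = lim_obj" and T: "topspace T = lim_arr"
  shows "src (limit_groupoid I le G \<tau> S T) \<in> lim_arr \<rightarrow> lim_obj"
    and "tgt (limit_groupoid I le G \<tau> S T) \<in> lim_arr \<rightarrow> lim_obj"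
    and "idt (limit_groupoid I le G \<tau> S T) \<in> lim_obj \<rightarrow> lim_arr"
    and "ivt (limit_groupoid I le G \<tau> S T) \<in> lim_arr \<rightarrow> lim_arr"
    and "(\<lambda>(a, b). cmp (limit_groupoid I le G \<tau> S T) a b)
           \<in> topspace (subtopology (prod_topology T T) (composable (limit_groupoid I le G \<tau> S T))) \<rightarrow> lim_arr"
  using groupoid_L[OF assms] unfolding groupoid_def Obj_L Arr_L S T
  by (simp_all add: Pi_iff split_beta del: mem_Collect_eq)

text \<open>The finest topologies exist.\<close>

lemma limit_topologies_nonempty:
  "(pullback_topology lim_obj (\<lambda>_. ()) (discrete_topology UNIV), pullback_topology lim_arr (\<lambda>_. ()) (discrete_topology UNIV))
     \<in> limit_topologies I le G \<tau>" (is "(?S, ?T) \<in> _")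
proof -
  have top: "topspace ?S = lim_obj" "topspace ?T = lim_arr" by (auto simp: topspace_pullback_topology)
  have g: "groupoid (limit_groupoid I le G \<tau> ?S ?T)" (is "groupoid ?L") using groupoid_L top by blast
  have S: "continuous_map X ?S f" if "f \<in> topspace X \<rightarrow> lim_obj" for X :: "'x topology" and f
    using that by (intro continuous_map_pullback') (auto simp: o_def)
  have T: "continuous_map X ?T f" if "f \<in> topspace X \<rightarrow> lim_arr" for X :: "'x topology" and f
    using that by (intro continuous_map_pullback') (auto simp: o_def)
  note ty = L_types[OF top]
  have "topological_groupoid ?L"
    unfolding topological_groupoid_def Obj_L Arr_L
    by (intro conjI g S T) (use ty in \<open>simp_all add: top del: mem_Collect_eq\<close>)
  then show ?thesis
    unfolding limit_topologies_def mem_Collect_eq case_prod_conv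
    by (intro conjI ballI S T top) (auto intro: lim_objI lim_arrI simp del: mem_Collect_eq)
qed

definition "limO = topology_generated_by {V. \<exists>S\<in>fst ` limit_topologies I le G \<tau>. openin S V}"
definition "limA = topology_generated_by {V. \<exists>T\<in>snd ` limit_topologies I le G \<tau>. openin T V}"

lemma colim_eq: "colim = limit_groupoid I le G \<tau> limO limA"
proof -
  have "{V. \<exists>(S, T)\<in>limit_topologies I le G \<tau>. openin S V} = {V. \<exists>S\<in>fst ` limit_topologies I le G \<tau>. openin S V}"
    "{V. \<exists>(S, T)\<in>limit_topologies I le G \<tau>. openin T V} = {V. \<exists>T\<in>snd ` limit_topologies I le G \<tau>. openin T V}"
    by (auto intro!: Collect_cong simp: split_beta)
  then show ?thesis unfolding colimit_groupoid_def limO_def limA_def by simp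
qed

lemma Obj_colim [simp]: "Obj colim = limO" and Arr_colim [simp]: "Arr colim = limA"
  by (simp_all add: colim_eq)

lemma limit_topologiesD:
  assumes "p \<in> limit_topologies I le G \<tau>"
  shows "topspace (fst p) = lim_obj" "topspace (snd p) = lim_arr"
    "topological_groupoid (limit_groupoid I le G \<tau> (fst p) (snd p))"
    "\<And>i. i \<in> I \<Longrightarrow> continuous_map (Obj (G i)) (fst p) (og i)"
    "\<And>i. i \<in> I \<Longrightarrow> continuous_map (Arr (G i)) (snd p) (ag i)"
  using assms unfolding limit_topologies_def by (auto intro!: Collect_cong simp: split_beta)

lemma lim_family:
  "fst ` limit_topologies I le G \<tau> \<noteq> {}" "snd ` limit_topologies I le G \<tau> \<noteq> {}"
  "S \<in> fst ` limit_topologies I le G \<tau> \<Longrightarrow> topspace S = lim_obj"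
  "T \<in> snd ` limit_topologies I le G \<tau> \<Longrightarrow> topspace T = lim_arr"
proof -
  have "limit_topologies I le G \<tau> \<noteq> {}"
    by (rule ex_in_conv[THEN iffD1], rule exI, rule limit_topologies_nonempty)
  then show "fst ` limit_topologies I le G \<tau> \<noteq> {}" "snd ` limit_topologies I le G \<tau> \<noteq> {}"
    by simp_all
next
  assume "S \<in> fst ` limit_topologies I le G \<tau>"
  then show "topspace S = lim_obj" by (rule imageE) (simp only: limit_topologiesD(1))
next
  assume "T \<in> snd ` limit_topologies I le G \<tau>"
  then show "topspace T = lim_arr" by (rule imageE) (simp only: limit_topologiesD(2))
qed

lemmas lim_familyO = topology_generated_by_family[OF lim_family(1) lim_family(3), folded limO_def]
lemmas lim_familyA = topology_generated_by_family[OF lim_family(2) lim_family(4), folded limA_def]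

lemma topspace_lim: "topspace limO = lim_obj" "topspace limA = lim_arr"
  by (rule lim_familyO(1) lim_familyA(1); assumption)+

lemma continuous_from_lim:
  assumes "p \<in> limit_topologies I le G \<tau>"
  shows "continuous_map limO (fst p) (\<lambda>x. x)" "continuous_map limA (snd p) (\<lambda>x. x)"
  by (rule lim_familyO(2), assumption, rule imageI, rule assms)
     (rule lim_familyA(2), assumption, rule imageI, rule assms)

lemma continuous_into_limO:
  assumes "\<And>p. p \<in> limit_topologies I le G \<tau> \<Longrightarrow> continuous_map X (fst p) f"
  shows "continuous_map X limO f"
  by (rule lim_familyO(3), assumption, erule imageE, hypsubst, rule assms)

lemma continuous_into_limA:
  assumes "\<And>p. p \<in> limit_topologies I le G \<tau> \<Longrightarrow> continuous_map X (snd p) f"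
  shows "continuous_map X limA f"
  by (rule lim_familyA(3), assumption, erule imageE, hypsubst, rule assms)

lemma limit_groupoid_topology_irrelevant:
  "src (limit_groupoid I le G \<tau> S T) = src colim" "tgt (limit_groupoid I le G \<tau> S T) = tgt colim"
  "idt (limit_groupoid I le G \<tau> S T) = idt colim" "ivt (limit_groupoid I le G \<tau> S T) = ivt colim"
  "cmp (limit_groupoid I le G \<tau> S T) = cmp colim"
  unfolding colim_eq by (simp_all add: limit_groupoid_def)

lemma colimit_cocone:
  shows "topological_groupoid colim"
    and "i \<in> I \<Longrightarrow> groupoid_morphism (G i) colim (og i, ag i)"
    and "\<lbrakk>i \<in> I; j \<in> I; le i j; x \<in> ob i\<rbrakk> \<Longrightarrow> og j (fst (\<tau> i j) x) = og i x"
    and "\<lbrakk>i \<in> I; j \<in> I; le i j; a \<in> ar i\<rbrakk> \<Longrightarrow> ag j (snd (\<tau> i j) a) = ag i a"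
proof -
  have g: "groupoid colim" unfolding colim_eq by (rule groupoid_L) (rule topspace_lim)+
  note str = limit_groupoid_topology_irrelevant
  have tg: "continuous_map (snd p) (fst p) (src colim)" "continuous_map (snd p) (fst p) (tgt colim)"
     "continuous_map (fst p) (snd p) (idt colim)" "continuous_map (snd p) (snd p) (ivt colim)"
     "continuous_map (subtopology (prod_topology (snd p) (snd p)) (composable colim)) (snd p) (\<lambda>(a, b). cmp colim a b)"
    if p: "p \<in> limit_topologies I le G \<tau>" for p
  proof -
    have "composable (limit_groupoid I le G \<tau> (fst p) (snd p)) = composable colim"
      unfolding composable_def str by (simp only: Arr_L Arr_colim limit_topologiesD(2)[OF p] topspace_lim)
    then show "continuous_map (snd p) (fst p) (src colim)" "continuous_map (snd p) (fst p) (tgt colim)"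
     "continuous_map (fst p) (snd p) (idt colim)" "continuous_map (snd p) (snd p) (ivt colim)"
     "continuous_map (subtopology (prod_topology (snd p) (snd p)) (composable colim)) (snd p) (\<lambda>(a, b). cmp colim a b)"
      using limit_topologiesD(3)[OF p] unfolding topological_groupoid_def str Obj_L Arr_L by simp_all
  qed
  note from_lim = continuous_map_compose[OF continuous_from_lim(1), unfolded o_def]
    continuous_map_compose[OF continuous_from_lim(2), unfolded o_def]
  show "topological_groupoid colim"
    unfolding topological_groupoid_def Obj_colim Arr_colim
  proof (intro conjI g continuous_into_limO continuous_into_limA)
    fix p assume p: "p \<in> limit_topologies I le G \<tau>"
    show "continuous_map limA (fst p) (src colim)" by (rule from_lim(2)[OF p tg(1)[OF p]])
    show "continuous_map limA (fst p) (tgt colim)" by (rule from_lim(2)[OF p tg(2)[OF p]])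
    show "continuous_map limO (snd p) (idt colim)" by (rule from_lim(1)[OF p tg(3)[OF p]])
    show "continuous_map limA (snd p) (ivt colim)" by (rule from_lim(2)[OF p tg(4)[OF p]])
    have "continuous_map (prod_topology limA limA) (prod_topology (snd p) (snd p)) (\<lambda>(a, b). (a, b))"
      unfolding continuous_map_prod_top using continuous_from_lim(2)[OF p] by simp
    then have "continuous_map (subtopology (prod_topology limA limA) (composable colim))
                (subtopology (prod_topology (snd p) (snd p)) (composable colim)) (\<lambda>x. x)"
      by (auto simp: continuous_map_in_subtopology continuous_map_from_subtopology id_def)
    from continuous_map_compose[OF this tg(5)[OF p]]
    show "continuous_map (subtopology (prod_topology limA limA) (composable colim)) (snd p) (\<lambda>(a, b). cmp colim a b)"
      by (simp add: o_def)
  qed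
  show "groupoid_morphism (G i) colim (og i, ag i)" if i: "i \<in> I"
    unfolding groupoid_morphism_def Obj_colim Arr_colim fst_conv snd_conv
  proof (intro conjI ballI continuous_into_limO continuous_into_limA)
    fix x assume "x \<in> composable (G i)"
    then show "case x of (a, b) \<Rightarrow> ag i (cmp (G i) a b) = cmp colim (ag i a) (ag i b)"
      using i by (auto simp: composable_def colim_eq cmp_L)
  qed (use i limit_topologiesD(4,5) in \<open>simp_all add: colim_eq src_L tgt_L idt_L ivt_L\<close>)
qed (simp_all add: og_push ag_push)

lemma colimit_universal:
  fixes H :: "('p, 'b) tgroupoid"
  assumes H: "topological_groupoid H"
    and mor: "\<And>i. i \<in> I \<Longrightarrow> groupoid_morphism (G i) H (\<Phi> i)"
    and obj: "\<And>i j x. \<lbrakk>i \<in> I; j \<in> I; le i j; x \<in> ob i\<rbrakk> \<Longrightarrow> fst (\<Phi> j) (fst (\<tau> i j) x) = fst (\<Phi> i) x"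
    and arr: "\<And>i j a. \<lbrakk>i \<in> I; j \<in> I; le i j; a \<in> ar i\<rbrakk> \<Longrightarrow> snd (\<Phi> j) (snd (\<tau> i j) a) = snd (\<Phi> i) a"
  shows "\<exists>\<Psi>. groupoid_morphism colim H \<Psi> \<and>
              (\<forall>i\<in>I. (\<forall>x\<in>ob i. fst \<Psi> (og i x) = fst (\<Phi> i) x) \<and> (\<forall>a\<in>ar i. snd \<Psi> (ag i a) = snd (\<Phi> i) a))"
proof -
  define f where "f X = (let (i, x) = SOME p. p \<in> X in fst (\<Phi> i) x)" for X
  define g where "g A = (let (i, a) = SOME p. p \<in> A in snd (\<Phi> i) a)" for A
  have f: "f (og i x) = fst (\<Phi> i) x" if ix: "i \<in> I" "x \<in> ob i" for i x
  proof -
    obtain j y where jy: "(SOME p. p \<in> og i x) = (j, y)" by (cases "SOME p. p \<in> og i x") blast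
    have "(SOME p. p \<in> og i x) \<in> og i x" by (rule someI, rule og_self[OF ix])
    then have "(j, y) \<in> og i x" using jy by simp
    from og_mem[OF this] obtain k where "j \<in> I" "y \<in> ob j" "k \<in> I" "le i k" "le j k"
        "fst (\<tau> i k) x = fst (\<tau> j k) y" by blast
    then have "fst (\<Phi> j) y = fst (\<Phi> i) x" using obj[of i k x] obj[of j k y] ix by simp
    then show ?thesis unfolding f_def using jy by simp
  qed
  have g: "g (ag i a) = snd (\<Phi> i) a" if ia: "i \<in> I" "a \<in> ar i" for i a
  proof -
    obtain j b where jb: "(SOME p. p \<in> ag i a) = (j, b)" by (cases "SOME p. p \<in> ag i a") blast
    have "(SOME p. p \<in> ag i a) \<in> ag i a" by (rule someI, rule ag_self[OF ia])
    then have "(j, b) \<in> ag i a" using jb by simp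
    from ag_mem[OF this] obtain k where "j \<in> I" "b \<in> ar j" "k \<in> I" "le i k" "le j k"
        "snd (\<tau> i k) a = snd (\<tau> j k) b" by blast
    then have "snd (\<Phi> j) b = snd (\<Phi> i) a" using arr[of i k a] arr[of j k b] ia by simp
    then show ?thesis unfolding g_def using jb by simp
  qed
  have cont: "continuous_map (Obj (G i)) (Obj H) (fst (\<Phi> i))" "continuous_map (Arr (G i)) (Arr H) (snd (\<Phi> i))"
    if "i \<in> I" for i
    using mor[OF that] by (simp_all add: groupoid_morphism_def)
  have fH: "f \<in> lim_obj \<rightarrow> topspace (Obj H)"
    by (rule Pi_I, erule lim_objE) (simp add: f continuous_map_funspace[OF cont(1), THEN funcset_mem])
  have gH: "g \<in> lim_arr \<rightarrow> topspace (Arr H)"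
    by (rule Pi_I, erule lim_arrE) (simp add: g continuous_map_funspace[OF cont(2), THEN funcset_mem])
  define S where "S = pullback_topology lim_obj f (Obj H)"
  define T where "T = pullback_topology lim_arr g (Arr H)"
  have top: "topspace S = lim_obj" "topspace T = lim_arr"
    unfolding S_def T_def topspace_pullback_topology
    by (rule Int_absorb1, rule subsetI, rule vimageI2, erule funcset_mem[OF fH] funcset_mem[OF gH])+
  let ?L = "limit_groupoid I le G \<tau> S T"
  note L = src_L tgt_L idt_L ivt_L cmp_L
  have grp: "groupoid ?L" by (rule groupoid_L) (rule top)+
  note ty = L_types[OF top]
  have S: "continuous_map X S h" if "continuous_map X (Obj H) (f \<circ> h)" "h \<in> topspace X \<rightarrow> lim_obj"
    for X :: "'x topology" and h
    unfolding S_def using that(1)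
    by (rule continuous_map_pullback') (rule subsetI, rule vimageI2, erule funcset_mem[OF that(2)])
  have T: "continuous_map X T h" if "continuous_map X (Arr H) (g \<circ> h)" "h \<in> topspace X \<rightarrow> lim_arr"
    for X :: "'x topology" and h
    unfolding T_def using that(1)
    by (rule continuous_map_pullback') (rule subsetI, rule vimageI2, erule funcset_mem[OF that(2)])
  have fc: "continuous_map S (Obj H) f" and gc: "continuous_map T (Arr H) g"
    unfolding S_def T_def
    using continuous_map_pullback[OF continuous_map_id, of lim_obj f "Obj H"]
      continuous_map_pullback[OF continuous_map_id, of lim_arr g "Arr H"] by (simp_all add: o_def)
  have str: "src H (snd (\<Phi> i) a) = fst (\<Phi> i) (src (G i) a)" "tgt H (snd (\<Phi> i) a) = fst (\<Phi> i) (tgt (G i) a)"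
    "ivt H (snd (\<Phi> i) a) = snd (\<Phi> i) (ivt (G i) a)" if "i \<in> I" "a \<in> ar i" for i a
    using mor[OF that(1)] that(2) by (simp_all add: groupoid_morphism_def)
  have str_id: "idt H (fst (\<Phi> i) x) = snd (\<Phi> i) (idt (G i) x)" if "i \<in> I" "x \<in> ob i" for i x
    using mor[OF that(1)] that(2) by (simp add: groupoid_morphism_def)
  have str_cmp: "cmp H (snd (\<Phi> i) a) (snd (\<Phi> i) b) = snd (\<Phi> i) (cmp (G i) a b)"
    if "i \<in> I" "a \<in> ar i" "b \<in> ar i" "tgt (G i) a = src (G i) b" for i a b
    using mor[OF that(1)] that(2-) by (simp add: groupoid_morphism_def composable_def)
  have fg: "f (src ?L A) = src H (g A)" "f (tgt ?L A) = tgt H (g A)" "g (ivt ?L A) = ivt H (g A)"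
    if "A \<in> lim_arr" for A
    using that by (rule lim_arrE; simp add: f g L G_closed str)+
  have fg_id: "g (idt ?L X) = idt H (f X)" if "X \<in> lim_obj" for X
    using that by (rule lim_objE) (simp add: f g L G_closed str_id)
  have fg_cmp: "g (cmp ?L A B) = cmp H (g A) (g B)" if AB: "(A, B) \<in> composable ?L" for A B
    by (rule composable_L_common[OF AB top(2)]) (simp add: g L G_closed str_cmp)
  have comp: "A \<in> lim_arr" "B \<in> lim_arr" "tgt ?L A = src ?L B" if "(A, B) \<in> composable ?L" for A B
    using that unfolding composable_def Arr_L top(2) by simp_all
  have gg: "(g A, g B) \<in> composable H" if AB: "(A, B) \<in> composable ?L" for A B
    using fg(2)[OF comp(1)[OF AB]] fg(1)[OF comp(2)[OF AB]] comp(3)[OF AB]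
      funcset_mem[OF gH comp(1)[OF AB]] funcset_mem[OF gH comp(2)[OF AB]]
    by (simp add: composable_def)
  have Hc: "continuous_map (Arr H) (Obj H) (src H)" "continuous_map (Arr H) (Obj H) (tgt H)"
     "continuous_map (Obj H) (Arr H) (idt H)" "continuous_map (Arr H) (Arr H) (ivt H)"
     "continuous_map (subtopology (prod_topology (Arr H) (Arr H)) (composable H)) (Arr H) (\<lambda>(a, b). cmp H a b)"
    using H unfolding topological_groupoid_def by simp_all
  have "topological_groupoid ?L"
    unfolding topological_groupoid_def Obj_L Arr_L
  proof (intro conjI grp S T)
    show "continuous_map T (Obj H) (f \<circ> src ?L)"
      by (rule continuous_map_eq[OF continuous_map_compose[OF gc Hc(1)]]) (simp add: top fg del: mem_Collect_eq)
    show "continuous_map T (Obj H) (f \<circ> tgt ?L)"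
      by (rule continuous_map_eq[OF continuous_map_compose[OF gc Hc(2)]]) (simp add: top fg del: mem_Collect_eq)
    show "continuous_map S (Arr H) (g \<circ> idt ?L)"
      by (rule continuous_map_eq[OF continuous_map_compose[OF fc Hc(3)]]) (simp add: top fg_id del: mem_Collect_eq)
    show "continuous_map T (Arr H) (g \<circ> ivt ?L)"
      by (rule continuous_map_eq[OF continuous_map_compose[OF gc Hc(4)]]) (simp add: top fg del: mem_Collect_eq)
    let ?P = "subtopology (prod_topology T T) (composable ?L)"
    have "continuous_map (prod_topology T T) (prod_topology (Arr H) (Arr H)) (\<lambda>(a, b). (g a, g b))"
      unfolding continuous_map_prod_top using gc by simp
    moreover have "(\<lambda>(a, b). (g a, g b)) \<in> topspace ?P \<rightarrow> composable H"
      by (rule Pi_I) (simp add: gg split_beta del: mem_Collect_eq)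
    ultimately have "continuous_map ?P (subtopology (prod_topology (Arr H) (Arr H)) (composable H)) (\<lambda>(a, b). (g a, g b))"
      by (simp add: continuous_map_in_subtopology continuous_map_from_subtopology image_subset_iff_funcset)
    from continuous_map_compose[OF this Hc(5)]
    show "continuous_map ?P (Arr H) (g \<circ> (\<lambda>(a, b). cmp ?L a b))"
      by (rule continuous_map_eq) (auto simp: fg_cmp)
  qed (use ty in \<open>simp_all only: top\<close>)
  moreover have "continuous_map (Obj (G i)) S (og i)" if i: "i \<in> I" for i
    by (rule S, rule continuous_map_eq[OF cont(1)[OF i]]) (use i lim_objI in \<open>simp_all add: f Pi_iff del: mem_Collect_eq\<close>)
  moreover have "continuous_map (Arr (G i)) T (ag i)" if i: "i \<in> I" for i
    by (rule T, rule continuous_map_eq[OF cont(2)[OF i]]) (use i lim_arrI in \<open>simp_all add: g Pi_iff del: mem_Collect_eq\<close>)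
  ultimately have ST: "(S, T) \<in> limit_topologies I le G \<tau>"
    unfolding limit_topologies_def mem_Collect_eq case_prod_conv by (intro conjI ballI top)
  note id = continuous_from_lim[OF ST, unfolded fst_conv snd_conv]
  have c: "composable colim = composable ?L"
    unfolding composable_def limit_groupoid_topology_irrelevant by (simp only: Arr_L Arr_colim top topspace_lim)
  have "groupoid_morphism colim H (f, g)"
    unfolding groupoid_morphism_def Obj_colim Arr_colim fst_conv snd_conv topspace_lim
      c limit_groupoid_topology_irrelevant[of S T, symmetric]
  proof (intro conjI ballI)
    show "continuous_map limO (Obj H) f" "continuous_map limA (Arr H) g"
      using continuous_map_compose[OF id(1) fc] continuous_map_compose[OF id(2) gc] by (simp_all add: o_def)
  qed (auto simp: fg fg_id fg_cmp simp del: mem_Collect_eq)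
  then show ?thesis using f g by (intro exI[of _ "(f, g)"]) simp
qed

end

end

theory Submission
  imports Defs
begin

text \<open>
  An object of the loop groupoid over a fixed cover \<open>W\<close> of the circle is a loop \<open>f\<close> in \<open>M\<close> together
  with a choice, for every interval of \<open>W\<close>, of a member of the open cover that contains its image; there is
  a unique arrow between two objects with the same loop and none otherwise. Hence the loop gives a
  morphism \<open>p\<close> from the colimit to the free loop space \<open>LM\<close>, surjective by Lebesgue's lemma. The object space of the colimit
  carries the final topology, and \<open>p\<close> is open: shrinking \<open>\<epsilon>\<close> makes the containment conditions
  conditions on compact sets. Locally on \<open>LM\<close> there is a continuous section of \<open>p\<close> given by a periodic
  choice; the arrows from an object \<open>X\<close> to the section at \<open>p X\<close> depend continuously on \<open>X\<close>, by finality,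
  and since every arrow is locally a quotient of two of these, the space of arrows is the
  fibre product of the object space with itself over \<open>LM\<close>. So a copy of the loop groupoid maps by
  Morita morphisms to both sides.
\<close>

section \<open>The compact-open topology\<close>

text \<open>The translates by integers of an interval of the cover are distinct components of the
  object space, linked only by arrows, and an object may label them independently. Hence an object
  carries infinitely many labels, and the loops that respect a given labelling need not form an open
  set. This obstacle shapes the proof: sections are built from periodic labellings only, which
  impose finitely many conditions, and an arbitrary labelling must be approximated before openness
  can be shown. The two topologies of the colimit are handled differently. On objects finality is
  available, so continuity out of the object space may be tested at each cover. On arrows it is not,
  since the arrow topology may be strictly coarser than the final one. So the only direct access to
  it is through continuous maps into the arrow space that factor through a single stage, and
  everything else must follow from the groupoid operations being continuous. The intermediate
  groupoid is a copy because the definition of Morita equivalence prescribes its types: objects are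
  pairs, here the points \<open>(x, p x)\<close> of the graph of \<open>p\<close>.\<close>

abbreviation "CO \<equiv> compact_open_topology"

lemma topspace_compact_open [simp]: "topspace (CO X Y) = continuous_maps X Y"
proof -
  have "continuous_maps X Y = {f \<in> continuous_maps X Y. f ` {} \<subseteq> {}}" by simp
  moreover have "compactin X {}" "openin Y {}" by simp_all
  ultimately have "continuous_maps X Y \<in> {{f \<in> continuous_maps X Y. f ` K \<subseteq> V} | K V. compactin X K \<and> openin Y V}"
    by blast
  then show ?thesis
    unfolding compact_open_topology_def topology_generated_by_topspace by blast
qed

lemma openin_compact_open_subbasic:
  "\<lbrakk>compactin X K; openin Y V\<rbrakk> \<Longrightarrow> openin (CO X Y) {f \<in> continuous_maps X Y. f ` K \<subseteq> V}"
  unfolding compact_open_topology_def by (rule topology_generated_by_Basis) blast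

lemma continuous_map_into_compact_open:
  assumes "\<And>p. p \<in> topspace P \<Longrightarrow> F p \<in> continuous_maps X Y"
    and "\<And>K V. \<lbrakk>compactin X K; openin Y V\<rbrakk> \<Longrightarrow> openin P {p \<in> topspace P. F p ` K \<subseteq> V}"
  shows "continuous_map P (CO X Y) F"
  unfolding compact_open_topology_def
proof (rule continuous_on_generated_topo)
  fix U assume "U \<in> {{f \<in> continuous_maps X Y. f ` K \<subseteq> V} |K V. compactin X K \<and> openin Y V}"
  then obtain K V where "U = {f \<in> continuous_maps X Y. f ` K \<subseteq> V}" "compactin X K" "openin Y V" by blast
  moreover from this have "F -` U \<inter> topspace P = {p \<in> topspace P. F p ` K \<subseteq> V}" using assms(1) by blast
  ultimately show "openin P (F -` U \<inter> topspace P)" using assms(2) by simp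
next
  have "F ` topspace P \<subseteq> topspace (CO X Y)" using assms(1) by auto
  then show "F ` topspace P \<subseteq> \<Union> {{f \<in> continuous_maps X Y. f ` K \<subseteq> V} |K V. compactin X K \<and> openin Y V}"
    unfolding compact_open_topology_def by (simp only: topology_generated_by_topspace)
qed

lemma compact_open_preimage:
  assumes "continuous_map P (CO X Y) F" "compactin X K" "openin Y V"
  shows "openin P {p \<in> topspace P. F p ` K \<subseteq> V}"
proof -
  have "F p \<in> continuous_maps X Y" if "p \<in> topspace P" for p
    using continuous_map_funspace[OF assms(1)] that by auto
  then have "{p \<in> topspace P. F p ` K \<subseteq> V} = {p \<in> topspace P. F p \<in> {f \<in> continuous_maps X Y. f ` K \<subseteq> V}}" by auto
  then show ?thesis
    using openin_continuous_map_preimage[OF assms(1) openin_compact_open_subbasic[OF assms(2,3)]] by simp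
qed

lemma continuous_mapsD:
  assumes "f \<in> continuous_maps X Y"
  shows "continuous_map X Y f" "f \<in> extensional (topspace X)" "x \<in> topspace X \<Longrightarrow> f x \<in> topspace Y"
  using assms continuous_map_funspace[of X Y f] by (auto simp: continuous_maps_def)

lemma continuous_mapsI:
  "continuous_map X Y f \<Longrightarrow> restrict f (topspace X) \<in> continuous_maps X Y"
  unfolding continuous_maps_def by (auto intro: continuous_map_eq)

lemma compact_open_value:
  assumes "continuous_map P (CO X Y) F" "p \<in> topspace P"
  shows "F p \<in> continuous_maps X Y"
  using continuous_map_funspace[OF assms(1)] assms(2) by auto

lemma compact_open_precompose:
  assumes F: "continuous_map P (CO X Y) F" and e: "continuous_map X' X e"
  shows "continuous_map P (CO X' Y) (\<lambda>p. \<lambda>x\<in>topspace X'. F p (e x))"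
proof (rule continuous_map_into_compact_open)
  fix p assume "p \<in> topspace P"
  from compact_open_value[OF F this] have "continuous_map X Y (F p)" by (rule continuous_mapsD)
  from continuous_map_compose[OF e this] show "(\<lambda>x\<in>topspace X'. F p (e x)) \<in> continuous_maps X' Y"
    by (intro continuous_mapsI) (simp add: o_def)
next
  fix K V assume K: "compactin X' K" and V: "openin Y V"
  have "(\<lambda>x\<in>topspace X'. F p (e x)) ` K = F p ` (e ` K)" for p
    using compactin_subset_topspace[OF K] by (auto simp: image_image subset_iff)
  then show "openin P {p \<in> topspace P. (\<lambda>x\<in>topspace X'. F p (e x)) ` K \<subseteq> V}"
    using compact_open_preimage[OF F image_compactin[OF K e] V] by simp
qed

text \<open>The map \<open>h\<close> need be continuous only on \<open>D\<close>, as with the map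
  that rebuilds an arrow from two ends over the same point. A preimage under \<open>h\<close> is
  open in \<open>D\<close> only, but it is cut out by an open set of \<open>Y\<close>, which tests
  the same values because all of them lie in \<open>D\<close>.\<close>

lemma compact_open_postcompose:
  assumes F: "continuous_map P (CO X Y) F" and h: "continuous_map (subtopology Y D) Y' h"
    and D: "\<And>p x. \<lbrakk>p \<in> topspace P; x \<in> topspace X\<rbrakk> \<Longrightarrow> F p x \<in> D"
  shows "continuous_map P (CO X Y') (\<lambda>p. \<lambda>x\<in>topspace X. h (F p x))"
proof (rule continuous_map_into_compact_open)
  fix p assume p: "p \<in> topspace P"
  have "continuous_map X (subtopology Y D) (F p)"
    using continuous_mapsD(1)[OF compact_open_value[OF F p]] D[OF p]
    by (auto simp: continuous_map_in_subtopology)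
  from continuous_map_compose[OF this h] show "(\<lambda>x\<in>topspace X. h (F p x)) \<in> continuous_maps X Y'"
    by (intro continuous_mapsI) (simp add: o_def)
next
  fix K V assume K: "compactin X K" and V: "openin Y' V"
  have "openin (subtopology Y D) {y \<in> topspace (subtopology Y D). h y \<in> V}"
    by (rule openin_continuous_map_preimage[OF h V])
  then obtain T where T: "openin Y T" and TD: "{y \<in> topspace (subtopology Y D). h y \<in> V} = T \<inter> D"
    unfolding openin_subtopology by auto
  have KX: "x \<in> K \<Longrightarrow> x \<in> topspace X" for x using compactin_subset_topspace[OF K] by auto
  have "F p x \<in> T \<longleftrightarrow> h (F p x) \<in> V" if "p \<in> topspace P" "x \<in> K" for p x
  proof -
    have "F p x \<in> topspace (subtopology Y D)" "F p x \<in> D"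
      using D[OF that(1) KX[OF that(2)]] continuous_mapsD(3)[OF compact_open_value[OF F that(1)] KX[OF that(2)]]
      by simp_all
    then show ?thesis using TD by blast
  qed
  then have "{p \<in> topspace P. (\<lambda>x\<in>topspace X. h (F p x)) ` K \<subseteq> V} = {p \<in> topspace P. F p ` K \<subseteq> T}"
    using KX by auto
  then show "openin P {p \<in> topspace P. (\<lambda>x\<in>topspace X. h (F p x)) ` K \<subseteq> V}"
    using compact_open_preimage[OF F K T] by simp
qed

text \<open>A condition on the pair over a compact \<open>K\<close> must be split into conditions on
  the two components. Regularity of \<open>K\<close> covers it by finitely many compact pieces, each
  of which is sent into one open box contained in \<open>V\<close>.\<close>

lemma compact_open_pair:
  assumes X: "Hausdorff_space X" and F: "continuous_map P (CO X Y) F" and G: "continuous_map P (CO X Z) G"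
  shows "continuous_map P (CO X (prod_topology Y Z)) (\<lambda>p. \<lambda>x\<in>topspace X. (F p x, G p x))"
proof (rule continuous_map_into_compact_open)
  fix p assume p: "p \<in> topspace P"
  then show "(\<lambda>x\<in>topspace X. (F p x, G p x)) \<in> continuous_maps X (prod_topology Y Z)"
    using continuous_mapsD(1)[OF compact_open_value[OF F p]] continuous_mapsD(1)[OF compact_open_value[OF G p]]
    by (intro continuous_mapsI continuous_map_pairedI)
next
  fix K V assume K: "compactin X K" and V: "openin (prod_topology Y Z) V"
  have KX: "x \<in> K \<Longrightarrow> x \<in> topspace X" for x using compactin_subset_topspace[OF K] by auto
  \<comment> \<open>The Hausdorff hypothesis enters here: points of \<open>K\<close> have closed,
    hence compact, neighbourhoods inside any given neighbourhood.\<close>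
  have nb: "neighbourhood_base_of (closedin (subtopology X K)) (subtopology X K)"
    unfolding neighbourhood_base_of_closedin
    by (rule compact_Hausdorff_imp_regular_space) (simp_all add: K X compact_space_subtopology Hausdorff_space_subtopology)
  let ?W = "{p \<in> topspace P. \<forall>x\<in>K. (F p x, G p x) \<in> V}"
  have "\<exists>T. openin P T \<and> p \<in> T \<and> T \<subseteq> ?W" if p: "p \<in> ?W" for p
  proof -
    have pP: "p \<in> topspace P" using p by simp
    note cont = continuous_mapsD(1)[OF compact_open_value[OF F pP]] continuous_mapsD(1)[OF compact_open_value[OF G pP]]
    define R where "R x A B U C \<longleftrightarrow> openin Y A \<and> openin Z B \<and> A \<times> B \<subseteq> V \<and> openin (subtopology X K) U \<and>
            compactin X C \<and> x \<in> U \<and> U \<subseteq> C \<and> F p ` C \<subseteq> A \<and> G p ` C \<subseteq> B" for x A B U C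
    have "\<exists>A B U C. R x A B U C" if x: "x \<in> K" for x
    proof -
      obtain A B where AB: "openin Y A" "openin Z B" "F p x \<in> A" "G p x \<in> B" "A \<times> B \<subseteq> V"
        using V[unfolded openin_prod_topology_alt, rule_format, of "F p x" "G p x"] p x by auto
      define N where "N = {y \<in> topspace (subtopology X K). F p y \<in> A} \<inter> {y \<in> topspace (subtopology X K). G p y \<in> B}"
      have "openin (subtopology X K) N" unfolding N_def
        by (rule openin_Int; rule openin_continuous_map_preimage[OF _ AB(1)] openin_continuous_map_preimage[OF _ AB(2)];
            rule continuous_map_from_subtopology; rule cont)
      moreover have "x \<in> N" unfolding N_def using x AB KX by simp
      ultimately have "\<exists>U C. openin (subtopology X K) U \<and> closedin (subtopology X K) C \<and> x \<in> U \<and> U \<subseteq> C \<and> C \<subseteq> N"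
        using nb unfolding neighbourhood_base_of by simp
      then obtain U C where UC: "openin (subtopology X K) U" "closedin (subtopology X K) C" "x \<in> U" "U \<subseteq> C" "C \<subseteq> N"
        by blast
      have "compactin (subtopology X K) C"
        by (rule closedin_compact_space[OF _ UC(2)]) (simp add: compact_space_subtopology K)
      then have "compactin X C" by (simp add: compactin_subtopology)
      moreover have "F p ` C \<subseteq> A" "G p ` C \<subseteq> B" using UC(5) unfolding N_def by auto
      ultimately show ?thesis unfolding R_def using AB UC by blast
    qed
    then obtain A B U C where ABUC: "\<And>x. x \<in> K \<Longrightarrow> R x (A x) (B x) (U x) (C x)"
      by metis
    have "compactin (subtopology X K) K" using K by (simp add: compactin_subtopology)
    moreover have "K \<subseteq> \<Union>(U ` K)" using ABUC unfolding R_def by blast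
    moreover have "\<forall>u\<in>U ` K. openin (subtopology X K) u" using ABUC unfolding R_def by blast
    ultimately have "\<exists>\<F>. finite \<F> \<and> \<F> \<subseteq> U ` K \<and> K \<subseteq> \<Union>\<F>"
      unfolding compactin_def by blast
    then obtain S where S: "finite S" "S \<subseteq> K" "K \<subseteq> \<Union>(U ` S)"
      by (metis finite_subset_image)
    \<comment> \<open>The factor \<open>topspace P\<close> matters when \<open>K\<close> is empty:
      \<open>S\<close> may then be empty too, and the intersection over it is the whole
      type.\<close>
    define T where "T = topspace P \<inter> (\<Inter>x\<in>S. {q \<in> topspace P. F q ` C x \<subseteq> A x} \<inter> {q \<in> topspace P. G q ` C x \<subseteq> B x})"
    have "openin P T"
      unfolding T_def
    proof (rule openin_Int_Inter)
      fix M assume "M \<in> (\<lambda>x. {q \<in> topspace P. F q ` C x \<subseteq> A x} \<inter> {q \<in> topspace P. G q ` C x \<subseteq> B x}) ` S"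
      then obtain x where x: "x \<in> S" and M: "M = {q \<in> topspace P. F q ` C x \<subseteq> A x} \<inter> {q \<in> topspace P. G q ` C x \<subseteq> B x}"
        by blast
      have "R x (A x) (B x) (U x) (C x)" using ABUC S(2) x by blast
      then show "openin P M"
        unfolding M R_def by (intro openin_Int compact_open_preimage[OF F] compact_open_preimage[OF G]) simp_all
    qed (use S in simp_all)
    moreover have "p \<in> T" using pP S(2) ABUC unfolding T_def R_def by blast
    moreover have "T \<subseteq> ?W"
    proof
      fix q assume q: "q \<in> T"
      have "(F q x, G q x) \<in> V" if x: "x \<in> K" for x
      proof -
        obtain y where y: "y \<in> S" "x \<in> U y" using S(3) x by blast
        then have "x \<in> C y" "A y \<times> B y \<subseteq> V" using ABUC S(2) unfolding R_def by blast+
        moreover have "F q ` C y \<subseteq> A y" "G q ` C y \<subseteq> B y" using q y(1) unfolding T_def by blast+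
        ultimately show ?thesis by blast
      qed
      then show "q \<in> ?W" using q by (simp add: T_def)
    qed
    ultimately show ?thesis by blast
  qed
  then have "openin P ?W" by (subst openin_subopen) blast
  moreover have "?W = {p \<in> topspace P. (\<lambda>x\<in>topspace X. (F p x, G p x)) ` K \<subseteq> V}"
    using KX by auto
  ultimately show "openin P {p \<in> topspace P. (\<lambda>x\<in>topspace X. (F p x, G p x)) ` K \<subseteq> V}" by simp
qed

text \<open>Used to pass from maps on a disjoint union of intervals to loops on the circle.
  Restricted to the compact set \<open>X0\<close>, the map \<open>E\<close> is a continuous
  surjection from a compact space to a Hausdorff space, hence a quotient map. A compact set
  downstairs is the image of its preimage in \<open>X0\<close>, which is again compact.\<close>

lemma compact_open_descend:
  assumes F: "continuous_map P (CO X Z) F" and E: "continuous_map X Y E" and X0: "compactin X X0"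
    and surj: "E ` X0 = topspace Y" and Y: "Hausdorff_space Y"
    and G: "\<And>p. p \<in> topspace P \<Longrightarrow> G p \<in> extensional (topspace Y)"
    and GF: "\<And>p x. \<lbrakk>p \<in> topspace P; x \<in> X0\<rbrakk> \<Longrightarrow> G p (E x) = F p x"
  shows "continuous_map P (CO Y Z) G"
proof (rule continuous_map_into_compact_open)
  have top: "topspace (subtopology X X0) = X0" using compactin_subset_topspace[OF X0] by auto
  have quot: "quotient_map (subtopology X X0) Y E"
    by (rule continuous_imp_quotient_map)
       (use E X0 Y surj top in \<open>simp_all add: continuous_map_from_subtopology compact_space_subtopology\<close>)
  {
    fix p assume p: "p \<in> topspace P"
    have "continuous_map (subtopology X X0) Z (G p \<circ> E)"
      by (rule continuous_map_eq[OF continuous_map_from_subtopology[OF continuous_mapsD(1)[OF compact_open_value[OF F p]]]])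
         (use top GF[OF p] in auto)
    then have "continuous_map Y Z (G p)" by (rule continuous_compose_quotient_map[OF quot])
    then show "G p \<in> continuous_maps Y Z" using G[OF p] by (simp add: continuous_maps_def)
  }
  fix K V assume K: "compactin Y K" and V: "openin Z V"
  have "closedin X {x \<in> topspace X. E x \<in> K}"
    by (rule closedin_continuous_map_preimage[OF E compactin_imp_closedin[OF Y K]])
  from closed_Int_compactin[OF this X0] have "compactin X ({x \<in> topspace X. E x \<in> K} \<inter> X0)" .
  from compact_open_preimage[OF F this V]
  have "openin P {p \<in> topspace P. F p ` ({x \<in> topspace X. E x \<in> K} \<inter> X0) \<subseteq> V}" .
  moreover have "F p ` ({x \<in> topspace X. E x \<in> K} \<inter> X0) = G p ` K" if p: "p \<in> topspace P" for p
  proof -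
    have "K \<subseteq> E ` X0" using compactin_subset_topspace[OF K] surj by simp
    then have "K = E ` ({x \<in> topspace X. E x \<in> K} \<inter> X0)" using compactin_subset_topspace[OF X0] by blast
    then have "G p ` K = G p ` E ` ({x \<in> topspace X. E x \<in> K} \<inter> X0)" by simp
    also have "\<dots> = F p ` ({x \<in> topspace X. E x \<in> K} \<inter> X0)"
      unfolding image_image by (rule image_cong) (use GF[OF p] in auto)
    finally show ?thesis by simp
  qed
  ultimately show "openin P {p \<in> topspace P. G p ` K \<subseteq> V}"
    by (smt (verit) Collect_cong)
qed

text \<open>Membership in a subbasic set depends only on the values on one compact set; finite
  intersections and unions preserve the property of being entered eventually.\<close>

lemma compact_open_eventually:
  assumes N: "openin (CO X Y) N" and g: "g \<in> N" and gn: "\<And>n. g_n n \<in> continuous_maps X Y"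
    and ev: "\<And>K. compactin X K \<Longrightarrow> \<forall>\<^sub>F n in F. \<forall>x\<in>K. g_n n x = g x"
  shows "\<forall>\<^sub>F n in F. g_n n \<in> N"
proof -
  have "generate_topology_on {{f \<in> continuous_maps X Y. f ` K \<subseteq> V} | K V. compactin X K \<and> openin Y V} N"
    using N unfolding compact_open_topology_def openin_topology_generated_by_iff .
  then show ?thesis using g
  proof induction
    case (Int a b) then show ?case by (simp add: eventually_conj_iff)
  next
    case (UN A)
    then obtain k where "k \<in> A" "g \<in> k" by blast
    from UN.IH[OF this] show ?case by (rule eventually_mono) (use \<open>k \<in> A\<close> in blast)
  next
    case (Basis s)
    then obtain K V where s: "s = {f \<in> continuous_maps X Y. f ` K \<subseteq> V}" "compactin X K" by blast
    from ev[OF s(2)] show ?case by (rule eventually_mono) (use Basis.prems s gn in auto)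
  qed simp
qed

section \<open>Covers of the circle\<close>

text \<open>The part of admissibility that ignores epsilon and the triple intersections. Unlike
  admissibility itself, it passes to unions of two point sets.\<close>

definition point_set :: "real set \<Rightarrow> bool" where
  "point_set Q \<longleftrightarrow> finite Q \<and> Q \<noteq> {} \<and> Q \<subseteq> {0<..1}"

text \<open>Ends before thickening. The half-open intervals from \<open>left_end\<close> to
  \<open>right_end\<close> partition the real line, which makes the order of pieces and the
  canonical coarsening easy to control.\<close>

definition left_end :: "piece \<Rightarrow> real" where
  "left_end \<beta> = fst \<beta> + of_int (snd \<beta>)"

definition right_end :: "real set \<Rightarrow> piece \<Rightarrow> real" where
  "right_end Q \<beta> = next_point Q (fst \<beta>) + of_int (snd \<beta>)"

lemma interval_of_eq: "interval_of W \<beta> = {left_end \<beta> - snd W <..< right_end (fst W) \<beta> + snd W}"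
proof -
  have "x \<in> interval_of W \<beta>" if "x \<in> {left_end \<beta> - snd W <..< right_end (fst W) \<beta> + snd W}" for x
    unfolding interval_of_def
    by (rule image_eqI[of _ _ "x - of_int (snd \<beta>)"])
       (use that in \<open>auto simp: base_interval_def left_end_def right_end_def\<close>)
  then show ?thesis
    by (auto simp: interval_of_def base_interval_def left_end_def right_end_def)
qed

lemma left_end_shift [simp]: "left_end (shift_piece l \<beta>) = left_end \<beta> + of_int l"
  and right_end_shift [simp]: "right_end Q (shift_piece l \<beta>) = right_end Q \<beta> + of_int l"
  by (simp_all add: left_end_def right_end_def shift_piece_def)

lemma shift_piece_simps [simp]:
  "fst (shift_piece l \<beta>) = fst \<beta>" "snd (shift_piece l \<beta>) = snd \<beta> + l"
  "shift_piece l (shift_piece m \<beta>) = shift_piece (l + m) \<beta>" "shift_piece 0 \<beta> = \<beta>"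
  by (simp_all add: shift_piece_def)

lemma interval_of_shift [simp]: "x + of_int l \<in> interval_of W (shift_piece l \<beta>) \<longleftrightarrow> x \<in> interval_of W \<beta>"
  by (auto simp: interval_of_eq)

lemma pieces_shift [simp]: "shift_piece l \<beta> \<in> pieces W \<longleftrightarrow> \<beta> \<in> pieces W"
  by (cases \<beta>) (simp add: shift_piece_def pieces_def)

context
  fixes Q :: "real set"
  assumes Q: "point_set Q"
begin

lemma point_set_facts: "finite Q" "Q \<noteq> {}" "q \<in> Q \<Longrightarrow> 0 < q" "q \<in> Q \<Longrightarrow> q \<le> 1" "Min Q \<in> Q" "0 < Min Q"
  "q \<in> Q \<Longrightarrow> Min Q \<le> q"
  using Q by (auto simp: point_set_def subset_iff)

lemma next_point_le: "\<lbrakk>r \<in> Q; q < r\<rbrakk> \<Longrightarrow> next_point Q q \<le> r"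
  using point_set_facts(1) by (auto simp: next_point_def)

lemma next_point_cases:
  "next_point Q q \<in> Q \<and> q < next_point Q q \<or> (\<forall>r\<in>Q. r \<le> q) \<and> next_point Q q = Min Q + 1"
proof (cases "\<exists>r\<in>Q. q < r")
  case True
  then have "Min {r \<in> Q. q < r} \<in> {r \<in> Q. q < r}" using point_set_facts(1) by (intro Min_in) auto
  then show ?thesis using True by (simp add: next_point_def)
qed (auto simp: next_point_def not_less)

lemma next_point_gt: "q \<in> Q \<Longrightarrow> q < next_point Q q"
  using next_point_cases[of q] point_set_facts(4)[of q] point_set_facts(6) by auto

lemma next_point_le_Min: "next_point Q q \<le> Min Q + 1"
  using next_point_cases[of q] point_set_facts(4)[of "next_point Q q"] point_set_facts(6) by auto

lemma left_end_less_right_end: "fst \<beta> \<in> Q \<Longrightarrow> left_end \<beta> < right_end Q \<beta>"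
  by (simp add: left_end_def right_end_def next_point_gt)

text \<open>Compare the integer shifts. A smaller shift is settled by \<open>next_point\<close>
  being at most \<open>Min Q + 1\<close>, equal shifts by the minimality of
  \<open>next_point\<close>, and a larger shift contradicts the order of the left ends because all
  points lie in (0,1].\<close>

lemma right_end_le_left_end:
  assumes "fst \<beta> \<in> Q" "fst \<gamma> \<in> Q" "left_end \<beta> < left_end \<gamma>"
  shows "right_end Q \<beta> \<le> left_end \<gamma>"
proof (cases "snd \<beta>" "snd \<gamma>" rule: linorder_cases)
  case less
  then have "of_int (snd \<beta>) + 1 \<le> (of_int (snd \<gamma>) :: real)" by linarith
  then show ?thesis
    using next_point_le_Min[of "fst \<beta>"] point_set_facts(7)[OF assms(2)]
    by (simp add: left_end_def right_end_def)
next
  case equal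
  then show ?thesis using next_point_le[of "fst \<gamma>" "fst \<beta>"] assms by (simp add: left_end_def right_end_def)
next
  case greater
  then have "of_int (snd \<gamma>) + 1 \<le> (of_int (snd \<beta>) :: real)" by linarith
  then show ?thesis
    using point_set_facts(3)[OF assms(1)] point_set_facts(4)[OF assms(2)] assms(3) by (simp add: left_end_def)
qed

lemma left_end_inject:
  assumes "fst \<beta> \<in> Q" "fst \<gamma> \<in> Q" "left_end \<beta> = left_end \<gamma>"
  shows "\<beta> = \<gamma>"
proof -
  have "\<bar>real_of_int (snd \<beta> - snd \<gamma>)\<bar> < 1"
    using assms point_set_facts(3,4)[OF assms(1)] point_set_facts(3,4)[OF assms(2)]
    by (auto simp: left_end_def)
  then have "snd \<beta> = snd \<gamma>" by linarith
  then show ?thesis using assms(3) by (simp add: left_end_def prod_eq_iff)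
qed

lemma piece_unique:
  assumes "fst \<beta> \<in> Q" "fst \<gamma> \<in> Q" "left_end \<beta> \<le> x" "x < right_end Q \<beta>" "left_end \<gamma> \<le> x" "x < right_end Q \<gamma>"
  shows "\<beta> = \<gamma>"
  using right_end_le_left_end[of \<beta> \<gamma>] right_end_le_left_end[of \<gamma> \<beta>] left_end_inject[of \<beta> \<gamma>] assms
  by (cases "left_end \<beta>" "left_end \<gamma>" rule: linorder_cases) auto

lemma piece_exists:
  obtains \<beta> where "fst \<beta> \<in> Q" "left_end \<beta> \<le> x" "x < right_end Q \<beta>"
proof -
  \<comment> \<open>The shift moves \<open>x\<close> into the period starting at
    \<open>Min Q\<close>, where some point of \<open>Q\<close> lies at or below it; the largest such
    point names the interval.\<close>
  define k where "k = \<lfloor>x - Min Q\<rfloor>"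
  define y where "y = x - of_int k"
  have y: "Min Q \<le> y" "y < Min Q + 1" unfolding y_def k_def by linarith+
  define q where "q = Max {r \<in> Q. r \<le> y}"
  have "q \<in> {r \<in> Q. r \<le> y}" unfolding q_def
    by (rule Max_in) (use y(1) point_set_facts(1,5) in auto)
  then have q: "q \<in> Q" "q \<le> y" by auto
  have "\<not> next_point Q q \<le> y"
  proof
    assume *: "next_point Q q \<le> y"
    then have "next_point Q q \<in> Q" using next_point_cases[of q] y by auto
    then have "next_point Q q \<le> Max {r \<in> Q. r \<le> y}" using * point_set_facts(1) by (intro Max_ge) auto
    then have "next_point Q q \<le> q" by (simp only: q_def)
    then show False using next_point_gt[OF q(1)] by simp
  qed
  then show thesis
    using q y that[of "(q, k)"] by (simp add: left_end_def right_end_def y_def)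
qed

lemma right_end_is_left_end:
  assumes "fst \<beta> \<in> Q"
  obtains \<gamma> where "fst \<gamma> \<in> Q" "right_end Q \<beta> = left_end \<gamma>"
  using next_point_cases[of "fst \<beta>"]
proof (elim disjE conjE)
  assume "next_point Q (fst \<beta>) \<in> Q"
  then show thesis using that[of "(next_point Q (fst \<beta>), snd \<beta>)"] by (simp add: left_end_def right_end_def)
next
  assume "next_point Q (fst \<beta>) = Min Q + 1"
  then show thesis
    using that[of "(Min Q, snd \<beta> + 1)"] point_set_facts by (simp add: left_end_def right_end_def)
qed

lemma coarse_piece_unique:
  assumes "fst \<gamma> \<in> Q" "left_end \<gamma> \<le> left_end \<beta>" "left_end \<beta> < right_end Q \<gamma>"
  shows "coarse_piece Q \<beta> = \<gamma>"
  unfolding coarse_piece_def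
proof (rule the_equality)
  show "case \<gamma> of (q, m) \<Rightarrow> q \<in> Q \<and> q + real_of_int m \<le> fst \<beta> + real_of_int (snd \<beta>) \<and>
      fst \<beta> + real_of_int (snd \<beta>) < next_point Q q + real_of_int m"
    using assms by (simp add: split_beta left_end_def right_end_def)
next
  fix \<delta> :: piece assume "case \<delta> of (q, m) \<Rightarrow> q \<in> Q \<and> q + real_of_int m \<le> fst \<beta> + real_of_int (snd \<beta>) \<and>
      fst \<beta> + real_of_int (snd \<beta>) < next_point Q q + real_of_int m"
  then show "\<delta> = \<gamma>" using assms
    by (intro piece_unique[of \<delta> \<gamma> "left_end \<beta>"]) (simp_all add: split_beta left_end_def right_end_def)
qed

lemma coarse_piece:
  "fst (coarse_piece Q \<beta>) \<in> Q" "left_end (coarse_piece Q \<beta>) \<le> left_end \<beta>"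
  "left_end \<beta> < right_end Q (coarse_piece Q \<beta>)"
proof -
  obtain \<gamma> where "fst \<gamma> \<in> Q" "left_end \<gamma> \<le> left_end \<beta>" "left_end \<beta> < right_end Q \<gamma>"
    using piece_exists[of "left_end \<beta>"] by blast
  moreover from this have "coarse_piece Q \<beta> = \<gamma>" by (rule coarse_piece_unique)
  ultimately show "fst (coarse_piece Q \<beta>) \<in> Q" "left_end (coarse_piece Q \<beta>) \<le> left_end \<beta>"
    "left_end \<beta> < right_end Q (coarse_piece Q \<beta>)" by simp_all
qed

lemma coarse_piece_shift: "coarse_piece Q (shift_piece l \<beta>) = shift_piece l (coarse_piece Q \<beta>)"
  using coarse_piece by (intro coarse_piece_unique) simp_all

lemma coarse_piece_id: "fst \<beta> \<in> Q \<Longrightarrow> coarse_piece Q \<beta> = \<beta>"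
  by (intro coarse_piece_unique) (simp_all add: left_end_less_right_end)

end

text \<open>The right end of a coarse interval is the left end of the next coarse one, hence also
  the left end of a fine interval. No fine interval that starts before it can reach past it.\<close>

lemma right_end_coarse_piece:
  assumes Q: "point_set Q" "point_set Q'" "Q \<subseteq> Q'" and \<beta>: "fst \<beta> \<in> Q'"
  shows "right_end Q' \<beta> \<le> right_end Q (coarse_piece Q \<beta>)"
proof -
  obtain \<gamma> where "fst \<gamma> \<in> Q" "right_end Q (coarse_piece Q \<beta>) = left_end \<gamma>"
    using right_end_is_left_end[OF Q(1) coarse_piece(1)[OF Q(1)]] by metis
  then show ?thesis
    using right_end_le_left_end[OF Q(2) \<beta>, of \<gamma>] coarse_piece(3)[OF Q(1), of \<beta>] Q(3) by auto
qed

text \<open>The unthickened intervals nest, so the left end of \<beta> stays inside the coarse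
  interval that contains the intermediate one; this characterises the direct coarsening.\<close>

lemma coarse_piece_trans:
  assumes Q: "point_set Q" "point_set Q'" "Q \<subseteq> Q'"
  shows "coarse_piece Q (coarse_piece Q' \<beta>) = coarse_piece Q \<beta>"
proof (rule coarse_piece_unique[OF Q(1), symmetric])
  let ?\<gamma> = "coarse_piece Q' \<beta>"
  show "fst (coarse_piece Q ?\<gamma>) \<in> Q" by (rule coarse_piece[OF Q(1)])
  show "left_end (coarse_piece Q ?\<gamma>) \<le> left_end \<beta>"
    using coarse_piece(2)[OF Q(1), of ?\<gamma>] coarse_piece(2)[OF Q(2), of \<beta>] by simp
  show "left_end \<beta> < right_end Q (coarse_piece Q ?\<gamma>)"
    using coarse_piece(3)[OF Q(2), of \<beta>] right_end_coarse_piece[OF Q coarse_piece(1)[OF Q(2)], of \<beta>] by simp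
qed

lemma admissible_point_set: "W \<in> admissible_covers \<Longrightarrow> point_set (fst W)"
  and admissible_pos: "W \<in> admissible_covers \<Longrightarrow> 0 < snd W"
  by (simp_all add: admissible_covers_def point_set_def)

lemma interval_of_coarse_piece:
  assumes "W \<in> admissible_covers" "W' \<in> admissible_covers" "cover_refines W' W" "\<beta> \<in> pieces W'"
  shows "interval_of W' \<beta> \<subseteq> interval_of W (coarse_piece (fst W) \<beta>)"
  using right_end_coarse_piece[of "fst W" "fst W'" \<beta>] coarse_piece(2)[of "fst W" \<beta>] assms
    admissible_point_set[of W] admissible_point_set[of W']
  unfolding interval_of_eq cover_refines_def pieces_def by (auto simp: mem_Times_iff)

lemma cis_eq_iff: "cis (2 * pi * x) = cis (2 * pi * y) \<longleftrightarrow> (\<exists>k::int. y = x + of_int k)"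
proof -
  have "cis (2 * pi * x) = cis (2 * pi * y) \<longleftrightarrow> sin (2 * pi * y) = sin (2 * pi * x) \<and> cos (2 * pi * y) = cos (2 * pi * x)"
    by (auto simp: complex_eq_iff)
  also have "\<dots> \<longleftrightarrow> (\<exists>k::int. 2 * pi * y = 2 * pi * x + 2 * pi * of_int k)"
    by (simp add: sin_cos_eq_iff)
  also have "\<dots> \<longleftrightarrow> (\<exists>k::int. y = x + of_int k)"
  proof -
    have "2 * pi * y = 2 * pi * x + 2 * pi * of_int k \<longleftrightarrow> y = x + of_int k" for k :: int
      unfolding distrib_left[symmetric] by simp
    then show ?thesis by simp
  qed
  finally show ?thesis .
qed

text \<open>On the line, two thickened intervals with a third one between them are separated as soon
  as the middle one has length at least twice epsilon. A triple intersection on the circle lifts to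
  one on the line, where one of the three intervals is always in the middle.\<close>

lemma admissibleI:
  assumes Q: "point_set Q" and \<epsilon>: "0 < \<epsilon>" and gap: "\<And>q. q \<in> Q \<Longrightarrow> 2 * \<epsilon> \<le> next_point Q q - q"
  shows "(Q, \<epsilon>) \<in> admissible_covers"
proof -
  have ordered: False
    if "fst \<beta> \<in> Q" "fst \<gamma> \<in> Q" "fst \<delta> \<in> Q" "left_end \<beta> < left_end \<gamma>" "left_end \<gamma> < left_end \<delta>"
      "x \<in> interval_of (Q, \<epsilon>) \<beta>" "x \<in> interval_of (Q, \<epsilon>) \<delta>" for \<beta> \<gamma> \<delta> x
    using right_end_le_left_end[OF Q, of \<beta> \<gamma>] right_end_le_left_end[OF Q, of \<gamma> \<delta>] gap[of "fst \<gamma>"] that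
    by (auto simp: interval_of_eq left_end_def right_end_def)
  have False
    if q: "q \<in> Q" "r \<in> Q" "u \<in> Q" "q \<noteq> r" "q \<noteq> u" "r \<noteq> u"
      and z: "z \<in> (\<lambda>x. cis (2 * pi * x)) ` base_interval (Q, \<epsilon>) q"
         "z \<in> (\<lambda>x. cis (2 * pi * x)) ` base_interval (Q, \<epsilon>) r"
         "z \<in> (\<lambda>x. cis (2 * pi * x)) ` base_interval (Q, \<epsilon>) u" for q r u z
  proof -
    obtain x where x: "z = cis (2 * pi * x)" "x \<in> base_interval (Q, \<epsilon>) q" using z(1) by blast
    \<comment> \<open>Lifting: all three arcs are represented by translates containing the same real
      number \<open>x\<close>.\<close>
    have piece: "\<exists>k. x \<in> interval_of (Q, \<epsilon>) (s, k)"
      if s: "z \<in> (\<lambda>x. cis (2 * pi * x)) ` base_interval (Q, \<epsilon>) s" for s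
    proof -
      obtain y where "z = cis (2 * pi * y)" and y: "y \<in> base_interval (Q, \<epsilon>) s" using s by blast
      then obtain k :: int where "x = y + of_int k" using x(1) cis_eq_iff by metis
      then show ?thesis using y by (auto simp: interval_of_def)
    qed
    obtain k l m where klm: "x \<in> interval_of (Q, \<epsilon>) (q, k)" "x \<in> interval_of (Q, \<epsilon>) (r, l)" "x \<in> interval_of (Q, \<epsilon>) (u, m)"
      using piece z by metis
    have "left_end (q, k) \<noteq> left_end (r, l)" "left_end (q, k) \<noteq> left_end (u, m)" "left_end (r, l) \<noteq> left_end (u, m)"
      using left_end_inject[OF Q] q by fastforce+
    then show False
      using ordered[of "(q, k)" "(r, l)" "(u, m)" x] ordered[of "(q, k)" "(u, m)" "(r, l)" x]
        ordered[of "(r, l)" "(q, k)" "(u, m)" x] ordered[of "(r, l)" "(u, m)" "(q, k)" x]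
        ordered[of "(u, m)" "(q, k)" "(r, l)" x] ordered[of "(u, m)" "(r, l)" "(q, k)" x] klm q
      by (simp add: linorder_neq_iff) linarith
  qed
  then have "(\<forall>q\<in>Q. \<forall>r\<in>Q. \<forall>u\<in>Q. q \<noteq> r \<and> q \<noteq> u \<and> r \<noteq> u \<longrightarrow>
     (let c = (\<lambda>q. (\<lambda>x. cis (2 * pi * x)) ` base_interval (Q, \<epsilon>) q) in c q \<inter> c r \<inter> c u = {}))"
    unfolding Let_def by (intro ballI impI equals0I) blast
  then show ?thesis
    using Q \<epsilon> unfolding admissible_covers_def point_set_def by simp
qed

text \<open>The bound is half of the smallest gap between consecutive points, the gap across the
  period included.\<close>

lemma admissible_margin:
  assumes "point_set Q"
  obtains \<delta> where "0 < \<delta>" "\<And>\<epsilon>. \<lbrakk>0 < \<epsilon>; \<epsilon> \<le> \<delta>\<rbrakk> \<Longrightarrow> (Q, \<epsilon>) \<in> admissible_covers"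
proof -
  define \<delta> where "\<delta> = Min ((\<lambda>q. (next_point Q q - q) / 2) ` Q)"
  have fin: "finite Q" "Q \<noteq> {}" using assms by (simp_all add: point_set_def)
  have "0 < \<delta>" unfolding \<delta>_def
    using fin next_point_gt[OF assms] by (subst Min_gr_iff) auto
  moreover have "(Q, \<epsilon>) \<in> admissible_covers" if \<epsilon>: "0 < \<epsilon>" "\<epsilon> \<le> \<delta>" for \<epsilon>
  proof (rule admissibleI[OF assms \<epsilon>(1)])
    fix q assume "q \<in> Q"
    then have "\<delta> \<le> (next_point Q q - q) / 2" unfolding \<delta>_def using fin by (intro Min_le) auto
    then show "2 * \<epsilon> \<le> next_point Q q - q" using \<epsilon>(2) by simp
  qed
  ultimately show thesis by (rule that)
qed

text \<open>The union of the two point sets may have smaller gaps than either set, so epsilon must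
  be bounded by the margin of the union besides the two given values.\<close>

lemma covers_directed:
  assumes "W \<in> admissible_covers" "W' \<in> admissible_covers"
  shows "\<exists>V\<in>admissible_covers. cover_refines V W \<and> cover_refines V W'"
proof -
  have "point_set (fst W \<union> fst W')"
    using admissible_point_set[OF assms(1)] admissible_point_set[OF assms(2)] by (auto simp: point_set_def)
  then obtain \<delta> where "0 < \<delta>" "\<And>\<epsilon>. \<lbrakk>0 < \<epsilon>; \<epsilon> \<le> \<delta>\<rbrakk> \<Longrightarrow> (fst W \<union> fst W', \<epsilon>) \<in> admissible_covers"
    using admissible_margin by metis
  then have "(fst W \<union> fst W', min \<delta> (min (snd W) (snd W'))) \<in> admissible_covers"
    using admissible_pos[OF assms(1)] admissible_pos[OF assms(2)] by simp
  then show ?thesis by (rule bexI[rotated]) (simp add: cover_refines_def min.coboundedI1 min.coboundedI2)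
qed

lemma cover_refines_refl: "cover_refines W W"
  and cover_refines_trans: "\<lbrakk>cover_refines W W'; cover_refines W' W''\<rbrakk> \<Longrightarrow> cover_refines W W''"
  by (auto simp: cover_refines_def)

lemma admissible_shrink:
  assumes "W \<in> admissible_covers" "0 < \<epsilon>" "\<epsilon> \<le> snd W"
  shows "(fst W, \<epsilon>) \<in> admissible_covers"
proof -
  have "base_interval (fst W, \<epsilon>) q \<subseteq> base_interval W q" for q
    using assms(3) by (auto simp: base_interval_def)
  then have sub: "(\<lambda>x. cis (2 * pi * x)) ` base_interval (fst W, \<epsilon>) q \<subseteq> (\<lambda>x. cis (2 * pi * x)) ` base_interval W q" for q
    by (rule image_mono)
  have mono: "A' \<inter> B' \<inter> C' = {}" if "A \<inter> B \<inter> C = {}" "A' \<subseteq> A" "B' \<subseteq> B" "C' \<subseteq> C" for A B C A' B' C' :: "complex set"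
    using that by blast
  show ?thesis
    using assms unfolding admissible_covers_def mem_Collect_eq fst_conv snd_conv Let_def
    by (intro conjI ballI impI mono[OF _ sub sub sub]) simp_all
qed

section \<open>Disjoint unions of subspaces\<close>

lemma sum_topology_const: "sum_topology (\<lambda>i. X) I = prod_topology (discrete_topology I) X"
proof -
  have "openin (sum_topology (\<lambda>i. X) I) S \<longleftrightarrow> openin (prod_topology (discrete_topology I) X) S" for S
  proof
    assume S: "openin (sum_topology (\<lambda>i. X) I) S"
    show "openin (prod_topology (discrete_topology I) X) S"
      unfolding openin_prod_topology_alt
    proof (intro allI impI)
      fix i x assume ix: "(i, x) \<in> S"
      then show "\<exists>A B. openin (discrete_topology I) A \<and> openin X B \<and> i \<in> A \<and> x \<in> B \<and> A \<times> B \<subseteq> S"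
        using S by (intro exI[of _ "{i}"] exI[of _ "{x. (i, x) \<in> S}"]) (auto simp: openin_sum_topology)
    qed
  next
    assume S: "openin (prod_topology (discrete_topology I) X) S"
    have "S \<subseteq> I \<times> topspace X" using openin_subset[OF S] by simp
    moreover have "openin X {x. (i, x) \<in> S}" if "i \<in> I" for i
    proof -
      have "continuous_map X (prod_topology (discrete_topology I) X) (\<lambda>x. (i, x))"
        using that by (simp add: continuous_map_paired)
      from openin_continuous_map_preimage[OF this S] have "openin X {x \<in> topspace X. (i, x) \<in> S}" .
      moreover have "{x \<in> topspace X. (i, x) \<in> S} = {x. (i, x) \<in> S}" using \<open>S \<subseteq> I \<times> topspace X\<close> by blast
      ultimately show ?thesis by simp
    qed
    ultimately show "openin (sum_topology (\<lambda>i. X) I) S" by (auto simp: openin_sum_topology)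
  qed
  then show ?thesis by (simp add: topology_eq)
qed

text \<open>A disjoint union of subspaces of one space sits inside a product with a discrete space.
  Continuity into it thus splits into a locally constant index and a continuous point, with a
  pointwise membership condition.\<close>

lemma sum_topology_subtopology:
  "sum_topology (\<lambda>i. subtopology X (U i)) I = subtopology (prod_topology (discrete_topology I) X) (Sigma I U)"
  by (simp add: subtopology_sum_topology[symmetric] sum_topology_const)

lemma continuous_map_into_sum:
  "continuous_map Z (sum_topology (\<lambda>i. subtopology X (U i)) I) f \<longleftrightarrow>
     continuous_map Z (discrete_topology I) (\<lambda>z. fst (f z)) \<and> continuous_map Z X (\<lambda>z. snd (f z)) \<and>
     (\<forall>z\<in>topspace Z. snd (f z) \<in> U (fst (f z)))"
proof -
  have "fst (f z) \<in> I" if "continuous_map Z (discrete_topology I) (\<lambda>z. fst (f z))" "z \<in> topspace Z" for z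
    using continuous_map_funspace[OF that(1)] that(2) by auto
  then show ?thesis
    unfolding sum_topology_subtopology continuous_map_in_subtopology continuous_map_pairwise o_def
    by (auto simp: Pi_iff mem_Sigma_iff) (metis mem_Sigma_iff prod.collapse)+
qed

lemma continuous_map_from_sum:
  "continuous_map (sum_topology (\<lambda>i. subtopology X (U i)) I) (discrete_topology I) fst"
  "continuous_map (sum_topology (\<lambda>i. subtopology X (U i)) I) X snd"
  unfolding sum_topology_subtopology by (rule continuous_map_from_subtopology, rule continuous_map_fst continuous_map_snd)+

lemma Hausdorff_sum_subtopology:
  "Hausdorff_space X \<Longrightarrow> Hausdorff_space (sum_topology (\<lambda>i. subtopology X (U i)) I)"
  unfolding sum_topology_subtopology by (intro Hausdorff_space_subtopology) (simp add: Hausdorff_space_prod_topology)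

lemma continuous_map_discrete_compose:
  "\<lbrakk>continuous_map X (discrete_topology D) g; h \<in> D \<rightarrow> topspace Y\<rbrakk> \<Longrightarrow> continuous_map X Y (\<lambda>x. h (g x))"
  using continuous_map_compose[of X "discrete_topology D" g Y h] by (simp add: o_def)

lemma continuous_map_discrete_pair:
  assumes "continuous_map X (discrete_topology A) f" "continuous_map X (discrete_topology B) g"
  shows "continuous_map X (discrete_topology (A \<times> B)) (\<lambda>x. (f x, g x))"
  unfolding prod_topology_discrete_topology using assms by (simp add: continuous_map_paired)

section \<open>The circle groupoids\<close>

abbreviation "cobj W \<equiv> Obj (circle_groupoid W)"
abbreviation "carr W \<equiv> Arr (circle_groupoid W)"

lemma cobj_eq: "cobj W = sum_topology (\<lambda>\<beta>. top_of_set (interval_of W \<beta>)) (pieces W)"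
  and carr_eq: "carr W = prod_topology (sum_topology (\<lambda>\<eta>. top_of_set (interval_of W (fst \<eta>) \<inter> interval_of W (snd \<eta>)))
                 (pieces W \<times> pieces W)) (discrete_topology UNIV)"
  by (simp_all add: circle_groupoid_def case_prod_unfold)

lemma mem_cobj: "p \<in> topspace (cobj W) \<longleftrightarrow> fst p \<in> pieces W \<and> snd p \<in> interval_of W (fst p)"
  by (cases p) (simp add: cobj_eq)

lemma mem_carr_iff:
  "r \<in> topspace (carr W) \<longleftrightarrow> fst (fst (fst r)) \<in> pieces W \<and> snd (fst (fst r)) \<in> pieces W \<and>
     snd (fst r) \<in> interval_of W (fst (fst (fst r))) \<and> snd (fst r) \<in> interval_of W (snd (fst (fst r)))"
  by (cases r, cases "fst r", cases "fst (fst r)") (auto simp: carr_eq)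

lemma mem_carr:
  "(((\<beta>, \<gamma>), x), l) \<in> topspace (carr W) \<longleftrightarrow> \<beta> \<in> pieces W \<and> \<gamma> \<in> pieces W \<and> x \<in> interval_of W \<beta> \<and> x \<in> interval_of W \<gamma>"
  by (auto simp: carr_eq)

lemma circle_groupoid_simps [simp]:
  "src (circle_groupoid W) (((\<beta>, \<gamma>), x), l) = (\<beta>, x)"
  "tgt (circle_groupoid W) (((\<beta>, \<gamma>), x), l) = (shift_piece l \<gamma>, x + of_int l)"
  "idt (circle_groupoid W) (\<beta>, x) = (((\<beta>, \<beta>), x), 0)"
  "ivt (circle_groupoid W) (((\<beta>, \<gamma>), x), l) = (((shift_piece l \<gamma>, shift_piece l \<beta>), x + of_int l), - l)"
  "cmp (circle_groupoid W) (((\<beta>, \<gamma>), x), l) (((\<gamma>', \<sigma>), y), k) = (((\<beta>, shift_piece (- l) \<sigma>), x), l + k)"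
  by (simp_all add: circle_groupoid_def)

lemma src_circle: "src (circle_groupoid W) r = (fst (fst (fst r)), snd (fst r))"
  and tgt_circle: "tgt (circle_groupoid W) r = (shift_piece (snd r) (snd (fst (fst r))), snd (fst r) + of_int (snd r))"
  and idt_circle: "idt (circle_groupoid W) p = (((fst p, fst p), snd p), 0)"
  by (cases r rule: prod.exhaust, auto simp: circle_groupoid_def split_beta)+

lemma circle_closed:
  "r \<in> topspace (carr W) \<Longrightarrow> src (circle_groupoid W) r \<in> topspace (cobj W)"
  "r \<in> topspace (carr W) \<Longrightarrow> tgt (circle_groupoid W) r \<in> topspace (cobj W)"
  "p \<in> topspace (cobj W) \<Longrightarrow> idt (circle_groupoid W) p \<in> topspace (carr W)"
  "r \<in> topspace (carr W) \<Longrightarrow> ivt (circle_groupoid W) r \<in> topspace (carr W)"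
  "p \<in> topspace (cobj W) \<Longrightarrow> src (circle_groupoid W) (idt (circle_groupoid W) p) = p"
  "p \<in> topspace (cobj W) \<Longrightarrow> tgt (circle_groupoid W) (idt (circle_groupoid W) p) = p"
  "r \<in> topspace (carr W) \<Longrightarrow> src (circle_groupoid W) (ivt (circle_groupoid W) r) = tgt (circle_groupoid W) r"
  "r \<in> topspace (carr W) \<Longrightarrow> tgt (circle_groupoid W) (ivt (circle_groupoid W) r) = src (circle_groupoid W) r"
  by (cases r, cases "fst r", cases "fst (fst r)"; cases p; simp add: mem_cobj mem_carr)+

lemma circle_cmp:
  assumes "(a, b) \<in> composable (circle_groupoid W)"
  shows "cmp (circle_groupoid W) a b \<in> topspace (carr W)"
    "src (circle_groupoid W) (cmp (circle_groupoid W) a b) = src (circle_groupoid W) a"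
    "tgt (circle_groupoid W) (cmp (circle_groupoid W) a b) = tgt (circle_groupoid W) b"
proof -
  obtain \<beta> \<gamma> x l where a: "a = (((\<beta>, \<gamma>), x), l)" by (metis surj_pair)
  obtain \<gamma>' \<sigma> y k where b: "b = (((\<gamma>', \<sigma>), y), k)" by (metis surj_pair)
  have *: "\<gamma>' = shift_piece l \<gamma>" "y = x + of_int l" using assms by (simp_all add: composable_def a b)
  \<comment> \<open>The composite arrow is based at \<open>x\<close>, so the interval
    \<open>\<sigma>\<close>, met only after moving by \<open>l\<close>, has to be moved
    back.\<close>
  have "x \<in> interval_of W (shift_piece (- l) \<sigma>) \<longleftrightarrow> y \<in> interval_of W \<sigma>"
    using interval_of_shift[of x l W "shift_piece (- l) \<sigma>"] by (simp add: *)
  then show "cmp (circle_groupoid W) a b \<in> topspace (carr W)"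
    "src (circle_groupoid W) (cmp (circle_groupoid W) a b) = src (circle_groupoid W) a"
    "tgt (circle_groupoid W) (cmp (circle_groupoid W) a b) = tgt (circle_groupoid W) b"
    using assms unfolding composable_def a b by (simp_all add: mem_carr * add.commute)
qed

lemma Hausdorff_cobj: "Hausdorff_space (cobj W)"
  unfolding cobj_eq by (rule Hausdorff_sum_subtopology) simp

lemma Hausdorff_carr: "Hausdorff_space (carr W)"
  unfolding carr_eq by (simp add: Hausdorff_space_prod_topology Hausdorff_sum_subtopology)

lemma continuous_cobj:
  "continuous_map (cobj W) (discrete_topology (pieces W)) fst"
  "continuous_map (cobj W) euclideanreal snd"
  unfolding cobj_eq by (rule continuous_map_from_sum)+

lemma continuous_carr:
  "continuous_map (carr W) (discrete_topology (pieces W \<times> pieces W)) (\<lambda>r. fst (fst r))"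
  "continuous_map (carr W) euclideanreal (\<lambda>r. snd (fst r))"
  "continuous_map (carr W) (discrete_topology UNIV) snd"
  unfolding carr_eq
  by (rule continuous_map_compose[OF continuous_map_fst continuous_map_from_sum(1), unfolded o_def]
      continuous_map_compose[OF continuous_map_fst continuous_map_from_sum(2), unfolded o_def]
      continuous_map_snd)+

lemma continuous_map_into_cobj:
  "continuous_map Z (cobj W) f \<longleftrightarrow>
     continuous_map Z (discrete_topology (pieces W)) (\<lambda>z. fst (f z)) \<and> continuous_map Z euclideanreal (\<lambda>z. snd (f z)) \<and>
     (\<forall>z\<in>topspace Z. snd (f z) \<in> interval_of W (fst (f z)))"
  unfolding cobj_eq by (rule continuous_map_into_sum)

lemma continuous_map_into_carr:
  "continuous_map Z (carr W) f \<longleftrightarrow>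
     continuous_map Z (discrete_topology (pieces W \<times> pieces W)) (\<lambda>z. fst (fst (f z))) \<and>
     continuous_map Z euclideanreal (\<lambda>z. snd (fst (f z))) \<and>
     (\<forall>z\<in>topspace Z. snd (fst (f z)) \<in> interval_of W (fst (fst (fst (f z)))) \<inter> interval_of W (snd (fst (fst (f z))))) \<and>
     continuous_map Z (discrete_topology UNIV) (\<lambda>z. snd (f z))"
  unfolding carr_eq continuous_map_pairwise o_def continuous_map_into_sum by auto

lemma continuous_src_circle: "continuous_map (carr W) (cobj W) (src (circle_groupoid W))"
  unfolding continuous_map_into_cobj src_circle fst_conv snd_conv
proof (intro conjI ballI continuous_carr(2))
  show "continuous_map (carr W) (discrete_topology (pieces W)) (\<lambda>r. fst (fst (fst r)))"
    by (rule continuous_map_discrete_compose[OF continuous_carr(1)]) auto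
qed (simp add: mem_carr_iff)

lemma continuous_tgt_circle: "continuous_map (carr W) (cobj W) (tgt (circle_groupoid W))"
  unfolding continuous_map_into_cobj tgt_circle fst_conv snd_conv
proof (intro conjI ballI continuous_map_add continuous_carr(2))
  have "(\<lambda>p. shift_piece (snd p) (snd (fst p))) \<in> (pieces W \<times> pieces W) \<times> UNIV \<rightarrow> topspace (discrete_topology (pieces W))"
    by auto
  from continuous_map_discrete_compose[OF continuous_map_discrete_pair[OF continuous_carr(1,3)] this]
  show "continuous_map (carr W) (discrete_topology (pieces W)) (\<lambda>z. shift_piece (snd z) (snd (fst (fst z))))"
    by simp
  show "continuous_map (carr W) euclideanreal (\<lambda>z. of_int (snd z))"
    by (rule continuous_map_discrete_compose[OF continuous_carr(3)]) simp
qed (simp add: mem_carr_iff)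

lemma continuous_idt_circle: "continuous_map (cobj W) (carr W) (idt (circle_groupoid W))"
  unfolding continuous_map_into_carr idt_circle fst_conv snd_conv
  using continuous_cobj continuous_map_discrete_pair[OF continuous_cobj(1,1)] by (auto simp: mem_cobj)

section \<open>The circle as a quotient of the object space\<close>

definition ex :: "real \<Rightarrow> complex" where "ex x = cis (2 * pi * x)"

lemma ex_eq_iff: "ex x = ex y \<longleftrightarrow> (\<exists>k::int. y = x + of_int k)"
  unfolding ex_def by (rule cis_eq_iff)

lemma ex_add_int [simp]: "ex (x + of_int k) = ex x"
  using ex_eq_iff by metis

lemma ex_in_sphere [simp]: "ex x \<in> sphere 0 1"
  by (simp add: ex_def)

lemma continuous_ex: "continuous_map euclideanreal (top_of_set (sphere 0 1)) ex"
proof -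
  have "continuous_on UNIV ex" unfolding ex_def by (intro continuous_intros)
  then show ?thesis using ex_in_sphere by (auto simp: continuous_map_in_subtopology simp del: mem_sphere_0)
qed

lemma sphere_ex: 
  assumes "z \<in> sphere 0 1" obtains x where "z = ex x"
proof -
  have "z = cis (Arg z)" using assms cis_Arg[of z] by (cases "z = 0") (auto simp: sgn_eq)
  then have "z = ex (Arg z / (2 * pi))" by (simp add: ex_def)
  then show thesis by (rule that)
qed

text \<open>A compact set of objects that already covers the circle: the closed unthickened
  intervals with shift zero. Thickening is what makes room for their closed ends.\<close>

definition core :: "cover \<Rightarrow> circle_obj set" where
  "core W = (\<Union>q\<in>fst W. Pair (q, 0) ` {q .. next_point (fst W) q})"

lemma compactin_core:
  assumes W: "W \<in> admissible_covers"
  shows "compactin (cobj W) (core W)"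
  unfolding core_def
proof (rule compactin_Union)
  have "compactin (cobj W) (Pair (q, 0) ` {q .. next_point (fst W) q})" if q: "q \<in> fst W" for q
  proof (rule image_compactin)
    show "compactin (top_of_set (interval_of W (q, 0))) {q .. next_point (fst W) q}"
      using admissible_pos[OF W] by (auto simp: compactin_subtopology interval_of_eq left_end_def right_end_def)
    show "continuous_map (top_of_set (interval_of W (q, 0))) (cobj W) (Pair (q, 0))"
      unfolding cobj_eq
      using continuous_map_component_injection[of "(q, 0)" "pieces W" "\<lambda>\<beta>. top_of_set (interval_of W \<beta>)"] q
      by (simp add: pieces_def)
  qed
  then show "\<And>S. S \<in> (\<lambda>q. Pair (q, 0) ` {q .. next_point (fst W) q}) ` fst W \<Longrightarrow> compactin (cobj W) S" by blast
qed (use admissible_point_set[OF W] in \<open>simp add: point_set_def\<close>)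

lemma core_surj:
  assumes W: "W \<in> admissible_covers"
  shows "(\<lambda>p. ex (snd p)) ` core W = sphere 0 1"
proof
  show "sphere 0 1 \<subseteq> (\<lambda>p. ex (snd p)) ` core W"
  proof
    fix z :: complex assume "z \<in> sphere 0 1"
    then obtain x where z: "z = ex x" by (rule sphere_ex)
    obtain \<beta> where \<beta>: "fst \<beta> \<in> fst W" "left_end \<beta> \<le> x" "x < right_end (fst W) \<beta>"
      using piece_exists[OF admissible_point_set[OF W]] by metis
    have "((fst \<beta>, 0), x - of_int (snd \<beta>)) \<in> core W"
      using \<beta> unfolding core_def left_end_def right_end_def by force
    moreover have "z = ex (x - of_int (snd \<beta>))"
      unfolding z using ex_add_int[of "x - of_int (snd \<beta>)" "snd \<beta>"] by simp
    ultimately show "z \<in> (\<lambda>p. ex (snd p)) ` core W" by force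
  qed
qed (use ex_in_sphere in blast)

lemma core_subset: "W \<in> admissible_covers \<Longrightarrow> core W \<subseteq> topspace (cobj W)"
  by (rule compactin_subset_topspace[OF compactin_core])

lemma continuous_ex_cobj: "continuous_map (cobj W) (top_of_set (sphere 0 1)) (\<lambda>p. ex (snd p))"
  using continuous_map_compose[OF continuous_cobj(2) continuous_ex] by (simp add: o_def)

section \<open>Cover groupoids\<close>

lemma cover_groupoid_topologies:
  "Obj (cover_groupoid M I U) = sum_topology (\<lambda>\<alpha>. subtopology M (U \<alpha>)) I"
  "Arr (cover_groupoid M I U) = sum_topology (\<lambda>\<eta>. subtopology M (U (fst \<eta>) \<inter> U (snd \<eta>))) (I \<times> I)"
  by (simp_all add: cover_groupoid_def case_prod_unfold)

lemma cover_groupoid_simps [simp]: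
  "src (cover_groupoid M I U) a = (fst (fst a), snd a)"
  "tgt (cover_groupoid M I U) a = (snd (fst a), snd a)"
  "idt (cover_groupoid M I U) x = ((fst x, fst x), snd x)"
  "ivt (cover_groupoid M I U) a = ((snd (fst a), fst (fst a)), snd a)"
  "cmp (cover_groupoid M I U) a b = ((fst (fst a), snd (fst b)), snd a)"
  by (simp_all add: cover_groupoid_def case_prod_unfold)

text \<open>The third map is the inverse of source and target on pairs of objects over a common
  point. Its continuity reduces every question about arrows of the cover groupoid to one about
  objects.\<close>

lemma cover_groupoid_continuous:
  fixes M :: "'m topology" and I :: "'i set" and U :: "'i \<Rightarrow> 'm set"
  defines "G \<equiv> cover_groupoid M I U"
  shows "continuous_map (Arr G) (Obj G) (\<lambda>a. (fst (fst a), snd a))"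
    "continuous_map (Arr G) (Obj G) (\<lambda>a. (snd (fst a), snd a))"
    "continuous_map (subtopology (prod_topology (Obj G) (Obj G)) {(x, y). snd x = snd y}) (Arr G)
       (\<lambda>(x, y). ((fst x, fst y), snd x))"
proof -
  have 1: "continuous_map (Arr G) (discrete_topology (I \<times> I)) fst" "continuous_map (Arr G) M snd"
    unfolding G_def cover_groupoid_topologies by (rule continuous_map_from_sum)+
  have 2: "continuous_map (Obj G) (discrete_topology I) fst" "continuous_map (Obj G) M snd"
    unfolding G_def cover_groupoid_topologies by (rule continuous_map_from_sum)+
  have eq: "Obj G = sum_topology (\<lambda>\<alpha>. subtopology M (U \<alpha>)) I"
    "Arr G = sum_topology (\<lambda>\<eta>. subtopology M (U (fst \<eta>) \<inter> U (snd \<eta>))) (I \<times> I)"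
    by (simp_all add: G_def cover_groupoid_topologies)
  have lab: "continuous_map (Arr G) (discrete_topology I) (\<lambda>a. fst (fst a))"
    "continuous_map (Arr G) (discrete_topology I) (\<lambda>a. snd (fst a))"
    by (rule continuous_map_discrete_compose[OF 1(1)], auto)+
  have mem: "snd a \<in> U (fst (fst a))" "snd a \<in> U (snd (fst a))" if "a \<in> topspace (Arr G)" for a
    using that by (auto simp: G_def cover_groupoid_topologies)
  show "continuous_map (Arr G) (Obj G) (\<lambda>a. (fst (fst a), snd a))"
    unfolding eq(1) continuous_map_into_sum fst_conv snd_conv
    using 1(2) lab mem by simp
  show "continuous_map (Arr G) (Obj G) (\<lambda>a. (snd (fst a), snd a))"
    unfolding eq(1) continuous_map_into_sum fst_conv snd_conv
    using 1(2) lab mem by simp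
  let ?P = "subtopology (prod_topology (Obj G) (Obj G)) {(x, y). snd x = snd y}"
  have p: "continuous_map ?P (Obj G) fst" "continuous_map ?P (Obj G) snd"
    by (rule continuous_map_from_subtopology, rule continuous_map_fst continuous_map_snd)+
  have "continuous_map ?P (discrete_topology (I \<times> I)) (\<lambda>p. (fst (fst p), fst (snd p)))"
    using continuous_map_compose[OF p(1) 2(1)] continuous_map_compose[OF p(2) 2(1)]
    by (intro continuous_map_discrete_pair) (simp_all add: o_def)
  moreover have "continuous_map ?P M (\<lambda>p. snd (fst p))"
    using continuous_map_compose[OF p(1) 2(2)] by (simp add: o_def)
  moreover have "snd (fst p) \<in> U (fst (fst p)) \<inter> U (fst (snd p))" if "p \<in> topspace ?P" for p
    using that by (auto simp: G_def cover_groupoid_topologies)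
  ultimately show "continuous_map ?P (Arr G) (\<lambda>(x, y). ((fst x, fst y), snd x))"
    unfolding eq(2) continuous_map_into_sum case_prod_unfold fst_conv snd_conv
    by simp
qed

section \<open>The loop groupoid of a cover groupoid over a fixed cover of the circle\<close>

text \<open>Arrows of a cover groupoid are determined by their source and target, so the arrow part of a
  morphism and the arrows of the loop groupoid are determined by the maps on objects.\<close>

definition arrow_map ::
  "cover \<Rightarrow> (circle_obj \<Rightarrow> 'i \<times> 'm) \<Rightarrow> (circle_obj \<Rightarrow> 'i \<times> 'm) \<Rightarrow> circle_arr \<Rightarrow> ('i \<times> 'i) \<times> 'm" where
  "arrow_map W F F' = (\<lambda>r\<in>topspace (carr W). ((fst (F (src (circle_groupoid W) r)), fst (F' (tgt (circle_groupoid W) r))),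
                                                snd (F (src (circle_groupoid W) r))))"

text \<open>With both maps equal this is the condition for a map on objects to extend to a morphism;
  with two different morphisms it is the condition for an arrow between them.\<close>

definition compatible :: "cover \<Rightarrow> (circle_obj \<Rightarrow> 'i \<times> 'm) \<Rightarrow> (circle_obj \<Rightarrow> 'i \<times> 'm) \<Rightarrow> bool" where
  "compatible W F F' \<longleftrightarrow>
     (\<forall>r\<in>topspace (carr W). snd (F (src (circle_groupoid W) r)) = snd (F' (tgt (circle_groupoid W) r)))"

locale cover_loops =
  fixes M :: "'m topology" and I :: "'i set" and U :: "'i \<Rightarrow> 'm set"
  assumes open_U: "\<alpha> \<in> I \<Longrightarrow> openin M (U \<alpha>)"
begin

abbreviation "G \<equiv> cover_groupoid M I U"
abbreviation "LG \<equiv> loop_groupoid_at G"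
abbreviation "obs W \<equiv> topspace (Obj (LG W))"
abbreviation "ars W \<equiv> topspace (Arr (LG W))"
abbreviation "Loops \<equiv> free_loop_space M"

text \<open>Evaluate at sources and at targets, pair the results over the Hausdorff arrow space, and
  rebuild the arrows on the fibre product; each of the three operations is continuous for the
  compact-open topologies.\<close>

lemma continuous_arrow_map:
  assumes "continuous_map P (CO (cobj W) (Obj G)) F" "continuous_map P (CO (cobj W) (Obj G)) F'"
    and "\<And>p. p \<in> topspace P \<Longrightarrow> compatible W (F p) (F' p)"
  shows "continuous_map P (CO (carr W) (Arr G)) (\<lambda>p. arrow_map W (F p) (F' p))"
proof -
  let ?s = "src (circle_groupoid W)" and ?t = "tgt (circle_groupoid W)"
  have "continuous_map P (CO (carr W) (prod_topology (Obj G) (Obj G)))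
     (\<lambda>p. \<lambda>r\<in>topspace (carr W). ((\<lambda>r\<in>topspace (carr W). F p (?s r)) r, (\<lambda>r\<in>topspace (carr W). F' p (?t r)) r))"
    by (rule compact_open_pair[OF Hausdorff_carr compact_open_precompose[OF assms(1) continuous_src_circle]
          compact_open_precompose[OF assms(2) continuous_tgt_circle]])
  from compact_open_postcompose[OF this cover_groupoid_continuous(3)] assms(3)
  have "continuous_map P (CO (carr W) (Arr G)) (\<lambda>p. \<lambda>r\<in>topspace (carr W). (\<lambda>(x, y). ((fst x, fst y), snd x))
     ((\<lambda>r\<in>topspace (carr W). ((\<lambda>r\<in>topspace (carr W). F p (?s r)) r, (\<lambda>r\<in>topspace (carr W). F' p (?t r)) r)) r))"
    by (simp add: compatible_def)
  then show ?thesis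
    by (rule continuous_map_eq) (auto simp: arrow_map_def)
qed

lemma arrow_map_continuous_maps:
  assumes "F \<in> continuous_maps (cobj W) (Obj G)" "F' \<in> continuous_maps (cobj W) (Obj G)" "compatible W F F'"
  shows "arrow_map W F F' \<in> continuous_maps (carr W) (Arr G)"
proof -
  \<comment> \<open>A one-point parameter space turns the statement about families into one about a
    single map.\<close>
  have "continuous_map (discrete_topology {()}) (CO (carr W) (Arr G)) (\<lambda>p. arrow_map W F F')"
    by (rule continuous_arrow_map) (use assms in simp_all)
  from compact_open_value[OF this] show ?thesis by simp
qed

lemma Obj_LG: "Obj (LG W) = subtopology (prod_topology (CO (cobj W) (Obj G)) (CO (carr W) (Arr G)))
                 {\<Psi>. groupoid_morphism (circle_groupoid W) G \<Psi>}"
  by (simp add: loop_groupoid_at_def Let_def)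

text \<open>The source and target equations of a morphism already fix every value on arrows.
  Conversely, once points agree along arrows, the remaining groupoid equations only compare labels
  and points at sources and targets.\<close>

lemma obs_iff:
  "\<Psi> \<in> obs W \<longleftrightarrow> fst \<Psi> \<in> continuous_maps (cobj W) (Obj G) \<and> compatible W (fst \<Psi>) (fst \<Psi>) \<and>
     snd \<Psi> = arrow_map W (fst \<Psi>) (fst \<Psi>)"
proof
  let ?S = "circle_groupoid W"
  assume L: "\<Psi> \<in> obs W"
  then have m: "groupoid_morphism ?S G \<Psi>" and c: "fst \<Psi> \<in> continuous_maps (cobj W) (Obj G)"
      "snd \<Psi> \<in> continuous_maps (carr W) (Arr G)"
    by (auto simp: Obj_LG)
  have st: "(fst (fst (snd \<Psi> r)), snd (snd \<Psi> r)) = fst \<Psi> (src ?S r)"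
     "(snd (fst (snd \<Psi> r)), snd (snd \<Psi> r)) = fst \<Psi> (tgt ?S r)" if "r \<in> topspace (carr W)" for r
    using m that unfolding groupoid_morphism_def by simp_all
  have "compatible W (fst \<Psi>) (fst \<Psi>)"
    unfolding compatible_def using st by (metis snd_conv)
  moreover have "snd \<Psi> = arrow_map W (fst \<Psi>) (fst \<Psi>)"
  proof (rule extensionalityI)
    show "snd \<Psi> \<in> extensional (topspace (carr W))" by (rule continuous_mapsD(2)[OF c(2)])
    show "arrow_map W (fst \<Psi>) (fst \<Psi>) \<in> extensional (topspace (carr W))" by (simp add: arrow_map_def)
    show "snd \<Psi> r = arrow_map W (fst \<Psi>) (fst \<Psi>) r" if "r \<in> topspace (carr W)" for r
      using st[OF that] that by (simp add: arrow_map_def prod_eq_iff split: prod.splits)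
  qed
  ultimately show "fst \<Psi> \<in> continuous_maps (cobj W) (Obj G) \<and> compatible W (fst \<Psi>) (fst \<Psi>) \<and>
     snd \<Psi> = arrow_map W (fst \<Psi>) (fst \<Psi>)" using c(1) by blast
next
  let ?S = "circle_groupoid W"
  assume R: "fst \<Psi> \<in> continuous_maps (cobj W) (Obj G) \<and> compatible W (fst \<Psi>) (fst \<Psi>) \<and>
     snd \<Psi> = arrow_map W (fst \<Psi>) (fst \<Psi>)"
  have snd: "snd \<Psi> \<in> continuous_maps (carr W) (Arr G)"
    using arrow_map_continuous_maps[of "fst \<Psi>" W "fst \<Psi>"] R by simp
  have val: "snd \<Psi> r = ((fst (fst \<Psi> (src ?S r)), fst (fst \<Psi> (tgt ?S r))), snd (fst \<Psi> (src ?S r)))"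
     "snd (fst \<Psi> (tgt ?S r)) = snd (fst \<Psi> (src ?S r))"
    if "r \<in> topspace (carr W)" for r
    using R that by (simp_all add: arrow_map_def compatible_def)
  have "groupoid_morphism ?S G \<Psi>"
    unfolding groupoid_morphism_def
  proof (intro conjI ballI)
    show "continuous_map (cobj W) (Obj G) (fst \<Psi>)" "continuous_map (carr W) (Arr G) (snd \<Psi>)"
      using continuous_mapsD(1) R snd by blast+
    fix p assume p: "p \<in> composable ?S"
    obtain a b where ab: "p = (a, b)" by (metis surj_pair)
    have "a \<in> topspace (carr W)" "b \<in> topspace (carr W)" using p by (simp_all add: ab composable_def)
    then show "case p of (a, b) \<Rightarrow> snd \<Psi> (cmp ?S a b) = cmp G (snd \<Psi> a) (snd \<Psi> b)"
      using circle_cmp[of a b W] p by (simp add: ab val)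
  qed (simp_all add: circle_closed val prod_eq_iff)
  then show "\<Psi> \<in> obs W" using R snd by (simp add: Obj_LG mem_Times_iff)
qed

lemma obs_eqI: "\<lbrakk>\<Psi> \<in> obs W; \<Phi> \<in> obs W; fst \<Psi> = fst \<Phi>\<rbrakk> \<Longrightarrow> \<Psi> = \<Phi>"
  by (simp add: obs_iff prod_eq_iff)

text \<open>The arrow component is a continuous function of the object component, so only the latter
  has to be tested.\<close>

lemma continuous_into_obs:
  assumes "\<And>p. p \<in> topspace P \<Longrightarrow> F p \<in> obs W" "continuous_map P (CO (cobj W) (Obj G)) (\<lambda>p. fst (F p))"
  shows "continuous_map P (Obj (LG W)) F"
  unfolding Obj_LG continuous_map_in_subtopology continuous_map_pairwise
proof (intro conjI)
  have "continuous_map P (CO (carr W) (Arr G)) (\<lambda>p. arrow_map W (fst (F p)) (fst (F p)))"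
    by (rule continuous_arrow_map) (use assms obs_iff in blast)+
  then show "continuous_map P (CO (carr W) (Arr G)) (snd \<circ> F)"
    by (rule continuous_map_eq) (use assms(1) in \<open>simp add: obs_iff\<close>)
qed (use assms in \<open>auto simp: o_def Obj_LG\<close>)

lemma continuous_fst_obs: "continuous_map (Obj (LG W)) (CO (cobj W) (Obj G)) fst"
  unfolding Obj_LG by (rule continuous_map_from_subtopology[OF continuous_map_fst])

text \<open>The topology on objects is induced by the object component alone: the identity is
  continuous from the pullback topology along \<open>fst\<close>, by the preceding test for
  continuity.\<close>

lemma openin_Obj_LG:
  assumes "openin (Obj (LG W)) N"
  obtains N' where "openin (CO (cobj W) (Obj G)) N'" "N = {\<Psi> \<in> obs W. fst \<Psi> \<in> N'}"
proof -
  let ?P = "pullback_topology (obs W) fst (CO (cobj W) (Obj G))"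
  have top: "topspace ?P = obs W" by (auto simp: topspace_pullback_topology obs_iff)
  have "continuous_map ?P (CO (cobj W) (Obj G)) fst"
    using continuous_map_pullback[OF continuous_map_id, of "obs W" fst "CO (cobj W) (Obj G)"] by simp
  then have "continuous_map ?P (Obj (LG W)) (\<lambda>x. x)"
    by (intro continuous_into_obs) (simp_all add: top)
  from openin_continuous_map_preimage[OF this assms] have "openin ?P {\<Psi> \<in> obs W. \<Psi> \<in> N}" by (simp add: top)
  moreover have "{\<Psi> \<in> obs W. \<Psi> \<in> N} = N" using openin_subset[OF assms] by blast
  ultimately obtain N' where "openin (CO (cobj W) (Obj G)) N'" "N = fst -` N' \<inter> obs W"
    unfolding openin_pullback_topology by auto
  then show thesis by (intro that[of N']) auto
qed

text \<open>The point to check is that the pullback in the definition discards no arrow, that is,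
  that both components used for the topology are continuous maps for every arrow.\<close>

lemma Arr_LG:
  "Arr (LG W) = pullback_topology (ars W)
     (\<lambda>(\<Psi>, \<Lambda>, \<Phi>). (snd \<Psi>, restrict (\<Lambda> \<circ> idt (circle_groupoid W)) (topspace (cobj W))))
     (prod_topology (CO (carr W) (Arr G)) (CO (cobj W) (Arr G)))" (is ?pullback)
  and ars_eq: "ars W = {(\<Psi>, \<Lambda>, \<Phi>). \<Psi> \<in> obs W \<and> \<Phi> \<in> obs W \<and>
     \<Lambda> \<in> continuous_maps (carr W) (Arr G) \<and>
     (\<forall>r \<in> topspace (carr W).
        src G (\<Lambda> r) = fst \<Psi> (src (circle_groupoid W) r) \<and> tgt G (\<Lambda> r) = fst \<Phi> (tgt (circle_groupoid W) r) \<and>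
        \<Lambda> r = cmp G (snd \<Psi> r) (\<Lambda> (idt (circle_groupoid W) (tgt (circle_groupoid W) r))) \<and>
        \<Lambda> r = cmp G (\<Lambda> (idt (circle_groupoid W) (src (circle_groupoid W) r))) (snd \<Phi> r))}" (is "_ = ?A")
proof -
  let ?S = "circle_groupoid W"
  let ?f = "\<lambda>(\<Psi>, \<Lambda>, \<Phi>). (snd \<Psi>, restrict (\<Lambda> \<circ> idt ?S) (topspace (cobj W)))"
  have A: "Arr (LG W) = pullback_topology ?A ?f (prod_topology (CO (carr W) (Arr G)) (CO (cobj W) (Arr G)))"
    by (simp add: loop_groupoid_at_def Let_def del: cover_groupoid_simps)
  then have "ars W = ?f -` (continuous_maps (carr W) (Arr G) \<times> continuous_maps (cobj W) (Arr G)) \<inter> ?A"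
    by (simp add: topspace_pullback_topology)
  moreover have "?f a \<in> continuous_maps (carr W) (Arr G) \<times> continuous_maps (cobj W) (Arr G)" if "a \<in> ?A" for a
  proof -
    obtain \<Psi> \<Lambda> \<Phi> where a: "a = (\<Psi>, \<Lambda>, \<Phi>)" by (metis surj_pair)
    have L: "\<Lambda> \<in> continuous_maps (carr W) (Arr G)" and P: "\<Psi> \<in> obs W" using that by (auto simp: a)
    have "snd \<Psi> \<in> continuous_maps (carr W) (Arr G)"
      using P unfolding Obj_LG by auto
    moreover have "restrict (\<Lambda> \<circ> idt ?S) (topspace (cobj W)) \<in> continuous_maps (cobj W) (Arr G)"
      by (rule continuous_mapsI[OF continuous_map_compose[OF continuous_idt_circle continuous_mapsD(1)[OF L]]])
    ultimately show ?thesis by (simp add: a)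
  qed
  ultimately show "ars W = ?A" by blast
  then show ?pullback using A by simp
qed

lemma ars_iff:
  "(\<Psi>, \<Lambda>, \<Phi>) \<in> ars W \<longleftrightarrow> \<Psi> \<in> obs W \<and> \<Phi> \<in> obs W \<and> compatible W (fst \<Psi>) (fst \<Phi>) \<and> \<Lambda> = arrow_map W (fst \<Psi>) (fst \<Phi>)"
proof -
  let ?S = "circle_groupoid W"
  note eq = ars_eq
  show ?thesis
  proof
    assume L: "(\<Psi>, \<Lambda>, \<Phi>) \<in> ars W"
    then have c: "\<Lambda> \<in> continuous_maps (carr W) (Arr G)" and ob: "\<Psi> \<in> obs W" "\<Phi> \<in> obs W" unfolding eq by auto
    have st: "(fst (fst (\<Lambda> r)), snd (\<Lambda> r)) = fst \<Psi> (src ?S r)"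
      "(snd (fst (\<Lambda> r)), snd (\<Lambda> r)) = fst \<Phi> (tgt ?S r)" if "r \<in> topspace (carr W)" for r
      using L that unfolding eq by auto
    have "compatible W (fst \<Psi>) (fst \<Phi>)" unfolding compatible_def using st by (metis snd_conv)
    moreover have "\<Lambda> = arrow_map W (fst \<Psi>) (fst \<Phi>)"
    proof (rule extensionalityI)
      show "\<Lambda> \<in> extensional (topspace (carr W))" by (rule continuous_mapsD(2)[OF c])
      show "arrow_map W (fst \<Psi>) (fst \<Phi>) \<in> extensional (topspace (carr W))" by (simp add: arrow_map_def)
      show "\<Lambda> r = arrow_map W (fst \<Psi>) (fst \<Phi>) r" if "r \<in> topspace (carr W)" for r
        using st[OF that] that by (simp add: arrow_map_def prod_eq_iff split: prod.splits)
    qed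
    ultimately show "\<Psi> \<in> obs W \<and> \<Phi> \<in> obs W \<and> compatible W (fst \<Psi>) (fst \<Phi>) \<and> \<Lambda> = arrow_map W (fst \<Psi>) (fst \<Phi>)"
      using ob by blast
  next
    assume R: "\<Psi> \<in> obs W \<and> \<Phi> \<in> obs W \<and> compatible W (fst \<Psi>) (fst \<Phi>) \<and> \<Lambda> = arrow_map W (fst \<Psi>) (fst \<Phi>)"
    then have "\<Lambda> \<in> continuous_maps (carr W) (Arr G)"
      using arrow_map_continuous_maps[of "fst \<Psi>" W "fst \<Phi>"] obs_iff by simp
    moreover have "src G (\<Lambda> r) = fst \<Psi> (src ?S r)" "tgt G (\<Lambda> r) = fst \<Phi> (tgt ?S r)"
        "\<Lambda> r = cmp G (snd \<Psi> r) (\<Lambda> (idt ?S (tgt ?S r)))"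
        "\<Lambda> r = cmp G (\<Lambda> (idt ?S (src ?S r))) (snd \<Phi> r)"
      if r: "r \<in> topspace (carr W)" for r
      using R r by (auto simp: arrow_map_def compatible_def obs_iff circle_closed prod_eq_iff)
    ultimately show "(\<Psi>, \<Lambda>, \<Phi>) \<in> ars W"
      unfolding eq using R by blast
  qed
qed

lemma LG_simps [simp]:
  "src (LG W) a = fst a" "tgt (LG W) a = snd (snd a)" "idt (LG W) \<Psi> = (\<Psi>, snd \<Psi>, \<Psi>)"
  by (simp_all add: loop_groupoid_at_def Let_def split_beta)

lemma LG_cmp_ivt_eq:
  "cmp (LG W) (\<Psi>, \<Lambda>, \<Phi>) (\<Phi>', \<Omega>, \<Gamma>) = (\<Psi>, \<lambda>r \<in> topspace (carr W).
     cmp G (cmp G (\<Lambda> (idt (circle_groupoid W) (src (circle_groupoid W) r)))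
                  (\<Omega> (idt (circle_groupoid W) (src (circle_groupoid W) r)))) (snd \<Gamma> r), \<Gamma>)"
  "ivt (LG W) (\<Psi>, \<Lambda>, \<Phi>) = (\<Phi>, \<lambda>r \<in> topspace (carr W).
     cmp G (ivt G (\<Lambda> (idt (circle_groupoid W) (src (circle_groupoid W) r)))) (snd \<Psi> r), \<Psi>)"
  by (simp_all add: loop_groupoid_at_def Let_def)

text \<open>On identities an arrow records just two labels over a common point, so the prescribed
  formulas collapse to the arrow determined by the outer objects.\<close>

lemma LG_cmp_ivt:
  assumes "(\<Psi>, \<Lambda>, \<Phi>) \<in> ars W"
  shows "(\<Phi>, \<Omega>, \<Gamma>) \<in> ars W \<Longrightarrow> cmp (LG W) (\<Psi>, \<Lambda>, \<Phi>) (\<Phi>, \<Omega>, \<Gamma>) = (\<Psi>, arrow_map W (fst \<Psi>) (fst \<Gamma>), \<Gamma>)"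
    and "ivt (LG W) (\<Psi>, \<Lambda>, \<Phi>) = (\<Phi>, arrow_map W (fst \<Phi>) (fst \<Psi>), \<Psi>)"
proof -
  let ?S = "circle_groupoid W"
  have ob: "\<Psi> \<in> obs W" "\<Phi> \<in> obs W" and c: "compatible W (fst \<Psi>) (fst \<Phi>)" and L: "\<Lambda> = arrow_map W (fst \<Psi>) (fst \<Phi>)"
    using assms unfolding ars_iff by simp_all
  have id: "snd (fst \<Psi> p) = snd (fst \<Phi> p)" if "p \<in> topspace (cobj W)" for p
    using c circle_closed(3)[OF that] circle_closed(5,6)[OF that] unfolding compatible_def by metis
  have val: "arrow_map W F F' (idt ?S p) = ((fst (F p), fst (F' p)), snd (F p))"
    if "p \<in> topspace (cobj W)" for F F' :: "circle_obj \<Rightarrow> 'i \<times> 'm" and p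
    using circle_closed(3)[OF that] circle_closed(5,6)[OF that] by (simp add: arrow_map_def)
  have val1: "snd \<Theta> r = ((fst (fst \<Theta> (src ?S r)), fst (fst \<Theta> (tgt ?S r))), snd (fst \<Theta> (src ?S r)))"
    if "\<Theta> \<in> obs W" "r \<in> topspace (carr W)" for \<Theta> r
    using that by (simp add: obs_iff arrow_map_def)
  show "ivt (LG W) (\<Psi>, \<Lambda>, \<Phi>) = (\<Phi>, arrow_map W (fst \<Phi>) (fst \<Psi>), \<Psi>)"
    unfolding LG_cmp_ivt_eq L prod.inject
    by (intro conjI refl, subst (2) arrow_map_def, rule restrict_ext)
       (simp add: val circle_closed(1) val1[OF ob(1)] id)
  show "cmp (LG W) (\<Psi>, \<Lambda>, \<Phi>) (\<Phi>, \<Omega>, \<Gamma>) = (\<Psi>, arrow_map W (fst \<Psi>) (fst \<Gamma>), \<Gamma>)" if a: "(\<Phi>, \<Omega>, \<Gamma>) \<in> ars W"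
  proof -
    have "\<Gamma> \<in> obs W" "\<Omega> = arrow_map W (fst \<Phi>) (fst \<Gamma>)" using a unfolding ars_iff by simp_all
    then show ?thesis
      unfolding LG_cmp_ivt_eq L prod.inject
      by (intro conjI refl, subst (2) arrow_map_def, intro restrict_ext)
         (simp add: val circle_closed(1) val1)
  qed
qed

text \<open>The only candidate for an arrow with the given ends; it is one exactly when the two
  loops agree.\<close>

definition arr :: "cover \<Rightarrow> ('i \<times> 'm, ('i \<times> 'i) \<times> 'm) loop_obj \<Rightarrow> ('i \<times> 'm, ('i \<times> 'i) \<times> 'm) loop_obj \<Rightarrow>
    ('i \<times> 'm, ('i \<times> 'i) \<times> 'm) loop_arr" where
  "arr W \<Psi> \<Phi> = (\<Psi>, arrow_map W (fst \<Psi>) (fst \<Phi>), \<Phi>)"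

definition loop_of :: "cover \<Rightarrow> ('i \<times> 'm, ('i \<times> 'i) \<times> 'm) loop_obj \<Rightarrow> complex \<Rightarrow> 'm" where
  "loop_of W \<Psi> = (\<lambda>z\<in>sphere 0 1. snd (fst \<Psi> (SOME p. p \<in> topspace (cobj W) \<and> ex (snd p) = z)))"

text \<open>Two points of the object space over the same point of the circle are source and target
  of an arrow, so the point component of the object agrees on them and the choice in
  \<open>loop_of\<close> is harmless.\<close>

lemma loop_of_ex:
  assumes \<Psi>: "\<Psi> \<in> obs W" and p: "p \<in> topspace (cobj W)"
  shows "loop_of W \<Psi> (ex (snd p)) = snd (fst \<Psi> p)"
proof -
  define q where "q = (SOME q. q \<in> topspace (cobj W) \<and> ex (snd q) = ex (snd p))"
  have "q \<in> topspace (cobj W) \<and> ex (snd q) = ex (snd p)"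
    unfolding q_def by (rule someI[of _ p]) (simp add: p)
  then have q: "q \<in> topspace (cobj W)" "ex (snd q) = ex (snd p)" by simp_all
  then obtain k :: int where k: "snd p = snd q + of_int k" using ex_eq_iff by metis
  \<comment> \<open>The arrow moves by the integer \<open>k\<close> from \<open>q\<close> to
    \<open>p\<close>; its second interval is that of \<open>p\<close>, pulled back to the position
    of \<open>q\<close>.\<close>
  let ?r = "(((fst q, shift_piece (- k) (fst p)), snd q), k)"
  have "snd q \<in> interval_of W (shift_piece (- k) (fst p))"
    using interval_of_shift[of "snd q" k W "shift_piece (- k) (fst p)"] p k by (simp add: mem_cobj)
  then have r: "?r \<in> topspace (carr W)" using p q by (simp add: mem_carr mem_cobj)
  have "src (circle_groupoid W) ?r = q" "tgt (circle_groupoid W) ?r = p" by (simp_all add: k[symmetric])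
  then have "snd (fst \<Psi> q) = snd (fst \<Psi> p)"
    using \<Psi> r unfolding obs_iff compatible_def by metis
  then show ?thesis using ex_in_sphere by (simp add: loop_of_def q_def[symmetric] del: mem_sphere_0)
qed

text \<open>Every arrow joins points with the same image on the circle, and testing on identities
  recovers equality of the loops at every point of the circle.\<close>

lemma compatible_iff:
  assumes W: "W \<in> admissible_covers" and ob: "\<Psi> \<in> obs W" "\<Phi> \<in> obs W"
  shows "compatible W (fst \<Psi>) (fst \<Phi>) \<longleftrightarrow> loop_of W \<Psi> = loop_of W \<Phi>"
proof
  assume c: "compatible W (fst \<Psi>) (fst \<Phi>)"
  show "loop_of W \<Psi> = loop_of W \<Phi>"
  proof (rule extensionalityI[of _ "sphere 0 1"])
    fix z :: complex assume "z \<in> sphere 0 1"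
    then obtain p where p: "p \<in> topspace (cobj W)" "z = ex (snd p)"
      using core_surj[OF W] core_subset[OF W] by blast
    have "snd (fst \<Psi> p) = snd (fst \<Phi> p)"
      using c circle_closed(3,5,6)[OF p(1)] unfolding compatible_def by metis
    then show "loop_of W \<Psi> z = loop_of W \<Phi> z" using loop_of_ex ob p by simp
  qed (simp_all add: loop_of_def)
next
  assume eq: "loop_of W \<Psi> = loop_of W \<Phi>"
  show "compatible W (fst \<Psi>) (fst \<Phi>)"
    unfolding compatible_def
  proof
    let ?S = "circle_groupoid W"
    fix r assume r: "r \<in> topspace (carr W)"
    have "ex (snd (tgt ?S r)) = ex (snd (src ?S r))" by (simp add: src_circle tgt_circle)
    then show "snd (fst \<Psi> (src ?S r)) = snd (fst \<Phi> (tgt ?S r))"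
      using loop_of_ex[OF ob(1) circle_closed(1)[OF r]] loop_of_ex[OF ob(2) circle_closed(2)[OF r]] eq by simp
  qed
qed

text \<open>The point component of an object depends continuously on it, and descends along the
  quotient map from \<open>core W\<close> to the circle.\<close>

lemma continuous_loop_of:
  assumes W: "W \<in> admissible_covers"
  shows "continuous_map (Obj (LG W)) Loops (loop_of W)"
  unfolding free_loop_space_def
proof (rule compact_open_descend[OF _ continuous_ex_cobj compactin_core[OF W]])
  have "continuous_map (subtopology (Obj G) UNIV) M snd"
    unfolding cover_groupoid_topologies by (simp add: continuous_map_from_sum)
  from compact_open_postcompose[OF continuous_fst_obs this]
  show "continuous_map (Obj (LG W)) (CO (cobj W) M) (\<lambda>\<Psi>. \<lambda>p\<in>topspace (cobj W). snd (fst \<Psi> p))" by simp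
  show "Hausdorff_space (top_of_set (sphere (0::complex) 1))" by (simp add: Hausdorff_space_subtopology)
  fix \<Psi> p assume "\<Psi> \<in> obs W" "p \<in> core W"
  then show "loop_of W \<Psi> (ex (snd p)) = (\<lambda>p\<in>topspace (cobj W). snd (fst \<Psi> p)) p"
    using core_subset[OF W] loop_of_ex by auto
qed (use core_surj[OF W] in \<open>simp_all add: loop_of_def\<close>)

lemma loop_of_loop: "\<lbrakk>W \<in> admissible_covers; \<Psi> \<in> obs W\<rbrakk> \<Longrightarrow> loop_of W \<Psi> \<in> topspace Loops"
  using continuous_map_funspace[OF continuous_loop_of] by blast

lemma ars_iff':
  assumes "W \<in> admissible_covers"
  shows "a \<in> ars W \<longleftrightarrow> fst a \<in> obs W \<and> snd (snd a) \<in> obs W \<and> loop_of W (fst a) = loop_of W (snd (snd a)) \<and>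
           a = arr W (fst a) (snd (snd a))"
  using compatible_iff[OF assms, of "fst a" "snd (snd a)"] ars_iff[of "fst a" "fst (snd a)" "snd (snd a)" W]
  by (auto simp: arr_def prod_eq_iff)

lemma arr_in_ars:
  "\<lbrakk>W \<in> admissible_covers; \<Psi> \<in> obs W; \<Phi> \<in> obs W; loop_of W \<Psi> = loop_of W \<Phi>\<rbrakk> \<Longrightarrow> arr W \<Psi> \<Phi> \<in> ars W"
  by (simp add: ars_iff' arr_def)

lemma arsE:
  assumes "a \<in> ars W" "W \<in> admissible_covers"
  obtains \<Psi> \<Phi> where "\<Psi> \<in> obs W" "\<Phi> \<in> obs W" "loop_of W \<Psi> = loop_of W \<Phi>" "a = arr W \<Psi> \<Phi>"
  using assms ars_iff' by blast

lemma LG_arr: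
  "src (LG W) (arr W \<Psi> \<Phi>) = \<Psi>" "tgt (LG W) (arr W \<Psi> \<Phi>) = \<Phi>"
  "\<Psi> \<in> obs W \<Longrightarrow> idt (LG W) \<Psi> = arr W \<Psi> \<Psi>"
  by (simp_all add: arr_def obs_iff)

lemma LG_arr_ops:
  assumes "W \<in> admissible_covers" "\<Psi> \<in> obs W" "\<Phi> \<in> obs W" "loop_of W \<Psi> = loop_of W \<Phi>"
  shows "ivt (LG W) (arr W \<Psi> \<Phi>) = arr W \<Phi> \<Psi>"
    "\<lbrakk>\<Gamma> \<in> obs W; loop_of W \<Phi> = loop_of W \<Gamma>\<rbrakk> \<Longrightarrow> cmp (LG W) (arr W \<Psi> \<Phi>) (arr W \<Phi> \<Gamma>) = arr W \<Psi> \<Gamma>"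
  using LG_cmp_ivt[OF arr_in_ars[OF assms, unfolded arr_def]] arr_in_ars[OF assms(1,3), of \<Gamma>]
  by (simp_all add: arr_def)

text \<open>Both data that define the topology on arrows are functions of the two ends, so
  continuous families of ends suffice. Together with the continuity of source and target this makes
  the arrows over \<open>W\<close> the fibre product of the objects over the loop space.\<close>

lemma continuous_into_ars:
  assumes W: "W \<in> admissible_covers" and A: "continuous_map P (Obj (LG W)) A" and B: "continuous_map P (Obj (LG W)) B"
    and AB: "\<And>p. p \<in> topspace P \<Longrightarrow> loop_of W (A p) = loop_of W (B p)"
  shows "continuous_map P (Arr (LG W)) (\<lambda>p. arr W (A p) (B p))"
proof (subst Arr_LG, rule continuous_map_pullback')
  have ob: "A p \<in> obs W" "B p \<in> obs W" if "p \<in> topspace P" for p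
    using continuous_map_funspace[OF A] continuous_map_funspace[OF B] that by auto
  then show "topspace P \<subseteq> (\<lambda>p. arr W (A p) (B p)) -` ars W" using AB
    by (intro subsetI vimageI2 arr_in_ars[OF W]) simp_all
  have fc: "continuous_map P (CO (cobj W) (Obj G)) (\<lambda>p. fst (A p))" "continuous_map P (CO (cobj W) (Obj G)) (\<lambda>p. fst (B p))"
    using continuous_map_compose[OF A continuous_fst_obs] continuous_map_compose[OF B continuous_fst_obs] by (simp_all add: o_def)
  have comp: "compatible W (fst (A p)) (fst (B p))" if "p \<in> topspace P" for p
    using compatible_iff[OF W ob[OF that]] AB[OF that] by simp
  have "continuous_map P (CO (carr W) (Arr G)) (\<lambda>p. arrow_map W (fst (A p)) (fst (B p)))"
    by (rule continuous_arrow_map[OF fc comp])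
  from compact_open_precompose[OF this continuous_idt_circle]
  have 1: "continuous_map P (CO (cobj W) (Arr G))
     (\<lambda>p. \<lambda>x\<in>topspace (cobj W). arrow_map W (fst (A p)) (fst (B p)) (idt (circle_groupoid W) x))" .
  have "continuous_map P (CO (carr W) (Arr G)) (\<lambda>p. arrow_map W (fst (A p)) (fst (A p)))"
    by (rule continuous_arrow_map[OF fc(1,1)]) (use ob obs_iff in blast)
  then have 2: "continuous_map P (CO (carr W) (Arr G)) (\<lambda>p. snd (A p))"
    by (rule continuous_map_eq) (use ob in \<open>simp add: obs_iff\<close>)
  show "continuous_map P (prod_topology (CO (carr W) (Arr G)) (CO (cobj W) (Arr G)))
     ((\<lambda>(\<Psi>, \<Lambda>, \<Phi>). (snd \<Psi>, restrict (\<Lambda> \<circ> idt (circle_groupoid W)) (topspace (cobj W)))) \<circ> (\<lambda>p. arr W (A p) (B p)))"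
    using continuous_map_pairedI[OF 2 1] by (simp add: arr_def o_def)
qed

text \<open>The ends are recovered from values at identities: the source from the arrow component of
  the first object, the target from the second label of the arrow itself.\<close>

lemma continuous_src_LG: "continuous_map (Arr (LG W)) (Obj (LG W)) fst" (is ?src)
  and continuous_tgt_LG: "continuous_map (Arr (LG W)) (Obj (LG W)) (\<lambda>a. snd (snd a))" (is ?tgt)
proof -
  let ?S = "circle_groupoid W"
  let ?f = "\<lambda>(\<Psi>, \<Lambda>, \<Phi>). (snd \<Psi>, restrict (\<Lambda> \<circ> idt ?S) (topspace (cobj W)))"
  have f: "continuous_map (Arr (LG W)) (prod_topology (CO (carr W) (Arr G)) (CO (cobj W) (Arr G))) ?f"
    using continuous_map_pullback[OF continuous_map_id, of "ars W" ?f] by (subst Arr_LG) (simp only: id_comp)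
  have f1: "continuous_map (Arr (LG W)) (CO (carr W) (Arr G)) (\<lambda>a. snd (fst a))"
    using continuous_map_fst_of[OF f] by (simp add: o_def split_beta)
  have f2: "continuous_map (Arr (LG W)) (CO (cobj W) (Arr G)) (\<lambda>a. restrict (fst (snd a) \<circ> idt ?S) (topspace (cobj W)))"
    using continuous_map_snd_of[OF f] by (simp add: o_def split_beta)
  have a: "fst a \<in> obs W" "snd (snd a) \<in> obs W" "fst (snd a) = arrow_map W (fst (fst a)) (fst (snd (snd a)))" if "a \<in> ars W" for a
    using that ars_iff[of "fst a" "fst (snd a)" "snd (snd a)" W] by simp_all
  have comp: "snd (fst (fst a) p) = snd (fst (snd (snd a)) p)" if "a \<in> ars W" "p \<in> topspace (cobj W)" for a p
    using that ars_iff[of "fst a" "fst (snd a)" "snd (snd a)" W] circle_closed(3)[OF that(2)] circle_closed(5,6)[OF that(2)]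
    unfolding compatible_def by (metis prod.collapse)
  have ext: "fst \<Psi> \<in> extensional (topspace (cobj W))" if "\<Psi> \<in> obs W" for \<Psi>
    using that continuous_mapsD(2) obs_iff by blast
  have val: "arrow_map W F F' (idt ?S p) = ((fst (F p), fst (F' p)), snd (F p))"
    if "p \<in> topspace (cobj W)" for F F' :: "circle_obj \<Rightarrow> 'i \<times> 'm" and p
    using circle_closed(3)[OF that] circle_closed(5,6)[OF that] by (simp add: arrow_map_def)
  have G1: "continuous_map (subtopology (Arr G) UNIV) (Obj G) (\<lambda>a. (fst (fst a), snd a))"
    and G2: "continuous_map (subtopology (Arr G) UNIV) (Obj G) (\<lambda>a. (snd (fst a), snd a))"
    unfolding subtopology_UNIV by (rule cover_groupoid_continuous)+
  show ?src
  proof (rule continuous_into_obs)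
    have "continuous_map (Arr (LG W)) (CO (cobj W) (Obj G))
       (\<lambda>a. \<lambda>p\<in>topspace (cobj W). (\<lambda>a. (fst (fst a), snd a)) ((\<lambda>p\<in>topspace (cobj W). snd (fst a) (idt ?S p)) p))"
      by (rule compact_open_postcompose[OF compact_open_precompose[OF f1 continuous_idt_circle] G1]) simp
    then show "continuous_map (Arr (LG W)) (CO (cobj W) (Obj G)) (\<lambda>a. fst (fst a))"
    proof (rule continuous_map_eq)
      fix x assume x: "x \<in> ars W"
      have "snd (fst x) = arrow_map W (fst (fst x)) (fst (fst x))" using a(1)[OF x] by (simp add: obs_iff)
      then show "(\<lambda>p\<in>topspace (cobj W). (\<lambda>a. (fst (fst a), snd a)) ((\<lambda>p\<in>topspace (cobj W). snd (fst x) (idt ?S p)) p)) = fst (fst x)"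
        using ext[OF a(1)[OF x]] by (intro extensionalityI[of _ "topspace (cobj W)"]) (simp_all add: val)
    qed
  qed (use a in simp)
  show ?tgt
  proof (rule continuous_into_obs)
    have "continuous_map (Arr (LG W)) (CO (cobj W) (Obj G))
       (\<lambda>a. \<lambda>p\<in>topspace (cobj W). (\<lambda>a. (snd (fst a), snd a)) (restrict (fst (snd a) \<circ> idt ?S) (topspace (cobj W)) p))"
      by (rule compact_open_postcompose[OF f2 G2]) simp
    then show "continuous_map (Arr (LG W)) (CO (cobj W) (Obj G)) (\<lambda>a. fst (snd (snd a)))"
    proof (rule continuous_map_eq)
      fix x assume x: "x \<in> ars W"
      show "(\<lambda>p\<in>topspace (cobj W). (\<lambda>a. (snd (fst a), snd a)) (restrict (fst (snd x) \<circ> idt ?S) (topspace (cobj W)) p)) = fst (snd (snd x))"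
        using ext[OF a(2)[OF x]] comp[OF x]
        by (intro extensionalityI[of _ "topspace (cobj W)"]) (simp_all add: a(3)[OF x] val)
    qed
  qed (use a in simp)
qed

lemma topological_groupoid_LG:
  assumes W: "W \<in> admissible_covers"
  shows "topological_groupoid (LG W)"
proof -
  \<comment> \<open>Normal form of a composable pair: three objects with one common loop. After this
    the groupoid laws are identities between arrows named by their ends.\<close>
  have comp: "\<exists>\<Psi> \<Phi> \<Gamma>. \<Psi> \<in> obs W \<and> \<Phi> \<in> obs W \<and> \<Gamma> \<in> obs W \<and> loop_of W \<Psi> = loop_of W \<Phi> \<and> loop_of W \<Phi> = loop_of W \<Gamma> \<and>
      a = arr W \<Psi> \<Phi> \<and> b = arr W \<Phi> \<Gamma>" if "(a, b) \<in> composable (LG W)" for a b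
  proof -
    have ab: "a \<in> ars W" "b \<in> ars W" "tgt (LG W) a = src (LG W) b" using that unfolding composable_def by simp_all
    obtain \<Psi> \<Phi> where a: "\<Psi> \<in> obs W" "\<Phi> \<in> obs W" "loop_of W \<Psi> = loop_of W \<Phi>" "a = arr W \<Psi> \<Phi>"
      using ab(1) W by (rule arsE)
    obtain \<Phi>' \<Gamma> where b: "\<Phi>' \<in> obs W" "\<Gamma> \<in> obs W" "loop_of W \<Phi>' = loop_of W \<Gamma>" "b = arr W \<Phi>' \<Gamma>"
      using ab(2) W by (rule arsE)
    show ?thesis using a b ab(3) by (intro exI[of _ \<Psi>] exI[of _ \<Phi>] exI[of _ \<Gamma>]) (simp add: arr_def)
  qed
  note arr = LG_arr LG_arr_ops[OF W] arr_in_ars[OF W]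
  have g: "groupoid (LG W)"
    unfolding groupoid_def
  proof (intro conjI)
    show "\<forall>(a, b)\<in>composable (LG W). cmp (LG W) a b \<in> ars W \<and>
        src (LG W) (cmp (LG W) a b) = src (LG W) a \<and> tgt (LG W) (cmp (LG W) a b) = tgt (LG W) b"
    proof (rule ballI, rule case_prodI2)
      fix p a b assume "p \<in> composable (LG W)" "p = (a, b)"
      then obtain \<Psi> \<Phi> \<Gamma> where "\<Psi> \<in> obs W" "\<Phi> \<in> obs W" "\<Gamma> \<in> obs W" "loop_of W \<Psi> = loop_of W \<Phi>" "loop_of W \<Phi> = loop_of W \<Gamma>"
        "a = arr W \<Psi> \<Phi>" "b = arr W \<Phi> \<Gamma>" using comp[of a b] by blast
      then show "cmp (LG W) a b \<in> ars W \<and> src (LG W) (cmp (LG W) a b) = src (LG W) a \<and> tgt (LG W) (cmp (LG W) a b) = tgt (LG W) b"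
        by (simp add: arr del: LG_simps)
    qed
    show "\<forall>a b c. (a, b) \<in> composable (LG W) \<and> (b, c) \<in> composable (LG W) \<longrightarrow>
        cmp (LG W) (cmp (LG W) a b) c = cmp (LG W) a (cmp (LG W) b c)"
    proof (intro allI impI, elim conjE)
      fix a b c assume ab: "(a, b) \<in> composable (LG W)" and bc: "(b, c) \<in> composable (LG W)"
      obtain \<Psi> \<Phi> \<Gamma> where 1: "\<Psi> \<in> obs W" "\<Phi> \<in> obs W" "\<Gamma> \<in> obs W" "loop_of W \<Psi> = loop_of W \<Phi>" "loop_of W \<Phi> = loop_of W \<Gamma>"
        "a = arr W \<Psi> \<Phi>" "b = arr W \<Phi> \<Gamma>" using comp[OF ab] by blast
      obtain \<Phi>' \<Gamma>' \<Theta> where 2: "\<Theta> \<in> obs W" "loop_of W \<Gamma>' = loop_of W \<Theta>" "b = arr W \<Phi>' \<Gamma>'" "c = arr W \<Gamma>' \<Theta>"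
        using comp[OF bc] by blast
      have "\<Gamma>' = \<Gamma>" using 1(7) 2(3) by (simp add: arr_def)
      then show "cmp (LG W) (cmp (LG W) a b) c = cmp (LG W) a (cmp (LG W) b c)"
        using 1 2 by (simp add: arr)
    qed
    show "src (LG W) \<in> ars W \<rightarrow> obs W" "tgt (LG W) \<in> ars W \<rightarrow> obs W" "ivt (LG W) \<in> ars W \<rightarrow> ars W"
      by (rule Pi_I, erule arsE[OF _ W], simp add: arr del: LG_simps)+
    show "idt (LG W) \<in> obs W \<rightarrow> ars W"
      by (rule Pi_I) (simp add: arr del: LG_simps)
    show "\<forall>\<Psi>\<in>obs W. src (LG W) (idt (LG W) \<Psi>) = \<Psi> \<and> tgt (LG W) (idt (LG W) \<Psi>) = \<Psi>" by simp
    show "\<forall>a\<in>ars W. cmp (LG W) (idt (LG W) (src (LG W) a)) a = a \<and> cmp (LG W) a (idt (LG W) (tgt (LG W) a)) = a"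
      by (rule ballI, erule arsE[OF _ W]) (simp add: arr del: LG_simps)
    show "\<forall>a\<in>ars W. src (LG W) (ivt (LG W) a) = tgt (LG W) a \<and> tgt (LG W) (ivt (LG W) a) = src (LG W) a \<and>
          cmp (LG W) a (ivt (LG W) a) = idt (LG W) (src (LG W) a) \<and> cmp (LG W) (ivt (LG W) a) a = idt (LG W) (tgt (LG W) a)"
      by (rule ballI, erule arsE[OF _ W]) (simp add: arr del: LG_simps)
  qed
  have ob: "fst a \<in> obs W" "snd (snd a) \<in> obs W" "loop_of W (fst a) = loop_of W (snd (snd a))" "a = arr W (fst a) (snd (snd a))"
    if "a \<in> ars W" for a
    using that ars_iff'[OF W] by blast+
  show ?thesis
    unfolding topological_groupoid_def
  proof (intro conjI g)
    show "continuous_map (Arr (LG W)) (Obj (LG W)) (src (LG W))"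
      by (rule continuous_map_eq[OF continuous_src_LG]) simp
    show "continuous_map (Arr (LG W)) (Obj (LG W)) (tgt (LG W))"
      by (rule continuous_map_eq[OF continuous_tgt_LG]) simp
    have "continuous_map (Obj (LG W)) (Arr (LG W)) (\<lambda>\<Psi>. arr W \<Psi> \<Psi>)"
      by (rule continuous_into_ars[OF W]) simp_all
    then show "continuous_map (Obj (LG W)) (Arr (LG W)) (idt (LG W))"
      by (rule continuous_map_eq) (simp add: arr_def obs_iff)
    have "continuous_map (Arr (LG W)) (Arr (LG W)) (\<lambda>a. arr W (snd (snd a)) (fst a))"
      by (rule continuous_into_ars[OF W continuous_tgt_LG continuous_src_LG]) (simp add: ob)
    then show "continuous_map (Arr (LG W)) (Arr (LG W)) (ivt (LG W))"
      by (rule continuous_map_eq) (metis LG_arr_ops(1)[OF W] ob)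
    let ?P = "subtopology (prod_topology (Arr (LG W)) (Arr (LG W))) (composable (LG W))"
    have pc: "fst p \<in> ars W \<and> snd p \<in> ars W \<and> (fst p, snd p) \<in> composable (LG W)" if "p \<in> topspace ?P" for p
      using that by auto
    have "continuous_map ?P (Arr (LG W)) (\<lambda>p. arr W (fst (fst p)) (snd (snd (snd p))))"
    proof (rule continuous_into_ars[OF W])
      have *: "continuous_map ?P (Arr (LG W)) fst" "continuous_map ?P (Arr (LG W)) snd"
        by (rule continuous_map_from_subtopology, rule continuous_map_fst continuous_map_snd)+
      show "continuous_map ?P (Obj (LG W)) (\<lambda>p. fst (fst p))"
        using continuous_map_compose[OF *(1) continuous_src_LG] by (simp add: o_def)
      show "continuous_map ?P (Obj (LG W)) (\<lambda>p. snd (snd (snd p)))"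
        using continuous_map_compose[OF *(2) continuous_tgt_LG] by (simp add: o_def)
      show "loop_of W (fst (fst p)) = loop_of W (snd (snd (snd p)))" if p: "p \<in> topspace ?P" for p
      proof -
        obtain \<Psi> \<Phi> \<Gamma> where "loop_of W \<Psi> = loop_of W \<Phi>" "loop_of W \<Phi> = loop_of W \<Gamma>" "fst p = arr W \<Psi> \<Phi>" "snd p = arr W \<Phi> \<Gamma>"
          using comp pc[OF p] by metis
        then show ?thesis by (simp add: arr_def)
      qed
    qed
    then show "continuous_map ?P (Arr (LG W)) (\<lambda>(a, b). cmp (LG W) a b)"
    proof (rule continuous_map_eq)
      fix p assume p: "p \<in> topspace ?P"
      obtain \<Psi> \<Phi> \<Gamma> where "\<Psi> \<in> obs W" "\<Phi> \<in> obs W" "\<Gamma> \<in> obs W" "loop_of W \<Psi> = loop_of W \<Phi>" "loop_of W \<Phi> = loop_of W \<Gamma>"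
         "fst p = arr W \<Psi> \<Phi>" "snd p = arr W \<Phi> \<Gamma>"
        using comp pc[OF p] by metis
      then show "arr W (fst (fst p)) (snd (snd (snd p))) = (case p of (a, b) \<Rightarrow> cmp (LG W) a b)"
        using LG_arr_ops(2)[OF W, of \<Psi> \<Phi> \<Gamma>] by (simp add: split_beta) (simp add: arr_def)
    qed
  qed
qed

end

section \<open>Restriction along a refinement of covers\<close>

lemma refinement_morphism_eq:
  "fst (refinement_morphism W) p = (coarse_piece (fst W) (fst p), snd p)"
  "snd (refinement_morphism W) r =
     (((coarse_piece (fst W) (fst (fst (fst r))), coarse_piece (fst W) (snd (fst (fst r)))), snd (fst r)), snd r)"
  by (simp_all add: refinement_morphism_def Let_def split_beta)

lemma refinement_closed:
  assumes W: "W \<in> admissible_covers" and W': "W' \<in> admissible_covers" and ref: "cover_refines W' W"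
  shows "p \<in> topspace (cobj W') \<Longrightarrow> fst (refinement_morphism W) p \<in> topspace (cobj W)"
    "r \<in> topspace (carr W') \<Longrightarrow> snd (refinement_morphism W) r \<in> topspace (carr W)"
    "src (circle_groupoid W) (snd (refinement_morphism W) r) = fst (refinement_morphism W) (src (circle_groupoid W') r)"
    "tgt (circle_groupoid W) (snd (refinement_morphism W) r) = fst (refinement_morphism W) (tgt (circle_groupoid W') r)"
proof -
  note Q = admissible_point_set[OF W]
  have "coarse_piece (fst W) \<beta> \<in> pieces W" for \<beta>
    using coarse_piece(1)[OF Q] by (simp add: pieces_def mem_Times_iff)
  moreover have "x \<in> interval_of W (coarse_piece (fst W) \<beta>)" if "\<beta> \<in> pieces W'" "x \<in> interval_of W' \<beta>" for \<beta> x
    using interval_of_coarse_piece[OF W W' ref that(1)] that(2) by blast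
  ultimately show "p \<in> topspace (cobj W') \<Longrightarrow> fst (refinement_morphism W) p \<in> topspace (cobj W)"
    "r \<in> topspace (carr W') \<Longrightarrow> snd (refinement_morphism W) r \<in> topspace (carr W)"
    by (simp_all add: mem_cobj mem_carr_iff refinement_morphism_eq)
  show "src (circle_groupoid W) (snd (refinement_morphism W) r) = fst (refinement_morphism W) (src (circle_groupoid W') r)"
    "tgt (circle_groupoid W) (snd (refinement_morphism W) r) = fst (refinement_morphism W) (tgt (circle_groupoid W') r)"
    by (simp_all add: src_circle tgt_circle refinement_morphism_eq coarse_piece_shift[OF Q])
qed

lemma continuous_refinement:
  assumes W: "W \<in> admissible_covers" and W': "W' \<in> admissible_covers" and ref: "cover_refines W' W"
  shows "continuous_map (cobj W') (cobj W) (fst (refinement_morphism W))"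
  unfolding continuous_map_into_cobj
proof (intro conjI ballI)
  have "coarse_piece (fst W) \<in> pieces W' \<rightarrow> topspace (discrete_topology (pieces W))"
    using coarse_piece(1)[OF admissible_point_set[OF W]] by (simp add: pieces_def mem_Times_iff)
  from continuous_map_discrete_compose[OF continuous_cobj(1) this]
  show "continuous_map (cobj W') (discrete_topology (pieces W)) (\<lambda>z. fst (fst (refinement_morphism W) z))"
    by (simp add: refinement_morphism_eq)
  show "continuous_map (cobj W') euclideanreal (\<lambda>z. snd (fst (refinement_morphism W) z))"
    using continuous_cobj(2) by (simp add: refinement_morphism_eq)
qed (use refinement_closed(1)[OF assms] in \<open>simp add: mem_cobj\<close>)

context cover_loops
begin

abbreviation "\<tau> \<equiv> loop_restriction :: cover \<Rightarrow> cover \<Rightarrow>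
    (('i \<times> 'm, ('i \<times> 'i) \<times> 'm) loop_obj \<Rightarrow> ('i \<times> 'm, ('i \<times> 'i) \<times> 'm) loop_obj) \<times>
    (('i \<times> 'm, ('i \<times> 'i) \<times> 'm) loop_arr \<Rightarrow> ('i \<times> 'm, ('i \<times> 'i) \<times> 'm) loop_arr)"

lemma restriction_obj:
  "fst (fst (\<tau> W W') \<Psi>) = (\<lambda>p\<in>topspace (cobj W'). fst \<Psi> (fst (refinement_morphism W) p))"
  "snd (fst (\<tau> W W') \<Psi>) = (\<lambda>r\<in>topspace (carr W'). snd \<Psi> (snd (refinement_morphism W) r))"
  by (simp_all add: loop_restriction_def Let_def o_def)

context
  fixes W W' :: cover
  assumes W: "W \<in> admissible_covers" and W': "W' \<in> admissible_covers" and ref: "cover_refines W' W"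
begin

lemma restriction_arrow_map:
  "(\<lambda>r\<in>topspace (carr W'). arrow_map W F F' (snd (refinement_morphism W) r)) =
   arrow_map W' (\<lambda>p\<in>topspace (cobj W'). F (fst (refinement_morphism W) p)) (\<lambda>p\<in>topspace (cobj W'). F' (fst (refinement_morphism W) p))"
  unfolding arrow_map_def
  by (rule restrict_ext) (simp add: refinement_closed[OF W W' ref] circle_closed)

text \<open>Refinement renames the interval but leaves the real coordinate alone. Hence it respects
  sources and targets, and the loop does not change.\<close>

lemma restriction_obs:
  assumes \<Psi>: "\<Psi> \<in> obs W"
  shows "fst (\<tau> W W') \<Psi> \<in> obs W'" "loop_of W' (fst (\<tau> W W') \<Psi>) = loop_of W \<Psi>"
proof -
  show ob: "fst (\<tau> W W') \<Psi> \<in> obs W'"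
    unfolding obs_iff
  proof (intro conjI)
    have "continuous_map (cobj W) (Obj G) (fst \<Psi>)" using \<Psi> by (simp add: obs_iff continuous_mapsD(1))
    from continuous_mapsI[OF continuous_map_compose[OF continuous_refinement[OF W W' ref] this]]
    show "fst (fst (\<tau> W W') \<Psi>) \<in> continuous_maps (cobj W') (Obj G)"
      by (simp add: restriction_obj o_def)
    show "compatible W' (fst (fst (\<tau> W W') \<Psi>)) (fst (fst (\<tau> W W') \<Psi>))"
      unfolding compatible_def
    proof
      fix r assume r: "r \<in> topspace (carr W')"
      have "snd (fst \<Psi> (src (circle_groupoid W) (snd (refinement_morphism W) r))) =
            snd (fst \<Psi> (tgt (circle_groupoid W) (snd (refinement_morphism W) r)))"
        using \<Psi> refinement_closed(2)[OF W W' ref r] unfolding obs_iff compatible_def by blast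
      then show "snd (fst (fst (\<tau> W W') \<Psi>) (src (circle_groupoid W') r)) = snd (fst (fst (\<tau> W W') \<Psi>) (tgt (circle_groupoid W') r))"
        using r by (simp add: restriction_obj circle_closed refinement_closed[OF W W' ref])
    qed
    have "snd \<Psi> = arrow_map W (fst \<Psi>) (fst \<Psi>)" using \<Psi> by (simp add: obs_iff)
    then show "snd (fst (\<tau> W W') \<Psi>) = arrow_map W' (fst (fst (\<tau> W W') \<Psi>)) (fst (fst (\<tau> W W') \<Psi>))"
      by (simp add: restriction_obj restriction_arrow_map)
  qed
  show "loop_of W' (fst (\<tau> W W') \<Psi>) = loop_of W \<Psi>"
  proof (rule extensionalityI[of _ "sphere 0 1"])
    fix z :: complex assume "z \<in> sphere 0 1"
    then obtain p where p: "p \<in> topspace (cobj W')" "z = ex (snd p)"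
      using core_surj[OF W'] core_subset[OF W'] by blast
    have "loop_of W' (fst (\<tau> W W') \<Psi>) z = snd (fst \<Psi> (fst (refinement_morphism W) p))"
      using loop_of_ex[OF ob p(1)] p by (simp add: restriction_obj)
    also have "\<dots> = loop_of W \<Psi> z"
      using loop_of_ex[OF \<Psi> refinement_closed(1)[OF W W' ref p(1)]] p by (simp add: refinement_morphism_eq)
    finally show "loop_of W' (fst (\<tau> W W') \<Psi>) z = loop_of W \<Psi> z" .
  qed (simp_all add: loop_of_def)
qed

lemma restriction_arr: "snd (\<tau> W W') (arr W \<Psi> \<Phi>) = arr W' (fst (\<tau> W W') \<Psi>) (fst (\<tau> W W') \<Phi>)"
  by (simp add: arr_def restriction_obj restriction_arrow_map[symmetric])
     (simp add: loop_restriction_def Let_def o_def)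

lemma continuous_restriction: "continuous_map (Obj (LG W)) (Obj (LG W')) (fst (\<tau> W W'))"
  by (rule continuous_into_obs)
     (simp_all add: restriction_obs compact_open_precompose[OF continuous_fst_obs continuous_refinement[OF W W' ref]] restriction_obj)

lemma restriction_morphism: "groupoid_morphism (LG W) (LG W') (\<tau> W W')"
  unfolding groupoid_morphism_def
proof (intro conjI continuous_restriction)
  note E = arsE[OF _ W]
  note arr = LG_arr LG_arr_ops[OF W] LG_arr_ops[OF W'] restriction_obs restriction_arr
  have "continuous_map (Arr (LG W)) (Arr (LG W')) (\<lambda>a. arr W' (fst (\<tau> W W') (fst a)) (fst (\<tau> W W') (snd (snd a))))"
  proof (rule continuous_into_ars[OF W'])
    show "continuous_map (Arr (LG W)) (Obj (LG W')) (\<lambda>a. fst (\<tau> W W') (fst a))"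
      "continuous_map (Arr (LG W)) (Obj (LG W')) (\<lambda>a. fst (\<tau> W W') (snd (snd a)))"
      using continuous_map_compose[OF continuous_src_LG continuous_restriction]
        continuous_map_compose[OF continuous_tgt_LG continuous_restriction] by (simp_all add: o_def)
    fix a assume "a \<in> ars W"
    then show "loop_of W' (fst (\<tau> W W') (fst a)) = loop_of W' (fst (\<tau> W W') (snd (snd a)))"
      by (rule E) (simp add: restriction_obs arr_def)
  qed
  then show "continuous_map (Arr (LG W)) (Arr (LG W')) (snd (\<tau> W W'))"
    by (rule continuous_map_eq) (erule E, simp add: restriction_arr, simp add: arr_def)
  show "\<forall>a\<in>ars W. src (LG W') (snd (\<tau> W W') a) = fst (\<tau> W W') (src (LG W) a) \<and>
      tgt (LG W') (snd (\<tau> W W') a) = fst (\<tau> W W') (tgt (LG W) a) \<and>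
      snd (\<tau> W W') (ivt (LG W) a) = ivt (LG W') (snd (\<tau> W W') a)"
    by (rule ballI, erule E) (simp add: arr del: LG_simps)
  show "\<forall>\<Psi>\<in>obs W. snd (\<tau> W W') (idt (LG W) \<Psi>) = idt (LG W') (fst (\<tau> W W') \<Psi>)"
    by (simp add: arr del: LG_simps)
  show "\<forall>(a, b)\<in>composable (LG W). snd (\<tau> W W') (cmp (LG W) a b) = cmp (LG W') (snd (\<tau> W W') a) (snd (\<tau> W W') b)"
  proof (rule ballI, rule case_prodI2)
    fix p a b assume "p \<in> composable (LG W)" "p = (a, b)"
    then have ab: "a \<in> ars W" "b \<in> ars W" "tgt (LG W) a = src (LG W) b" unfolding composable_def by simp_all
    obtain \<Psi> \<Phi> where a: "\<Psi> \<in> obs W" "\<Phi> \<in> obs W" "loop_of W \<Psi> = loop_of W \<Phi>" "a = arr W \<Psi> \<Phi>"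
      using ab(1) by (rule E)
    obtain \<Phi>' \<Gamma> where b: "\<Phi>' \<in> obs W" "\<Gamma> \<in> obs W" "loop_of W \<Phi>' = loop_of W \<Gamma>" "b = arr W \<Phi>' \<Gamma>"
      using ab(2) by (rule E)
    have "\<Phi>' = \<Phi>" using a b ab(3) by (simp add: arr_def)
    then show "snd (\<tau> W W') (cmp (LG W) a b) = cmp (LG W') (snd (\<tau> W W') a) (snd (\<tau> W W') b)"
      using a b by (simp add: arr del: LG_simps)
  qed
qed

end

lemma restriction_trans:
  assumes W: "W \<in> admissible_covers" "W' \<in> admissible_covers" "W'' \<in> admissible_covers"
    and ref: "cover_refines W' W" "cover_refines W'' W'" and \<Psi>: "\<Psi> \<in> obs W"
  shows "fst (\<tau> W' W'') (fst (\<tau> W W') \<Psi>) = fst (\<tau> W W'') \<Psi>"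
proof -
  have ref': "cover_refines W'' W" using ref cover_refines_trans by blast
  have "fst (refinement_morphism W) (fst (refinement_morphism W') p) = fst (refinement_morphism W) p" for p
    using coarse_piece_trans[OF admissible_point_set[OF W(1)] admissible_point_set[OF W(2)]] ref
    by (simp add: refinement_morphism_eq cover_refines_def)
  then have "fst (fst (\<tau> W' W'') (fst (\<tau> W W') \<Psi>)) = fst (fst (\<tau> W W'') \<Psi>)"
    unfolding restriction_obj
    by (intro restrict_ext) (simp add: refinement_closed(1)[OF W(2,3) ref(2)])
  then show ?thesis
    using restriction_obs(1)[OF W(2,3) ref(2) restriction_obs(1)[OF W(1,2) ref(1) \<Psi>]]
      restriction_obs(1)[OF W(1,3) ref' \<Psi>] by (intro obs_eqI)
qed

text \<open>When only epsilon shrinks, every interval keeps its address, so restricting an object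
  does not change its values on the smaller domain.\<close>

lemma restriction_same_points:
  assumes "W \<in> admissible_covers" "fst W' = fst W" "p \<in> topspace (cobj W')"
  shows "fst (fst (\<tau> W W') \<Psi>) p = fst \<Psi> p"
proof -
  have "coarse_piece (fst W) (fst p) = fst p"
    using coarse_piece_id[OF admissible_point_set[OF assms(1)], of "fst p"] assms(2,3)
    by (simp add: mem_cobj pieces_def mem_Times_iff)
  then show ?thesis using assms(3) by (simp add: restriction_obj refinement_morphism_eq)
qed

lemma restriction_id:
  assumes "W \<in> admissible_covers" "\<Psi> \<in> obs W"
  shows "fst (\<tau> W W) \<Psi> = \<Psi>"
proof (rule obs_eqI[OF restriction_obs(1)[OF assms(1,1) cover_refines_refl assms(2)] assms(2)])
  show "fst (fst (\<tau> W W) \<Psi>) = fst \<Psi>"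
  proof (rule extensionalityI[of _ "topspace (cobj W)"])
    show "fst \<Psi> \<in> extensional (topspace (cobj W))" using assms(2) continuous_mapsD(2) obs_iff by blast
    show "fst (fst (\<tau> W W) \<Psi>) \<in> extensional (topspace (cobj W))" by (simp add: restriction_obj)
  qed (rule restriction_same_points[OF assms(1) refl])
qed

text \<open>Finer covers come later in the system, hence the reversed order of the
  arguments.\<close>

sublocale limit: directed_system admissible_covers "\<lambda>W W'. cover_refines W' W" LG loop_restriction
proof
  fix i j k :: cover and x and a
  assume i: "i \<in> admissible_covers"
  show "cover_refines i i" by (rule cover_refines_refl)
  show "topological_groupoid (LG i)" by (rule topological_groupoid_LG[OF i])
  show "x \<in> obs i \<Longrightarrow> fst (\<tau> i i) x = x" by (rule restriction_id[OF i])
  show "a \<in> ars i \<Longrightarrow> snd (\<tau> i i) a = a"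
    by (erule arsE[OF _ i]) (simp add: restriction_arr[OF i i cover_refines_refl] restriction_id[OF i])
  assume j: "j \<in> admissible_covers"
  show "\<exists>k\<in>admissible_covers. cover_refines k i \<and> cover_refines k j" by (rule covers_directed[OF i j])
  show "cover_refines j i \<Longrightarrow> groupoid_morphism (LG i) (LG j) (\<tau> i j)" by (rule restriction_morphism[OF i j])
  assume k: "k \<in> admissible_covers" and ij: "cover_refines j i" and jk: "cover_refines k j"
  show ik: "cover_refines k i" using ij jk cover_refines_trans by blast
  show tr: "fst (\<tau> j k) (fst (\<tau> i j) x) = fst (\<tau> i k) x" if "x \<in> obs i" for x
    by (rule restriction_trans[OF i j k ij jk that])
  show "snd (\<tau> j k) (snd (\<tau> i j) a) = snd (\<tau> i k) a" if "a \<in> ars i"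
    using that i by (rule arsE) (simp add: restriction_arr i j k ij jk ik tr)
qed

section \<open>Objects given by a loop and a labelling of the intervals\<close>

definition obj_of :: "cover \<Rightarrow> (piece \<Rightarrow> 'i) \<Rightarrow> (complex \<Rightarrow> 'm) \<Rightarrow> ('i \<times> 'm, ('i \<times> 'i) \<times> 'm) loop_obj" where
  "obj_of W \<alpha> f = (let F = \<lambda>p\<in>topspace (cobj W). (\<alpha> (fst p), f (ex (snd p))) in (F, arrow_map W F F))"

text \<open>All integer translates of an interval are tested, each with its own label, although the
  loop takes the same values on all of them.\<close>

definition subordinate :: "cover \<Rightarrow> (piece \<Rightarrow> 'i) \<Rightarrow> (complex \<Rightarrow> 'm) \<Rightarrow> bool" where
  "subordinate W \<alpha> f \<longleftrightarrow> (\<forall>\<beta>\<in>pieces W. \<alpha> \<beta> \<in> I \<and> (\<forall>x\<in>interval_of W \<beta>. f (ex x) \<in> U (\<alpha> \<beta>)))"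

lemma fst_obj_of: "fst (obj_of W \<alpha> f) = (\<lambda>p\<in>topspace (cobj W). (\<alpha> (fst p), f (ex (snd p))))"
  by (simp add: obj_of_def Let_def)

text \<open>The label component does not vary with the parameter, the point component varies with
  the loop, and subordination puts the pair into the disjoint union.\<close>

lemma continuous_obj_of_aux:
  assumes \<phi>: "continuous_map P Loops \<phi>" and sub: "\<And>p. p \<in> topspace P \<Longrightarrow> subordinate W \<alpha> (\<phi> p)"
  shows "continuous_map P (CO (cobj W) (Obj G)) (\<lambda>p. fst (obj_of W \<alpha> (\<phi> p)))"
\<comment> \<open>With an empty parameter space the hypothesis says nothing about the labels, which
  might then lie outside \<open>I\<close>.\<close>
proof (cases "topspace P = {}")
  case False
  then obtain p0 where "p0 \<in> topspace P" by blast
  then have \<alpha>: "\<alpha> \<in> pieces W \<rightarrow> topspace (discrete_topology I)" using sub by (auto simp: subordinate_def)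
  have "continuous_map P (CO (cobj W) (discrete_topology I)) (\<lambda>p. \<lambda>x\<in>topspace (cobj W). \<alpha> (fst x))"
    using continuous_mapsI[OF continuous_map_discrete_compose[OF continuous_cobj(1) \<alpha>]] by simp
  moreover have "continuous_map P (CO (cobj W) M) (\<lambda>p. \<lambda>x\<in>topspace (cobj W). \<phi> p (ex (snd x)))"
    by (rule compact_open_precompose[OF \<phi>[unfolded free_loop_space_def] continuous_ex_cobj])
  ultimately have 1: "continuous_map P (CO (cobj W) (prod_topology (discrete_topology I) M))
     (\<lambda>p. \<lambda>x\<in>topspace (cobj W). ((\<lambda>x\<in>topspace (cobj W). \<alpha> (fst x)) x, (\<lambda>x\<in>topspace (cobj W). \<phi> p (ex (snd x))) x))"
    by (rule compact_open_pair[OF Hausdorff_cobj])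
  have 2: "continuous_map (subtopology (prod_topology (discrete_topology I) M) (Sigma I U)) (Obj G) (\<lambda>y. y)"
    by (simp add: cover_groupoid_topologies sum_topology_subtopology)
  have "continuous_map P (CO (cobj W) (Obj G)) (\<lambda>p. \<lambda>x\<in>topspace (cobj W).
     ((\<lambda>x\<in>topspace (cobj W). ((\<lambda>x\<in>topspace (cobj W). \<alpha> (fst x)) x, (\<lambda>x\<in>topspace (cobj W). \<phi> p (ex (snd x))) x)) x))"
    by (rule compact_open_postcompose[OF 1 2]) (use sub in \<open>simp add: subordinate_def mem_cobj\<close>)
  then show ?thesis
    by (rule continuous_map_eq) (auto simp: fst_obj_of)
qed (simp add: continuous_map_on_empty2 null_topspace_iff_trivial)

lemma obj_of_obs:
  assumes f: "f \<in> topspace Loops" and sub: "subordinate W \<alpha> f"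
  shows "obj_of W \<alpha> f \<in> obs W"
  unfolding obs_iff
proof (intro conjI)
  have "continuous_map (discrete_topology {()}) (CO (cobj W) (Obj G)) (\<lambda>p. fst (obj_of W \<alpha> f))"
    using f by (intro continuous_obj_of_aux sub) simp
  from compact_open_value[OF this] show "fst (obj_of W \<alpha> f) \<in> continuous_maps (cobj W) (Obj G)" by simp
  have "ex (snd (src (circle_groupoid W) r)) = ex (snd (tgt (circle_groupoid W) r))" for r
    by (simp add: src_circle tgt_circle)
  then show "compatible W (fst (obj_of W \<alpha> f)) (fst (obj_of W \<alpha> f))"
    by (simp add: compatible_def fst_obj_of circle_closed)
qed (simp add: obj_of_def Let_def)

lemma continuous_obj_of:
  assumes \<phi>: "continuous_map P Loops \<phi>" and sub: "\<And>p. p \<in> topspace P \<Longrightarrow> subordinate W \<alpha> (\<phi> p)"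
  shows "continuous_map P (Obj (LG W)) (\<lambda>p. obj_of W \<alpha> (\<phi> p))"
proof (rule continuous_into_obs)
  fix p assume "p \<in> topspace P"
  then show "obj_of W \<alpha> (\<phi> p) \<in> obs W" using continuous_map_funspace[OF \<phi>] sub by (intro obj_of_obs) auto
qed (rule continuous_obj_of_aux[OF assms])

lemma loop_of_obj_of:
  assumes W: "W \<in> admissible_covers" and f: "f \<in> topspace Loops" and sub: "subordinate W \<alpha> f"
  shows "loop_of W (obj_of W \<alpha> f) = f"
proof (rule extensionalityI[of _ "sphere 0 1"])
  show "f \<in> extensional (sphere 0 1)" using f continuous_mapsD(2)[of f "top_of_set (sphere 0 1)" M] by (simp add: free_loop_space_def)
  fix z :: complex assume "z \<in> sphere 0 1"
  then obtain p where p: "p \<in> topspace (cobj W)" "z = ex (snd p)"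
    using core_surj[OF W] core_subset[OF W] by blast
  then show "loop_of W (obj_of W \<alpha> f) z = f z"
    using loop_of_ex[OF obj_of_obs[OF f sub] p(1)] by (simp add: fst_obj_of)
qed (simp add: loop_of_def)

text \<open>Each interval is connected and labels form a discrete space, so the label is constant on
  it.\<close>

lemma obs_label:
  assumes W: "W \<in> admissible_covers" and \<Psi>: "\<Psi> \<in> obs W"
  obtains \<alpha> where "subordinate W \<alpha> (loop_of W \<Psi>)"
    "\<And>p. p \<in> topspace (cobj W) \<Longrightarrow> fst \<Psi> p = (\<alpha> (fst p), loop_of W \<Psi> (ex (snd p)))"
proof -
  \<comment> \<open>The left end before thickening serves as sample point; thickening makes it an
    interior point of the interval.\<close>
  define \<alpha> where "\<alpha> \<beta> = fst (fst \<Psi> (\<beta>, left_end \<beta>))" for \<beta>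
  have c: "continuous_map (cobj W) (Obj G) (fst \<Psi>)" using \<Psi> by (simp add: obs_iff continuous_mapsD(1))
  have label: "fst (fst \<Psi> p) = \<alpha> (fst p)" if p: "p \<in> topspace (cobj W)" for p
  proof -
    have \<beta>: "fst p \<in> pieces W" using p by (simp add: mem_cobj)
    have c': "continuous_map (top_of_set (interval_of W (fst p))) (discrete_topology I) (\<lambda>x. fst (fst \<Psi> (fst p, x)))"
      using continuous_map_compose[OF continuous_map_compose[OF
          continuous_map_component_injection[of "fst p" "pieces W" "\<lambda>\<beta>. top_of_set (interval_of W \<beta>)", folded cobj_eq] c]
        continuous_map_from_sum(1)[where I = I and U = U and X = M, folded cover_groupoid_topologies]] \<beta>
      by (simp add: o_def)
    have "connected (interval_of W (fst p))" unfolding interval_of_eq by simp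
    then have "connectedin (top_of_set (interval_of W (fst p))) (interval_of W (fst p))"
      by (simp add: connectedin_subtopology)
    from connectedin_continuous_map_image[OF c' this]
    have conn: "connectedin (discrete_topology I) ((\<lambda>x. fst (fst \<Psi> (fst p, x))) ` interval_of W (fst p))" .
    have "left_end (fst p) \<in> interval_of W (fst p)"
      using left_end_less_right_end[OF admissible_point_set[OF W], of "fst p"] admissible_pos[OF W] \<beta>
      by (simp add: interval_of_eq pieces_def mem_Times_iff)
    moreover have "snd p \<in> interval_of W (fst p)" using p by (simp add: mem_cobj)
    ultimately have "fst (fst \<Psi> (fst p, snd p)) = fst (fst \<Psi> (fst p, left_end (fst p)))"
      using conn unfolding connectedin_discrete_topology by blast
    then show ?thesis by (simp add: \<alpha>_def)
  qed
  have val: "fst \<Psi> p = (\<alpha> (fst p), loop_of W \<Psi> (ex (snd p)))" if "p \<in> topspace (cobj W)" for p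
    using label[OF that] loop_of_ex[OF \<Psi> that] by (simp add: prod_eq_iff)
  moreover have "subordinate W \<alpha> (loop_of W \<Psi>)"
    unfolding subordinate_def
  proof (intro ballI conjI)
    fix \<beta> assume \<beta>: "\<beta> \<in> pieces W"
    have mem: "\<alpha> \<beta> \<in> I \<and> loop_of W \<Psi> (ex x) \<in> U (\<alpha> \<beta>)" if "x \<in> interval_of W \<beta>" for x
    proof -
      have p: "(\<beta>, x) \<in> topspace (cobj W)" using that \<beta> by (simp add: mem_cobj)
      have "fst \<Psi> (\<beta>, x) \<in> topspace (Obj G)" using continuous_map_funspace[OF c] p by blast
      then show ?thesis using val[OF p] by (simp add: cover_groupoid_topologies)
    qed
    then show "\<And>x. x \<in> interval_of W \<beta> \<Longrightarrow> loop_of W \<Psi> (ex x) \<in> U (\<alpha> \<beta>)" by blast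
    have "left_end \<beta> \<in> interval_of W \<beta>"
      using left_end_less_right_end[OF admissible_point_set[OF W], of \<beta>] admissible_pos[OF W] \<beta>
      by (simp add: interval_of_eq pieces_def mem_Times_iff)
    then show "\<alpha> \<beta> \<in> I" using mem by blast
  qed
  ultimately show thesis using that by blast
qed

end

lemma groupoid_laws:
  assumes "groupoid G"
  shows "a \<in> topspace (Arr G) \<Longrightarrow> src G a \<in> topspace (Obj G)" "a \<in> topspace (Arr G) \<Longrightarrow> tgt G a \<in> topspace (Obj G)"
  "x \<in> topspace (Obj G) \<Longrightarrow> idt G x \<in> topspace (Arr G)" "a \<in> topspace (Arr G) \<Longrightarrow> ivt G a \<in> topspace (Arr G)"
  "x \<in> topspace (Obj G) \<Longrightarrow> src G (idt G x) = x" "x \<in> topspace (Obj G) \<Longrightarrow> tgt G (idt G x) = x"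
  "a \<in> topspace (Arr G) \<Longrightarrow> src G (ivt G a) = tgt G a" "a \<in> topspace (Arr G) \<Longrightarrow> tgt G (ivt G a) = src G a"
  "(a, b) \<in> composable G \<Longrightarrow> cmp G a b \<in> topspace (Arr G)"
  "(a, b) \<in> composable G \<Longrightarrow> src G (cmp G a b) = src G a" "(a, b) \<in> composable G \<Longrightarrow> tgt G (cmp G a b) = tgt G b"
  using assms unfolding groupoid_def by blast+

section \<open>The colimit carries the final topology on objects\<close>

context directed_system
begin

definition final_topology :: "('i \<times> 'o) set topology" where
  "final_topology = topology (\<lambda>V. V \<subseteq> lim_obj \<and> (\<forall>i\<in>I. openin (Obj (G i)) {x \<in> ob i. og i x \<in> V}))"

lemma openin_final_topology:
  "openin final_topology V \<longleftrightarrow> V \<subseteq> lim_obj \<and> (\<forall>i\<in>I. openin (Obj (G i)) {x \<in> ob i. og i x \<in> V})"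
proof -
  have "istopology (\<lambda>V. V \<subseteq> lim_obj \<and> (\<forall>i\<in>I. openin (Obj (G i)) {x \<in> ob i. og i x \<in> V}))"
    unfolding istopology_def
  proof (intro conjI allI impI)
    fix S T
    assume S: "S \<subseteq> lim_obj \<and> (\<forall>i\<in>I. openin (Obj (G i)) {x \<in> ob i. og i x \<in> S})"
      and T: "T \<subseteq> lim_obj \<and> (\<forall>i\<in>I. openin (Obj (G i)) {x \<in> ob i. og i x \<in> T})"
    show "S \<inter> T \<subseteq> lim_obj" using S by blast
    show "\<forall>i\<in>I. openin (Obj (G i)) {x \<in> ob i. og i x \<in> S \<inter> T}"
    proof
      fix i assume i: "i \<in> I"
      have "openin (Obj (G i)) ({x \<in> ob i. og i x \<in> S} \<inter> {x \<in> ob i. og i x \<in> T})"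
        by (rule openin_Int) (use S T i in blast)+
      moreover have "{x \<in> ob i. og i x \<in> S \<inter> T} = {x \<in> ob i. og i x \<in> S} \<inter> {x \<in> ob i. og i x \<in> T}" by blast
      ultimately show "openin (Obj (G i)) {x \<in> ob i. og i x \<in> S \<inter> T}" by (simp only:)
    qed
  next
    fix \<K> assume K: "\<forall>K\<in>\<K>. K \<subseteq> lim_obj \<and> (\<forall>i\<in>I. openin (Obj (G i)) {x \<in> ob i. og i x \<in> K})"
    then show "\<Union>\<K> \<subseteq> lim_obj" by blast
    have "{x \<in> ob i. og i x \<in> \<Union>\<K>} = (\<Union>K\<in>\<K>. {x \<in> ob i. og i x \<in> K})" for i by blast
    then show "\<forall>i\<in>I. openin (Obj (G i)) {x \<in> ob i. og i x \<in> \<Union>\<K>}" using K by auto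
  qed
  then show ?thesis by (simp add: final_topology_def)
qed

lemma topspace_final_topology: "topspace final_topology = lim_obj"
proof -
  have "{x \<in> ob i. og i x \<in> lim_obj} = ob i" if "i \<in> I" for i using that lim_objI by blast
  then have "openin final_topology lim_obj" unfolding openin_final_topology by simp
  from equalityI[OF openin_final_topology[THEN iffD1, OF openin_topspace, THEN conjunct1] openin_subset[OF this]]
  show ?thesis .
qed

text \<open>The final topology has to occur as the object part of some admissible pair. Give the
  arrows the coarsest topology that makes source and target continuous: a structure map into it is
  continuous as soon as its source and target are, and those follow from the groupoid laws. So the
  composition causes no trouble, however coarse this arrow topology is.\<close>

lemma limO_finer: "openin final_topology V \<Longrightarrow> openin limO V"
proof -
  let ?st = "\<lambda>A. (src colim A, tgt colim A)"
  let ?T = "pullback_topology lim_arr ?st (prod_topology final_topology final_topology)"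
  let ?L = "limit_groupoid I le G \<tau> final_topology ?T"
  have st: "src colim A \<in> lim_obj" "tgt colim A \<in> lim_obj" if "A \<in> lim_arr" for A
    by (rule funcset_mem[OF L_types(1)[OF topspace_lim, folded colim_eq] that]
        funcset_mem[OF L_types(2)[OF topspace_lim, folded colim_eq] that])+
  have top: "topspace ?T = lim_arr"
    unfolding topspace_pullback_topology topspace_prod_topology topspace_final_topology
    by (rule Int_absorb1, rule subsetI, rule vimageI2, rule SigmaI; rule st)
  have g: "groupoid ?L" by (rule groupoid_L) (rule topspace_final_topology top)+
  note ty = L_types[OF topspace_final_topology top]
  note irr = limit_groupoid_topology_irrelevant[of final_topology ?T]
  have st_cont: "continuous_map ?T (prod_topology final_topology final_topology) ?st"
    using continuous_map_pullback[OF continuous_map_id, of lim_arr ?st] by (simp only: id_comp)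
  then have s: "continuous_map ?T final_topology (src ?L)" and t: "continuous_map ?T final_topology (tgt ?L)"
    unfolding irr by (simp_all add: continuous_map_pairwise o_def)
  have into: "continuous_map P ?T h" if h: "h \<in> topspace P \<rightarrow> lim_arr"
      and c: "continuous_map P final_topology (\<lambda>p. src ?L (h p))" "continuous_map P final_topology (\<lambda>p. tgt ?L (h p))"
    for P :: "'p topology" and h
  proof (rule continuous_map_pullback')
    show "continuous_map P (prod_topology final_topology final_topology) (?st \<circ> h)"
      using c unfolding irr by (simp add: continuous_map_pairwise o_def)
  qed (rule subsetI, rule vimageI2, erule funcset_mem[OF h])
  have laws: "src ?L (idt ?L x) = x" "tgt ?L (idt ?L x) = x" if "x \<in> lim_obj" for x
    by (rule groupoid_laws(5,6)[OF g, unfolded Obj_L topspace_final_topology, OF that])+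
  have laws': "src ?L (ivt ?L A) = tgt ?L A" "tgt ?L (ivt ?L A) = src ?L A" if "A \<in> lim_arr" for A
    by (rule groupoid_laws(7,8)[OF g, unfolded Arr_L top, OF that])+
  note laws'' = groupoid_laws(10,11)[OF g]
  have id: "continuous_map final_topology final_topology (\<lambda>x. x)" by simp
  have "topological_groupoid ?L"
    unfolding topological_groupoid_def Obj_L Arr_L
  proof (intro conjI g s t into)
    show "continuous_map final_topology final_topology (\<lambda>p. src ?L (idt ?L p))"
      by (rule continuous_map_eq[OF id]) (simp only: topspace_final_topology laws)
    show "continuous_map final_topology final_topology (\<lambda>p. tgt ?L (idt ?L p))"
      by (rule continuous_map_eq[OF id]) (simp only: topspace_final_topology laws)
    show "continuous_map ?T final_topology (\<lambda>p. src ?L (ivt ?L p))"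
      by (rule continuous_map_eq[OF t]) (simp only: top laws')
    show "continuous_map ?T final_topology (\<lambda>p. tgt ?L (ivt ?L p))"
      by (rule continuous_map_eq[OF s]) (simp only: top laws')
    let ?P = "subtopology (prod_topology ?T ?T) (composable ?L)"
    have P: "p \<in> topspace ?P \<Longrightarrow> (fst p, snd p) \<in> composable ?L" for p by simp
    have "continuous_map ?P final_topology (\<lambda>p. src ?L (fst p))"
      using continuous_map_compose[OF continuous_map_from_subtopology[OF continuous_map_fst] s] by (simp add: o_def)
    then show "continuous_map ?P final_topology (\<lambda>p. src ?L ((\<lambda>(a, b). cmp ?L a b) p))"
      by (rule continuous_map_eq) (simp only: case_prod_unfold laws''[OF P])
    have "continuous_map ?P final_topology (\<lambda>p. tgt ?L (snd p))"
      using continuous_map_compose[OF continuous_map_from_subtopology[OF continuous_map_snd] t] by (simp add: o_def)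
    then show "continuous_map ?P final_topology (\<lambda>p. tgt ?L ((\<lambda>(a, b). cmp ?L a b) p))"
      by (rule continuous_map_eq) (simp only: case_prod_unfold laws''[OF P])
  qed (use ty in \<open>simp_all only: topspace_final_topology top\<close>)
  moreover have og: "continuous_map (Obj (G i)) final_topology (og i)" if i: "i \<in> I" for i
    unfolding continuous_map_def topspace_final_topology openin_final_topology
    using i lim_objI by (simp add: Pi_iff del: mem_Collect_eq)
  moreover have "continuous_map (Arr (G i)) ?T (ag i)" if i: "i \<in> I" for i
  proof (rule into)
    have c: "continuous_map (Arr (G i)) (Obj (G i)) (src (G i))" "continuous_map (Arr (G i)) (Obj (G i)) (tgt (G i))"
      using groupoid_G[OF i] unfolding topological_groupoid_def by simp_all
    show "continuous_map (Arr (G i)) final_topology (\<lambda>p. src ?L (ag i p))"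
      by (rule continuous_map_eq[OF continuous_map_compose[OF c(1) og[OF i]]]) (simp add: src_L i)
    show "continuous_map (Arr (G i)) final_topology (\<lambda>p. tgt ?L (ag i p))"
      by (rule continuous_map_eq[OF continuous_map_compose[OF c(2) og[OF i]]]) (simp add: tgt_L i)
  qed (use i lim_arrI in \<open>simp add: Pi_iff del: mem_Collect_eq\<close>)
  ultimately have "(final_topology, ?T) \<in> limit_topologies I le G \<tau>"
    unfolding limit_topologies_def mem_Collect_eq case_prod_conv
    by (intro conjI ballI topspace_final_topology top)
  then show "openin final_topology V \<Longrightarrow> openin limO V"
    unfolding limO_def by (intro topology_generated_by_Basis CollectI bexI[of _ final_topology]) (auto intro: image_eqI[rotated])
qed

lemma openin_limO:
  "\<lbrakk>V \<subseteq> lim_obj; \<And>i. i \<in> I \<Longrightarrow> openin (Obj (G i)) {x \<in> ob i. og i x \<in> V}\<rbrakk> \<Longrightarrow> openin limO V"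
  by (rule limO_finer, rule openin_final_topology[THEN iffD2], intro conjI ballI)

lemma continuous_og: "i \<in> I \<Longrightarrow> continuous_map (Obj (G i)) limO (og i)"
  and continuous_ag: "i \<in> I \<Longrightarrow> continuous_map (Arr (G i)) limA (ag i)"
  using colimit_cocone(2)[of i] by (simp_all add: groupoid_morphism_def)

end

section \<open>Morita equivalence with a space\<close>

lemma topological_groupoid_unit: "topological_groupoid (unit_groupoid Z)"
  unfolding topological_groupoid_def groupoid_def unit_groupoid_def composable_def
  by (auto simp: case_prod_unfold intro: continuous_map_from_subtopology continuous_map_fst)

text \<open>Transport along injections with left inverse \<open>fst\<close>. It serves to realise a
  groupoid at the larger types that the definition of Morita equivalence demands of the groupoid in
  the middle.\<close>

definition groupoid_copy ::
  "('o \<Rightarrow> 'o \<times> 'c) \<Rightarrow> ('a \<Rightarrow> 'a \<times> 'd) \<Rightarrow> ('o, 'a) tgroupoid \<Rightarrow> ('o \<times> 'c, 'a \<times> 'd) tgroupoid" where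
  "groupoid_copy eo ea G =
     \<lparr>Obj = pullback_topology (eo ` topspace (Obj G)) fst (Obj G),
      Arr = pullback_topology (ea ` topspace (Arr G)) fst (Arr G),
      src = (\<lambda>a. eo (src G (fst a))), tgt = (\<lambda>a. eo (tgt G (fst a))),
      cmp = (\<lambda>a b. ea (cmp G (fst a) (fst b))), idt = (\<lambda>x. ea (idt G (fst x))), ivt = (\<lambda>a. ea (ivt G (fst a)))\<rparr>"

locale copied_groupoid =
  fixes eo :: "'o \<Rightarrow> 'o \<times> 'c" and ea :: "'a \<Rightarrow> 'a \<times> 'd" and G :: "('o, 'a) tgroupoid"
  assumes eo [simp]: "fst (eo x) = x" and ea [simp]: "fst (ea a) = a"
    and G: "topological_groupoid G"
begin

abbreviation "K \<equiv> groupoid_copy eo ea G"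

lemma groupoid_G: "groupoid G"
  and continuous_G: "continuous_map (Arr G) (Obj G) (src G)" "continuous_map (Arr G) (Obj G) (tgt G)"
    "continuous_map (Obj G) (Arr G) (idt G)" "continuous_map (Arr G) (Arr G) (ivt G)"
    "continuous_map (subtopology (prod_topology (Arr G) (Arr G)) (composable G)) (Arr G) (\<lambda>(a, b). cmp G a b)"
  using G by (simp_all add: topological_groupoid_def)

lemma copy_simps [simp]:
  "src K = (\<lambda>a. eo (src G (fst a)))" "tgt K = (\<lambda>a. eo (tgt G (fst a)))" "cmp K = (\<lambda>a b. ea (cmp G (fst a) (fst b)))"
  "idt K = (\<lambda>x. ea (idt G (fst x)))" "ivt K = (\<lambda>a. ea (ivt G (fst a)))"
  by (simp_all add: groupoid_copy_def)

lemma topspace_copy [simp]: "topspace (Obj K) = eo ` topspace (Obj G)" "topspace (Arr K) = ea ` topspace (Arr G)"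
  by (auto simp: groupoid_copy_def topspace_pullback_topology)

lemma continuous_fst_copy: "continuous_map (Obj K) (Obj G) fst" "continuous_map (Arr K) (Arr G) fst"
  unfolding groupoid_copy_def
  using continuous_map_pullback[OF continuous_map_id, of "eo ` topspace (Obj G)" fst]
    continuous_map_pullback[OF continuous_map_id, of "ea ` topspace (Arr G)" fst] by simp_all

lemma continuous_into_copy:
  "continuous_map P (Obj G) f \<Longrightarrow> continuous_map P (Obj K) (\<lambda>p. eo (f p))"
  "continuous_map P (Arr G) g \<Longrightarrow> continuous_map P (Arr K) (\<lambda>p. ea (g p))"
  unfolding groupoid_copy_def
  using continuous_map_funspace[of P "Obj G" f] continuous_map_funspace[of P "Arr G" g]
  by (auto intro!: continuous_map_pullback' simp: o_def)

lemma inj_copy [simp]: "eo x = eo y \<longleftrightarrow> x = y"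
  by (metis eo)

lemma composable_copy: "(a, b) \<in> composable K \<longleftrightarrow> a \<in> ea ` topspace (Arr G) \<and> b \<in> ea ` topspace (Arr G) \<and> (fst a, fst b) \<in> composable G"
  by (auto simp: composable_def)

lemma topological_groupoid_copy: "topological_groupoid K"
  unfolding topological_groupoid_def
proof (intro conjI)
  note g = groupoid_G[unfolded groupoid_def]
  have cmp: "(a, b) \<in> composable G \<Longrightarrow> cmp G a b \<in> topspace (Arr G) \<and> src G (cmp G a b) = src G a \<and> tgt G (cmp G a b) = tgt G b" for a b
    using g by blast
  have assoc: "(a, b) \<in> composable G \<Longrightarrow> (b, c) \<in> composable G \<Longrightarrow> cmp G (cmp G a b) c = cmp G a (cmp G b c)" for a b c
    using g by blast
  show "groupoid K"
    unfolding groupoid_def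
  proof (intro conjI)
    show "\<forall>(a, b)\<in>composable K. cmp K a b \<in> topspace (Arr K) \<and> src K (cmp K a b) = src K a \<and> tgt K (cmp K a b) = tgt K b"
      by (auto simp: composable_copy cmp)
    show "\<forall>a b c. (a, b) \<in> composable K \<and> (b, c) \<in> composable K \<longrightarrow> cmp K (cmp K a b) c = cmp K a (cmp K b c)"
      by (auto simp: composable_copy assoc)
  qed (use g in \<open>auto simp: Pi_iff\<close>)
  show "continuous_map (Arr K) (Obj K) (src K)"
    using continuous_into_copy(1)[OF continuous_map_compose[OF continuous_fst_copy(2) continuous_G(1)]] by (simp add: o_def)
  show "continuous_map (Arr K) (Obj K) (tgt K)"
    using continuous_into_copy(1)[OF continuous_map_compose[OF continuous_fst_copy(2) continuous_G(2)]] by (simp add: o_def)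
  show "continuous_map (Obj K) (Arr K) (idt K)"
    using continuous_into_copy(2)[OF continuous_map_compose[OF continuous_fst_copy(1) continuous_G(3)]] by (simp add: o_def)
  show "continuous_map (Arr K) (Arr K) (ivt K)"
    using continuous_into_copy(2)[OF continuous_map_compose[OF continuous_fst_copy(2) continuous_G(4)]] by (simp add: o_def)
  let ?P = "subtopology (prod_topology (Arr K) (Arr K)) (composable K)"
  have "continuous_map ?P (subtopology (prod_topology (Arr G) (Arr G)) (composable G)) (\<lambda>p. (fst (fst p), fst (snd p)))"
    unfolding continuous_map_in_subtopology continuous_map_paired
    using continuous_map_compose[OF continuous_map_from_subtopology[OF continuous_map_fst] continuous_fst_copy(2)]
      continuous_map_compose[OF continuous_map_from_subtopology[OF continuous_map_snd] continuous_fst_copy(2)]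
    by (auto simp: o_def composable_copy)
  from continuous_into_copy(2)[OF continuous_map_compose[OF this continuous_G(5)]]
  show "continuous_map ?P (Arr K) (\<lambda>(a, b). cmp K a b)" by (simp add: o_def case_prod_unfold)
qed

end

text \<open>The assumption \<open>local_section\<close> combines a local section of \<open>p\<close>
  with continuous arrows to it: the target of \<open>c x\<close> depends only on \<open>p x\<close>.
  This supplies an arrow between any two objects of a fibre, and locally a continuous choice of such
  arrows.\<close>

locale groupoid_over_space =
  fixes G :: "('o, 'a) tgroupoid" and Z :: "'z topology" and p :: "'o \<Rightarrow> 'z"
  assumes G: "topological_groupoid G"
    and p: "continuous_map (Obj G) Z p" "open_map (Obj G) Z p" "p ` topspace (Obj G) = topspace Z"
    and p_arr: "a \<in> topspace (Arr G) \<Longrightarrow> p (src G a) = p (tgt G a)"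
    and thin: "\<lbrakk>a \<in> topspace (Arr G); b \<in> topspace (Arr G); src G a = src G b; tgt G a = tgt G b\<rbrakk> \<Longrightarrow> a = b"
    and local_section: "z \<in> topspace Z \<Longrightarrow> \<exists>N c. openin Z N \<and> z \<in> N \<and>
          continuous_map (subtopology (Obj G) {x. p x \<in> N}) (Arr G) c \<and>
          (\<forall>x\<in>topspace (Obj G). p x \<in> N \<longrightarrow> src G (c x) = x) \<and>
          (\<forall>x\<in>topspace (Obj G). \<forall>y\<in>topspace (Obj G). p x \<in> N \<and> p x = p y \<longrightarrow> tgt G (c x) = tgt G (c y))"
begin

lemma gpd: "groupoid G"
  and cont: "continuous_map (Arr G) (Obj G) (src G)" "continuous_map (Arr G) (Obj G) (tgt G)"
    "continuous_map (Obj G) (Arr G) (idt G)" "continuous_map (Arr G) (Arr G) (ivt G)"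
    "continuous_map (subtopology (prod_topology (Arr G) (Arr G)) (composable G)) (Arr G) (\<lambda>(a, b). cmp G a b)"
  using G by (simp_all add: topological_groupoid_def)

lemmas closed = groupoid_laws[OF gpd]

definition fibre_pairs :: "('o \<times> 'o) topology" where
  "fibre_pairs = subtopology (prod_topology (Obj G) (Obj G)) {(x, y). p x = p y}"

definition arrow :: "'o \<times> 'o \<Rightarrow> 'a" where
  "arrow q = (SOME a. a \<in> topspace (Arr G) \<and> src G a = fst q \<and> tgt G a = snd q)"

lemma topspace_fibre_pairs: "q \<in> topspace fibre_pairs \<longleftrightarrow> fst q \<in> topspace (Obj G) \<and> snd q \<in> topspace (Obj G) \<and> p (fst q) = p (snd q)"
  by (cases q) (auto simp: fibre_pairs_def)

text \<open>Any two objects over the same point of \<open>N\<close> have a common target under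
  \<open>c\<close>, so the arrow between them is a quotient of two values of \<open>c\<close>;
  thinness identifies it with the chosen one.\<close>

lemma arrow_local:
  assumes z: "z \<in> topspace Z"
  obtains N where "openin Z N" "z \<in> N"
    "continuous_map (subtopology fibre_pairs {q. p (fst q) \<in> N}) (Arr G) arrow"
    "\<And>q. \<lbrakk>q \<in> topspace fibre_pairs; p (fst q) \<in> N\<rbrakk> \<Longrightarrow>
       arrow q \<in> topspace (Arr G) \<and> src G (arrow q) = fst q \<and> tgt G (arrow q) = snd q"
proof -
  obtain N c where N: "openin Z N" "z \<in> N" and c: "continuous_map (subtopology (Obj G) {x. p x \<in> N}) (Arr G) c"
    and sc: "\<And>x. \<lbrakk>x \<in> topspace (Obj G); p x \<in> N\<rbrakk> \<Longrightarrow> src G (c x) = x"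
    and tc: "\<And>x y. \<lbrakk>x \<in> topspace (Obj G); y \<in> topspace (Obj G); p x \<in> N; p x = p y\<rbrakk> \<Longrightarrow> tgt G (c x) = tgt G (c y)"
    using local_section[OF z] by metis
  let ?F = "subtopology fibre_pairs {q. p (fst q) \<in> N}"
  have F: "fst q \<in> topspace (Obj G)" "snd q \<in> topspace (Obj G)" "p (fst q) \<in> N" "p (snd q) \<in> N" "p (fst q) = p (snd q)" if "q \<in> topspace ?F" for q
    using that by (auto simp: topspace_fibre_pairs)
  have cA: "c x \<in> topspace (Arr G)" if "x \<in> topspace (Obj G)" "p x \<in> N" for x
    using continuous_map_funspace[OF c] that by auto
  define \<theta> where "\<theta> q = cmp G (c (fst q)) (ivt G (c (snd q)))" for q
  have comp: "(c (fst q), ivt G (c (snd q))) \<in> composable G" if "q \<in> topspace ?F" for q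
    using F[OF that] cA sc tc[of "fst q" "snd q"] by (simp add: composable_def closed)
  have \<theta>: "\<theta> q \<in> topspace (Arr G)" "src G (\<theta> q) = fst q" "tgt G (\<theta> q) = snd q" if "q \<in> topspace ?F" for q
    using F[OF that] cA sc closed comp[OF that] by (simp_all add: \<theta>_def)
  have arrow: "arrow q \<in> topspace (Arr G) \<and> src G (arrow q) = fst q \<and> tgt G (arrow q) = snd q" if "q \<in> topspace ?F" for q
    unfolding arrow_def by (rule someI[of _ "\<theta> q"]) (use \<theta>[OF that] in simp)
  have eq: "\<theta> q = arrow q" if "q \<in> topspace ?F" for q
    using \<theta>[OF that] arrow[OF that] by (intro thin) simp_all
  have *: "continuous_map ?F (subtopology (Obj G) {x. p x \<in> N}) fst" "continuous_map ?F (subtopology (Obj G) {x. p x \<in> N}) snd"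
    unfolding continuous_map_in_subtopology fibre_pairs_def
    by (auto intro!: continuous_map_from_subtopology continuous_map_fst continuous_map_snd)
  have "continuous_map ?F (subtopology (prod_topology (Arr G) (Arr G)) (composable G)) (\<lambda>q. (c (fst q), ivt G (c (snd q))))"
    unfolding continuous_map_in_subtopology continuous_map_paired
    using continuous_map_compose[OF *(1) c] continuous_map_compose[OF continuous_map_compose[OF *(2) c] cont(4)] comp
    by (simp add: o_def Pi_iff)
  from continuous_map_compose[OF this cont(5)] have "continuous_map ?F (Arr G) \<theta>"
    by (simp add: o_def \<theta>_def[abs_def])
  then have "continuous_map ?F (Arr G) arrow" by (rule continuous_map_eq) (rule eq)
  then show thesis using that[OF N] arrow by simp
qed

lemma arrow:
  assumes "q \<in> topspace fibre_pairs"
  shows "arrow q \<in> topspace (Arr G)" "src G (arrow q) = fst q" "tgt G (arrow q) = snd q"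
proof -
  have "p (fst q) \<in> topspace Z" using assms p(3) by (auto simp: topspace_fibre_pairs)
  from arrow_local[OF this] assms show "arrow q \<in> topspace (Arr G)" "src G (arrow q) = fst q" "tgt G (arrow q) = snd q"
    by metis+
qed

lemma src_tgt_fibre_pairs: "a \<in> topspace (Arr G) \<Longrightarrow> (src G a, tgt G a) \<in> topspace fibre_pairs"
  by (simp add: topspace_fibre_pairs closed p_arr)

lemma arrow_src_tgt: "a \<in> topspace (Arr G) \<Longrightarrow> arrow (src G a, tgt G a) = a"
  using arrow[OF src_tgt_fibre_pairs] by (intro thin) simp_all

text \<open>Continuity is local on the fibre product, which is covered by the open preimages of the
  sets \<open>N\<close>. So the space of arrows carries the topology of the fibre product.\<close>

lemma continuous_arrow: "continuous_map fibre_pairs (Arr G) arrow"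
proof -
  have "\<forall>z\<in>topspace Z. \<exists>N. openin Z N \<and> z \<in> N \<and> continuous_map (subtopology fibre_pairs {q. p (fst q) \<in> N}) (Arr G) arrow"
    using arrow_local by metis
  then obtain N where N: "\<And>z. z \<in> topspace Z \<Longrightarrow> openin Z (N z) \<and> z \<in> N z \<and> continuous_map (subtopology fibre_pairs {q. p (fst q) \<in> N z}) (Arr G) arrow"
    by metis
  have pf: "continuous_map fibre_pairs Z (\<lambda>q. p (fst q))"
    unfolding fibre_pairs_def
    using continuous_map_compose[OF continuous_map_from_subtopology[OF continuous_map_fst] p(1)] by (simp add: o_def)
  show ?thesis
    unfolding continuous_map_def
  proof (intro conjI allI impI)
    show "arrow \<in> topspace fibre_pairs \<rightarrow> topspace (Arr G)" using arrow by blast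
    fix V assume V: "openin (Arr G) V"
    have "openin fibre_pairs ({q \<in> topspace fibre_pairs. p (fst q) \<in> N z} \<inter> {q \<in> topspace fibre_pairs. arrow q \<in> V})" if z: "z \<in> topspace Z" for z
    proof -
      have o: "openin fibre_pairs {q \<in> topspace fibre_pairs. p (fst q) \<in> N z}"
        using openin_continuous_map_preimage[OF pf] N[OF z] by blast
      have s: "subtopology fibre_pairs {q. p (fst q) \<in> N z} = subtopology fibre_pairs {q \<in> topspace fibre_pairs. p (fst q) \<in> N z}"
        by (subst subtopology_restrict[symmetric], rule arg_cong[where f = "subtopology fibre_pairs"]) blast
      have "openin (subtopology fibre_pairs {q. p (fst q) \<in> N z}) {q \<in> topspace (subtopology fibre_pairs {q. p (fst q) \<in> N z}). arrow q \<in> V}"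
        using openin_continuous_map_preimage[OF _ V] N[OF z] by blast
      then have "openin fibre_pairs {q \<in> topspace (subtopology fibre_pairs {q. p (fst q) \<in> N z}). arrow q \<in> V}"
        unfolding s using openin_trans_full[OF _ o] by blast
      moreover have "{q \<in> topspace (subtopology fibre_pairs {q. p (fst q) \<in> N z}). arrow q \<in> V} =
          {q \<in> topspace fibre_pairs. p (fst q) \<in> N z} \<inter> {q \<in> topspace fibre_pairs. arrow q \<in> V}" by auto
      ultimately show ?thesis by simp
    qed
    then have "openin fibre_pairs (\<Union>z\<in>topspace Z. {q \<in> topspace fibre_pairs. p (fst q) \<in> N z} \<inter> {q \<in> topspace fibre_pairs. arrow q \<in> V})"
      by blast
    moreover have "(\<Union>z\<in>topspace Z. {q \<in> topspace fibre_pairs. p (fst q) \<in> N z} \<inter> {q \<in> topspace fibre_pairs. arrow q \<in> V}) =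
        {q \<in> topspace fibre_pairs. arrow q \<in> V}"
    proof -
      have "p (fst q) \<in> topspace Z" if "q \<in> topspace fibre_pairs" for q
        using that p(3) by (auto simp: topspace_fibre_pairs)
      then show ?thesis using N by blast
    qed
    ultimately show "openin fibre_pairs {q \<in> topspace fibre_pairs. arrow q \<in> V}" by simp
  qed
qed

text \<open>By continuity of \<open>arrow\<close>, every arrow whose ends lie in suitable open sets
  \<open>X\<close> and \<open>Y\<close> belongs to \<open>V\<close>. An object of \<open>X\<close>
  starts such an arrow when its fibre meets \<open>Y\<close>, and this is an open condition because
  \<open>p\<close> is open.\<close>

lemma open_map_src: "open_map (Arr G) (Obj G) (src G)"
  unfolding open_map_def
proof (intro allI impI)
  fix V assume V: "openin (Arr G) V"
  have "\<exists>T. openin (Obj G) T \<and> x \<in> T \<and> T \<subseteq> src G ` V" if x: "x \<in> src G ` V" for x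
  proof -
    obtain a where a: "a \<in> V" "x = src G a" using x by blast
    have aA: "a \<in> topspace (Arr G)" using openin_subset[OF V] a by blast
    have "openin fibre_pairs {q \<in> topspace fibre_pairs. arrow q \<in> V}"
      by (rule openin_continuous_map_preimage[OF continuous_arrow V])
    then obtain B where B: "openin (prod_topology (Obj G) (Obj G)) B"
      and eq: "{q \<in> topspace fibre_pairs. arrow q \<in> V} = B \<inter> {(x, y). p x = p y}"
      unfolding fibre_pairs_def openin_subtopology by blast
    have "(src G a, tgt G a) \<in> {q \<in> topspace fibre_pairs. arrow q \<in> V}"
      using src_tgt_fibre_pairs[OF aA] arrow_src_tgt[OF aA] a by simp
    then have "(src G a, tgt G a) \<in> B" unfolding eq by blast
    then obtain X Y where XY: "openin (Obj G) X" "openin (Obj G) Y" "src G a \<in> X" "tgt G a \<in> Y" "X \<times> Y \<subseteq> B"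
      using B unfolding openin_prod_topology_alt by meson
    define T where "T = X \<inter> {x \<in> topspace (Obj G). p x \<in> p ` Y}"
    have "openin Z (p ` Y)" using p(2) XY(2) unfolding open_map_def by blast
    from openin_continuous_map_preimage[OF p(1) this] have "openin (Obj G) T"
      unfolding T_def using XY(1) by blast
    moreover have "x \<in> T" unfolding T_def a(2) using XY p_arr[OF aA] closed(1)[OF aA] by blast
    moreover have "T \<subseteq> src G ` V"
    proof
      fix u assume "u \<in> T"
      then obtain v where "u \<in> X" "v \<in> Y" "p u = p v" unfolding T_def by blast
      then have "(u, v) \<in> B \<inter> {(x, y). p x = p y}" using XY(5) by blast
      then have q: "(u, v) \<in> {q \<in> topspace fibre_pairs. arrow q \<in> V}" unfolding eq .
      then have "src G (arrow (u, v)) = u" using arrow(2) by fastforce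
      then show "u \<in> src G ` V" using q by (metis (mono_tags, lifting) image_eqI mem_Collect_eq)
    qed
    ultimately show ?thesis by blast
  qed
  then show "openin (Obj G) (src G ` V)" by (subst openin_subopen) blast
qed

text \<open>Towards \<open>G\<close> the copy is an isomorphism, and the open surjection required
  there is the source map of \<open>G\<close>. Towards the space, the cartesian condition says that
  arrows are pairs of objects in one fibre, and the open surjection is \<open>p\<close>.\<close>

theorem morita_equivalent_unit_groupoid: "morita_equivalent G (unit_groupoid Z)"
proof -
  \<comment> \<open>The graph of \<open>p\<close> plays the part of the bibundle; the further
    components of \<open>ea\<close> repeat the source and its image so as to fit the prescribed
    arrow type.\<close>
  define eo where "eo x = (x, p x)" for x
  define ea where "ea a = (a, (eo (src G a), p (src G a)))" for a
  interpret copied_groupoid eo ea G by unfold_locales (simp_all add: eo_def ea_def G)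
  let ?\<Phi> = "(\<lambda>x. p (fst x), \<lambda>a. p (src G (fst a)))"
  have PG: "p x \<in> topspace Z" if "x \<in> topspace (Obj G)" for x using p(3) that by blast
  have 1: "morita_morphism K G (fst, fst)"
    unfolding morita_morphism_def Let_def fst_conv snd_conv
  proof (intro conjI)
    show "groupoid_morphism K G (fst, fst)"
      unfolding groupoid_morphism_def using continuous_fst_copy by (simp add: case_prod_unfold)
    let ?Y = "subtopology (prod_topology (prod_topology (Obj K) (Obj K)) (Arr G))
          {((x, y), g). src G g = fst x \<and> tgt G g = fst y}"
    have "homeomorphic_maps (Arr K) ?Y (\<lambda>h. ((src K h, tgt K h), fst h)) (\<lambda>q. ea (snd q))"
      unfolding homeomorphic_maps_def
    proof (intro conjI ballI)
      note tg = topological_groupoid_copy[unfolded topological_groupoid_def]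
      show "continuous_map (Arr K) ?Y (\<lambda>h. ((src K h, tgt K h), fst h))"
        unfolding continuous_map_in_subtopology continuous_map_paired
        using tg continuous_fst_copy(2) by (auto simp del: copy_simps) (auto)
      show "continuous_map ?Y (Arr K) (\<lambda>q. ea (snd q))"
        by (intro continuous_into_copy continuous_map_from_subtopology continuous_map_snd)
    qed (auto simp: prod_eq_iff)
    then show "homeomorphic_map (Arr K) ?Y (\<lambda>h. ((src K h, tgt K h), fst h))"
      by (rule homeomorphic_maps_map[THEN iffD1, THEN conjunct1])
    let ?P = "subtopology (prod_topology (Obj K) (Arr G)) {(x, g). fst x = tgt G g}"
    have snd: "continuous_map ?P (Arr G) snd" by (intro continuous_map_from_subtopology continuous_map_snd)
    show "continuous_map ?P (Obj G) (\<lambda>(x, g). src G g)"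
      using continuous_map_compose[OF snd cont(1)] by (simp add: o_def case_prod_unfold)
    \<comment> \<open>The fibre product is parametrised by arrows of \<open>G\<close>, since its
      first component must be the copy of their target. Under this parametrisation the map in
      question is the source map.\<close>
    have embed: "continuous_map (Arr G) ?P (\<lambda>g. (eo (tgt G g), g))"
      unfolding continuous_map_in_subtopology continuous_map_paired
      using continuous_into_copy(1)[OF cont(2)] by auto
    have P: "q \<in> topspace ?P \<longleftrightarrow> snd q \<in> topspace (Arr G) \<and> fst q = eo (tgt G (snd q))" for q
      by (cases q) (auto simp: closed)
    show "open_map ?P (Obj G) (\<lambda>(x, g). src G g)"
      unfolding open_map_def
    proof (intro allI impI)
      fix V assume V: "openin ?P V"
      have "(\<lambda>(x, g). src G g) ` V = src G ` {g \<in> topspace (Arr G). (eo (tgt G g), g) \<in> V}"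
      proof -
        have "snd q \<in> topspace (Arr G)" "(eo (tgt G (snd q)), snd q) = q" if "q \<in> V" for q
          using openin_subset[OF V] that P[of q] by (auto simp: prod_eq_iff)
        then show ?thesis by force
      qed
      then show "openin (Obj G) ((\<lambda>(x, g). src G g) ` V)"
        using openin_continuous_map_preimage[OF embed V] open_map_src unfolding open_map_def by simp
    qed
    have "x \<in> (\<lambda>(x, g). src G g) ` topspace ?P" if "x \<in> topspace (Obj G)" for x
      by (rule image_eqI[of _ _ "(eo x, idt G x)"]) (use that closed in auto)
    then show "(\<lambda>(x, g). src G g) ` topspace ?P = topspace (Obj G)" using closed(1) by auto
  qed
  have 2: "morita_morphism K (unit_groupoid Z) ?\<Phi>"
    unfolding morita_morphism_def Let_def fst_conv snd_conv
  proof (intro conjI)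
    have c0: "continuous_map (Obj K) Z (\<lambda>x. p (fst x))"
      using continuous_map_compose[OF continuous_fst_copy(1) p(1)] by (simp add: o_def)
    have c1: "continuous_map (Arr K) Z (\<lambda>a. p (src G (fst a)))"
      using continuous_map_compose[OF continuous_map_compose[OF continuous_fst_copy(2) cont(1)] p(1)] by (simp add: o_def)
    show "groupoid_morphism K (unit_groupoid Z) ?\<Phi>"
      unfolding groupoid_morphism_def using c0 c1
      by (auto simp: unit_groupoid_def composable_copy closed p_arr)
    let ?Y = "subtopology (prod_topology (prod_topology (Obj K) (Obj K)) (Arr (unit_groupoid Z)))
          {((x, y), g). src (unit_groupoid Z) g = p (fst x) \<and> tgt (unit_groupoid Z) g = p (fst y)}"
    have Y: "?Y = subtopology (prod_topology (prod_topology (Obj K) (Obj K)) Z) {((x, y), g). g = p (fst x) \<and> g = p (fst y)}"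
      by (simp add: unit_groupoid_def)
    \<comment> \<open>The inverse is where the continuity of \<open>arrow\<close> is used: it
      rebuilds an arrow of the copy from its two ends.\<close>
    have "homeomorphic_maps (Arr K) ?Y (\<lambda>h. ((src K h, tgt K h), p (src G (fst h)))) (\<lambda>q. ea (arrow (fst (fst (fst q)), fst (snd (fst q)))))"
      unfolding homeomorphic_maps_def Y
    proof (intro conjI ballI)
      let ?Y = "subtopology (prod_topology (prod_topology (Obj K) (Obj K)) Z) {((x, y), g). g = p (fst x) \<and> g = p (fst y)}"
      note tg = topological_groupoid_copy[unfolded topological_groupoid_def]
      show "continuous_map (Arr K) ?Y (\<lambda>h. ((src K h, tgt K h), p (src G (fst h))))"
        unfolding continuous_map_in_subtopology continuous_map_paired
        using tg c1 by (auto simp del: copy_simps) (auto simp: p_arr)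
      have f0: "continuous_map ?Y (prod_topology (Obj K) (Obj K)) fst"
        by (intro continuous_map_from_subtopology continuous_map_fst)
      have f: "continuous_map ?Y (Obj G) (\<lambda>q. fst (fst (fst q)))" "continuous_map ?Y (Obj G) (\<lambda>q. fst (snd (fst q)))"
        using continuous_map_compose[OF continuous_map_compose[OF f0 continuous_map_fst] continuous_fst_copy(1)]
          continuous_map_compose[OF continuous_map_compose[OF f0 continuous_map_snd] continuous_fst_copy(1)]
        by (simp_all add: o_def)
      have "continuous_map ?Y fibre_pairs (\<lambda>q. (fst (fst (fst q)), fst (snd (fst q))))"
        unfolding fibre_pairs_def continuous_map_in_subtopology continuous_map_paired using f by auto
      from continuous_into_copy(2)[OF continuous_map_compose[OF this continuous_arrow]]
      show "continuous_map ?Y (Arr K) (\<lambda>q. ea (arrow (fst (fst (fst q)), fst (snd (fst q)))))" by (simp add: o_def)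
      fix q assume "q \<in> topspace ?Y"
      then obtain x y where q: "q = ((eo x, eo y), p x)" "x \<in> topspace (Obj G)" "y \<in> topspace (Obj G)" "p x = p y" by auto
      then have "(x, y) \<in> topspace fibre_pairs" by (simp add: topspace_fibre_pairs)
      from arrow[OF this] show "((src K (ea (arrow (fst (fst (fst q)), fst (snd (fst q))))), tgt K (ea (arrow (fst (fst (fst q)), fst (snd (fst q)))))),
           p (src G (fst (ea (arrow (fst (fst (fst q)), fst (snd (fst q)))))))) = q" by (simp add: q)
    qed (auto simp: arrow_src_tgt)
    then show "homeomorphic_map (Arr K) ?Y (\<lambda>h. ((src K h, tgt K h), p (src G (fst h))))"
      by (rule homeomorphic_maps_map[THEN iffD1, THEN conjunct1])
    let ?P = "subtopology (prod_topology (Obj K) (Arr (unit_groupoid Z))) {(x, g). p (fst x) = tgt (unit_groupoid Z) g}"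
    have P: "?P = subtopology (prod_topology (Obj K) Z) {(x, g). p (fst x) = g}" by (simp add: unit_groupoid_def)
    have U: "Obj (unit_groupoid Z) = Z" "src (unit_groupoid Z) g = g" for g by (simp_all add: unit_groupoid_def)
    let ?P' = "subtopology (prod_topology (Obj K) Z) {(x, g). p (fst x) = g}"
    show "continuous_map ?P (Obj (unit_groupoid Z)) (\<lambda>(x, g). src (unit_groupoid Z) g)"
      unfolding P U by (simp add: case_prod_unfold continuous_map_from_subtopology continuous_map_snd)
    \<comment> \<open>This fibre product is the graph of \<open>p\<close> over the copied objects,
      so projecting to the space is \<open>p\<close> itself.\<close>
    have embed: "continuous_map (Obj G) ?P' (\<lambda>x. (eo x, p x))"
      unfolding continuous_map_in_subtopology continuous_map_paired
      using continuous_into_copy(1)[OF continuous_map_id] p(1) by (auto simp: id_def)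
    show "open_map ?P (Obj (unit_groupoid Z)) (\<lambda>(x, g). src (unit_groupoid Z) g)"
      unfolding P U open_map_def
    proof (intro allI impI)
      fix V assume V: "openin ?P' V"
      have form: "\<exists>x\<in>topspace (Obj G). q = (eo x, p x)" if "q \<in> V" for q
      proof -
        have "q \<in> topspace ?P'" using openin_subset[OF V] that by blast
        then show ?thesis by (cases q) auto
      qed
      have "(\<lambda>(x, g). g) ` V = p ` {x \<in> topspace (Obj G). (eo x, p x) \<in> V}" (is "?l = ?r")
      proof (intro equalityI subsetI)
        fix z assume "z \<in> ?l"
        then obtain q where "q \<in> V" "z = snd q" by (auto simp: case_prod_unfold)
        moreover from form[OF this(1)] obtain x where "x \<in> topspace (Obj G)" "q = (eo x, p x)" by blast
        ultimately show "z \<in> ?r" by simp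
      next
        fix z assume "z \<in> ?r"
        then obtain x where "(eo x, p x) \<in> V" "z = p x" by blast
        then show "z \<in> ?l" by (intro image_eqI[of _ _ "(eo x, p x)"]) simp_all
      qed
      then show "openin Z ((\<lambda>(x, g). g) ` V)"
        using openin_continuous_map_preimage[OF embed V] p(2) unfolding open_map_def by simp
    qed
    have "z \<in> (\<lambda>(x, g). g) ` topspace ?P'" if z: "z \<in> topspace Z" for z
    proof -
      obtain x where "x \<in> topspace (Obj G)" "z = p x" using z p(3) by blast
      then show ?thesis using PG by (intro image_eqI[of _ _ "(eo x, p x)"]) auto
    qed
    then show "(\<lambda>(x, g). src (unit_groupoid Z) g) ` topspace ?P = topspace (Obj (unit_groupoid Z))"
      unfolding P U by auto
  qed
  show ?thesis
    unfolding morita_equivalent_def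
    using G topological_groupoid_unit topological_groupoid_copy 1 2 by blast
qed

end

section \<open>The loop groupoid of a cover groupoid\<close>

context cover_loops
begin

text \<open>The images of the closed intervals in the circle are compact, so finitely many
  containments form a finite intersection of subbasic sets.\<close>

lemma openin_tube:
  assumes "finite B" "\<And>\<beta>. \<beta> \<in> B \<Longrightarrow> \<alpha> \<beta> \<in> I"
  shows "openin Loops {f \<in> topspace Loops. \<forall>\<beta>\<in>B. \<forall>x\<in>{a \<beta>..b \<beta>}. f (ex x) \<in> U (\<alpha> \<beta>)}"
proof -
  let ?S = "\<lambda>\<beta>. {f \<in> topspace Loops. f ` (ex ` {a \<beta>..b \<beta>}) \<subseteq> U (\<alpha> \<beta>)}"
  have "openin Loops (topspace Loops \<inter> \<Inter>(?S ` B))"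
  proof (rule openin_Int_Inter)
    fix S assume "S \<in> ?S ` B"
    then obtain \<beta> where \<beta>: "\<beta> \<in> B" "S = ?S \<beta>" by blast
    have "compactin (top_of_set (sphere 0 1)) (ex ` {a \<beta>..b \<beta>})"
      by (rule image_compactin[OF _ continuous_ex]) simp
    from openin_compact_open_subbasic[OF this open_U[OF assms(2)[OF \<beta>(1)]]]
    show "openin Loops S" unfolding \<beta>(2) free_loop_space_def by simp
  qed (rule finite_imageI[OF assms(1)], rule openin_topspace)
  moreover have "topspace Loops \<inter> \<Inter>(?S ` B) = {f \<in> topspace Loops. \<forall>\<beta>\<in>B. \<forall>x\<in>{a \<beta>..b \<beta>}. f (ex x) \<in> U (\<alpha> \<beta>)}"
    unfolding image_image image_subset_iff by blast
  ultimately show ?thesis by (simp only:)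
qed

abbreviation "og \<equiv> limit.og"
abbreviation "ag \<equiv> limit.ag"
abbreviation "\<L> \<equiv> loop_groupoid G"

lemma loop_groupoid_eq: "\<L> = limit.colim"
  by (rule loop_groupoid_def)

lemma Obj_\<L>: "Obj \<L> = limit.limO" and Arr_\<L>: "Arr \<L> = limit.limA"
  unfolding loop_groupoid_eq by (rule limit.Obj_colim limit.Arr_colim)+

lemma obj_\<L>E:
  assumes "X \<in> topspace (Obj \<L>)"
  obtains W \<Psi> where "W \<in> admissible_covers" "\<Psi> \<in> obs W" "X = og W \<Psi>"
  using assms unfolding Obj_\<L> limit.topspace_lim by (rule limit.lim_objE)

lemma obj_\<L>I: "\<lbrakk>W \<in> admissible_covers; \<Psi> \<in> obs W\<rbrakk> \<Longrightarrow> og W \<Psi> \<in> topspace (Obj \<L>)"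
  unfolding Obj_\<L> limit.topspace_lim by (rule limit.lim_objI)

lemma arr_\<L>E:
  assumes "A \<in> topspace (Arr \<L>)"
  obtains W \<Psi> \<Phi> where "W \<in> admissible_covers" "\<Psi> \<in> obs W" "\<Phi> \<in> obs W" "loop_of W \<Psi> = loop_of W \<Phi>" "A = ag W (arr W \<Psi> \<Phi>)"
proof -
  have "A \<in> limit.lim_arr" using assms unfolding Arr_\<L> limit.topspace_lim .
  then obtain W a where W: "W \<in> admissible_covers" and a: "a \<in> ars W" "A = ag W a" by (rule limit.lim_arrE)
  from a(1) W show thesis by (rule arsE) (rule that[OF W], use a(2) in simp_all)
qed

lemma arr_\<L>:
  assumes "W \<in> admissible_covers" "\<Psi> \<in> obs W" "\<Phi> \<in> obs W" "loop_of W \<Psi> = loop_of W \<Phi>"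
  shows "ag W (arr W \<Psi> \<Phi>) \<in> topspace (Arr \<L>)" "src \<L> (ag W (arr W \<Psi> \<Phi>)) = og W \<Psi>" "tgt \<L> (ag W (arr W \<Psi> \<Phi>)) = og W \<Phi>"
proof -
  note a = arr_in_ars[OF assms]
  show "ag W (arr W \<Psi> \<Phi>) \<in> topspace (Arr \<L>)"
    unfolding Arr_\<L> limit.topspace_lim by (rule limit.lim_arrI[OF assms(1) a])
  show "src \<L> (ag W (arr W \<Psi> \<Phi>)) = og W \<Psi>"
    using limit.src_L[OF assms(1) a] unfolding limit.limit_groupoid_topology_irrelevant loop_groupoid_eq LG_arr .
  show "tgt \<L> (ag W (arr W \<Psi> \<Phi>)) = og W \<Phi>"
    using limit.tgt_L[OF assms(1) a] unfolding limit.limit_groupoid_topology_irrelevant loop_groupoid_eq LG_arr .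
qed

lemma topological_groupoid_\<L>: "topological_groupoid \<L>"
  unfolding loop_groupoid_eq by (rule limit.colimit_cocone(1))

lemma ag_restriction:
  assumes "W \<in> admissible_covers" "W' \<in> admissible_covers" "cover_refines W' W" "\<Psi> \<in> obs W" "\<Phi> \<in> obs W" "loop_of W \<Psi> = loop_of W \<Phi>"
  shows "ag W' (arr W' (fst (\<tau> W W') \<Psi>) (fst (\<tau> W W') \<Phi>)) = ag W (arr W \<Psi> \<Phi>)"
  using limit.ag_push[OF assms(1) arr_in_ars[OF assms(1,4-6)] assms(2,3)]
  by (simp only: restriction_arr[OF assms(1-3)])

text \<open>Equality of germs of the sources and of the targets may first be visible over two
  different covers. Over a common refinement of these both ends agree, and there the ends determine
  the arrow.\<close>

lemma arrows_\<L>_determined: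
  assumes A: "A \<in> topspace (Arr \<L>)" and B: "B \<in> topspace (Arr \<L>)"
    and s: "src \<L> A = src \<L> B" and t: "tgt \<L> A = tgt \<L> B"
  shows "A = B"
proof -
  obtain W \<Psi> \<Phi> where a: "W \<in> admissible_covers" "\<Psi> \<in> obs W" "\<Phi> \<in> obs W" "loop_of W \<Psi> = loop_of W \<Phi>" "A = ag W (arr W \<Psi> \<Phi>)"
    using A by (rule arr_\<L>E)
  obtain W' \<Psi>' \<Phi>' where b: "W' \<in> admissible_covers" "\<Psi>' \<in> obs W'" "\<Phi>' \<in> obs W'" "loop_of W' \<Psi>' = loop_of W' \<Phi>'" "B = ag W' (arr W' \<Psi>' \<Phi>')"
    using B by (rule arr_\<L>E)
  have "og W \<Psi> = og W' \<Psi>'" "og W \<Phi> = og W' \<Phi>'"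
    using s t arr_\<L>(2,3)[OF a(1-4)] arr_\<L>(2,3)[OF b(1-4)] a(5) b(5) by simp_all
  then obtain k l where k: "k \<in> admissible_covers" "cover_refines k W" "cover_refines k W'" "fst (\<tau> W k) \<Psi> = fst (\<tau> W' k) \<Psi>'"
    and l: "l \<in> admissible_covers" "cover_refines l W" "cover_refines l W'" "fst (\<tau> W l) \<Phi> = fst (\<tau> W' l) \<Phi>'"
    using limit.og_eq_iff[OF a(1,2) b(1,2)] limit.og_eq_iff[OF a(1,3) b(1,3)] by blast
  obtain h where h: "h \<in> admissible_covers" "cover_refines h k" "cover_refines h l"
    using covers_directed[OF k(1) l(1)] by blast
  have h': "cover_refines h W" "cover_refines h W'" using h k cover_refines_trans by blast+
  have 1: "fst (\<tau> W h) \<Psi> = fst (\<tau> W' h) \<Psi>'"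
    using restriction_trans[OF a(1) k(1) h(1) k(2) h(2) a(2)] restriction_trans[OF b(1) k(1) h(1) k(3) h(2) b(2)] k(4) by simp
  have 2: "fst (\<tau> W h) \<Phi> = fst (\<tau> W' h) \<Phi>'"
    using restriction_trans[OF a(1) l(1) h(1) l(2) h(3) a(3)] restriction_trans[OF b(1) l(1) h(1) l(3) h(3) b(3)] l(4) by simp
  show ?thesis
    using ag_restriction[OF a(1) h(1) h'(1) a(2-4)] ag_restriction[OF b(1) h(1) h'(2) b(2-4)] 1 2 a(5) b(5) by simp
qed

text \<open>Instance of the universal property with the unit groupoid of the loop space as receiver:
  the maps \<open>loop_of\<close> are constant along arrows and invariant under restriction.\<close>

lemma germ_loop_exists:
  "\<exists>p. continuous_map (Obj \<L>) Loops p \<and> (\<forall>W\<in>admissible_covers. \<forall>\<Psi>\<in>obs W. p (og W \<Psi>) = loop_of W \<Psi>)"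
proof -
  let ?\<Phi> = "\<lambda>W. (loop_of W, \<lambda>a :: ('i \<times> 'm, ('i \<times> 'i) \<times> 'm) loop_arr. loop_of W (fst a))"
  have "\<exists>\<Psi>. groupoid_morphism limit.colim (unit_groupoid Loops) \<Psi> \<and>
              (\<forall>W\<in>admissible_covers. (\<forall>x\<in>obs W. fst \<Psi> (og W x) = fst (?\<Phi> W) x) \<and> (\<forall>a\<in>ars W. snd \<Psi> (ag W a) = snd (?\<Phi> W) a))"
  proof (rule limit.colimit_universal[where \<Phi> = ?\<Phi>, OF topological_groupoid_unit])
    fix W assume W: "W \<in> admissible_covers"
    show "groupoid_morphism (LG W) (unit_groupoid Loops) (?\<Phi> W)"
      unfolding groupoid_morphism_def
    proof (intro conjI)
      show "continuous_map (Obj (LG W)) (Obj (unit_groupoid Loops)) (fst (?\<Phi> W))"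
        using continuous_loop_of[OF W] by (simp add: unit_groupoid_def)
      show "continuous_map (Arr (LG W)) (Arr (unit_groupoid Loops)) (snd (?\<Phi> W))"
        using continuous_map_compose[OF continuous_src_LG continuous_loop_of[OF W]] by (simp add: unit_groupoid_def o_def)
      have fst_arr: "fst (arr W \<Psi> \<Phi>) = \<Psi>" for \<Psi> \<Phi> by (simp add: arr_def)
      show "\<forall>a\<in>ars W. src (unit_groupoid Loops) (snd (?\<Phi> W) a) = fst (?\<Phi> W) (src (LG W) a) \<and>
          tgt (unit_groupoid Loops) (snd (?\<Phi> W) a) = fst (?\<Phi> W) (tgt (LG W) a) \<and>
          snd (?\<Phi> W) (ivt (LG W) a) = ivt (unit_groupoid Loops) (snd (?\<Phi> W) a)"
        by (rule ballI, erule arsE[OF _ W]) (simp add: unit_groupoid_def LG_arr LG_arr_ops[OF W] fst_arr del: LG_simps)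
      show "\<forall>x\<in>obs W. snd (?\<Phi> W) (idt (LG W) x) = idt (unit_groupoid Loops) (fst (?\<Phi> W) x)"
        by (simp add: unit_groupoid_def)
      show "\<forall>(a, b)\<in>composable (LG W). snd (?\<Phi> W) (cmp (LG W) a b) = cmp (unit_groupoid Loops) (snd (?\<Phi> W) a) (snd (?\<Phi> W) b)"
      proof (rule ballI, rule case_prodI2)
        fix q a b assume "q \<in> composable (LG W)" "q = (a, b)"
        then have "(a, b) \<in> composable (LG W)" by simp
        from groupoid_laws(10)[OF _ this]
        have "src (LG W) (cmp (LG W) a b) = src (LG W) a"
          using topological_groupoid_LG[OF W] by (simp add: topological_groupoid_def)
        then show "snd (?\<Phi> W) (cmp (LG W) a b) = cmp (unit_groupoid Loops) (snd (?\<Phi> W) a) (snd (?\<Phi> W) b)"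
          by (simp add: unit_groupoid_def)
      qed
    qed
  next
    fix W W' x assume W: "W \<in> admissible_covers" "W' \<in> admissible_covers" "cover_refines W' W"
    show "x \<in> obs W \<Longrightarrow> fst (?\<Phi> W') (fst (\<tau> W W') x) = fst (?\<Phi> W) x" by (simp add: restriction_obs[OF W])
  next
    fix W W' a assume W: "W \<in> admissible_covers" "W' \<in> admissible_covers" "cover_refines W' W" and a: "a \<in> ars W"
    show "snd (?\<Phi> W') (snd (\<tau> W W') a) = snd (?\<Phi> W) a"
      using a W(1) by (rule arsE) (simp only: restriction_arr[OF W] restriction_obs[OF W], simp add: arr_def restriction_obs[OF W])
  qed
  then obtain \<Psi> where \<Psi>: "groupoid_morphism limit.colim (unit_groupoid Loops) \<Psi>"
     "\<And>W x. \<lbrakk>W \<in> admissible_covers; x \<in> obs W\<rbrakk> \<Longrightarrow> fst \<Psi> (og W x) = loop_of W x" by auto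
  have "continuous_map (Obj \<L>) Loops (fst \<Psi>)"
    using \<Psi>(1) by (simp add: groupoid_morphism_def loop_groupoid_eq unit_groupoid_def)
  then show ?thesis using \<Psi>(2) by blast
qed

definition germ_loop :: "(cover \<times> ('i \<times> 'm, ('i \<times> 'i) \<times> 'm) loop_obj) set \<Rightarrow> complex \<Rightarrow> 'm" where
  "germ_loop = (SOME p. continuous_map (Obj \<L>) Loops p \<and> (\<forall>W\<in>admissible_covers. \<forall>\<Psi>\<in>obs W. p (og W \<Psi>) = loop_of W \<Psi>))"

lemma continuous_germ_loop: "continuous_map (Obj \<L>) Loops germ_loop"
  and germ_loop: "\<lbrakk>W \<in> admissible_covers; \<Psi> \<in> obs W\<rbrakk> \<Longrightarrow> germ_loop (og W \<Psi>) = loop_of W \<Psi>"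
  using someI_ex[OF germ_loop_exists, folded germ_loop_def] by blast+

lemma germ_loop_arrow: "A \<in> topspace (Arr \<L>) \<Longrightarrow> germ_loop (src \<L> A) = germ_loop (tgt \<L> A)"
  by (erule arr_\<L>E) (simp add: arr_\<L> germ_loop)

text \<open>Since \<open>ex\<close> has period one, an interval labelled like its translate of shift
  zero inherits the containment from it. The set \<open>B\<close> collects the intervals that are
  checked directly.\<close>

lemma subordinate_shift:
  assumes "\<And>\<beta>. \<beta> \<in> B \<Longrightarrow> \<alpha> \<beta> \<in> I \<and> (\<forall>x\<in>interval_of W \<beta>. f (ex x) \<in> U (\<alpha> \<beta>))"
    and "\<And>\<beta>. \<beta> \<in> pieces W \<Longrightarrow> \<beta> \<in> B \<or> ((fst \<beta>, 0) \<in> B \<and> \<alpha> \<beta> = \<alpha> (fst \<beta>, 0))"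
  shows "subordinate W \<alpha> f"
  unfolding subordinate_def
proof
  fix \<beta> assume "\<beta> \<in> pieces W"
  then consider "\<beta> \<in> B" | "(fst \<beta>, 0) \<in> B" "\<alpha> \<beta> = \<alpha> (fst \<beta>, 0)" using assms(2) by blast
  then show "\<alpha> \<beta> \<in> I \<and> (\<forall>x\<in>interval_of W \<beta>. f (ex x) \<in> U (\<alpha> \<beta>))"
  proof cases
    case 2
    have "f (ex x) \<in> U (\<alpha> \<beta>)" if x: "x \<in> interval_of W \<beta>" for x
    proof -
      have "\<beta> = shift_piece (snd \<beta>) (fst \<beta>, 0)" by (simp add: shift_piece_def)
      then have "x - of_int (snd \<beta>) \<in> interval_of W (fst \<beta>, 0)"
        using x interval_of_shift[of "x - of_int (snd \<beta>)" "snd \<beta>" W "(fst \<beta>, 0)"] by simp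
      then have "f (ex (x - of_int (snd \<beta>))) \<in> U (\<alpha> \<beta>)" using assms(1)[OF 2(1)] 2(2) by simp
      moreover have "ex (x - of_int (snd \<beta>)) = ex x" using ex_add_int[of "x - of_int (snd \<beta>)" "snd \<beta>"] by simp
      ultimately show ?thesis by simp
    qed
    then show ?thesis using assms(1)[OF 2(1)] 2(2) by simp
  qed (use assms(1) in blast)
qed

text \<open>Any label assignment is the limit of the assignments that agree with it on finitely many pieces
  and are periodic outside of them. For the latter, subordination is an open condition on the loop,
  provided the intervals are shrunk first.\<close>

lemma open_map_germ_loop: "open_map (Obj \<L>) Loops germ_loop"
  unfolding open_map_def
proof (intro allI impI)
  fix V assume V: "openin (Obj \<L>) V"
  have "\<exists>T. openin Loops T \<and> f0 \<in> T \<and> T \<subseteq> germ_loop ` V" if f0: "f0 \<in> germ_loop ` V" for f0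
  proof -
    obtain X where X: "X \<in> V" "f0 = germ_loop X" using f0 by blast
    then have "X \<in> topspace (Obj \<L>)" using openin_subset[OF V] by blast
    then obtain W \<Psi> where W: "W \<in> admissible_covers" and \<Psi>: "\<Psi> \<in> obs W" and XW: "X = og W \<Psi>" by (rule obj_\<L>E)
    have f0W: "f0 = loop_of W \<Psi>" using X XW germ_loop[OF W \<Psi>] by simp
    obtain \<alpha> where sub: "subordinate W \<alpha> f0"
      and lab: "\<And>p. p \<in> topspace (cobj W) \<Longrightarrow> fst \<Psi> p = (\<alpha> (fst p), f0 (ex (snd p)))"
      using obs_label[OF W \<Psi>] unfolding f0W by blast
    \<comment> \<open>Half of the thickness leaves room for compact intervals between those of
      \<open>W'\<close> and those of \<open>W\<close>.\<close>
    define \<epsilon> where "\<epsilon> = snd W / 2"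
    have \<epsilon>: "0 < \<epsilon>" "\<epsilon> < snd W" using admissible_pos[OF W] by (simp_all add: \<epsilon>_def)
    define W' where "W' = (fst W, \<epsilon>)"
    have W': "W' \<in> admissible_covers" unfolding W'_def using admissible_shrink[OF W \<epsilon>(1)] \<epsilon>(2) by simp
    have ref: "cover_refines W' W" using \<epsilon> by (simp add: cover_refines_def W'_def)
    have fW': "fst W' = fst W" "pieces W' = pieces W" by (simp_all add: W'_def pieces_def)
    have int': "{left_end \<beta> - \<epsilon>..right_end (fst W) \<beta> + \<epsilon>} \<subseteq> interval_of W \<beta>"
       "interval_of W' \<beta> \<subseteq> {left_end \<beta> - \<epsilon>..right_end (fst W) \<beta> + \<epsilon>}" for \<beta>
      using \<epsilon> by (auto simp: interval_of_eq W'_def)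
    have f0L: "f0 \<in> topspace Loops" unfolding f0W by (rule loop_of_loop[OF W \<Psi>])
    define \<Phi> where "\<Phi> = fst (\<tau> W W') \<Psi>"
    have \<Phi>: "\<Phi> \<in> obs W'" unfolding \<Phi>_def by (rule restriction_obs(1)[OF W W' ref \<Psi>])
    have XW': "X = og W' \<Phi>" unfolding XW \<Phi>_def by (rule limit.og_push[OF W \<Psi> W' ref, symmetric])
    have lab': "fst \<Phi> p = (\<alpha> (fst p), f0 (ex (snd p)))" if p: "p \<in> topspace (cobj W')" for p
    proof -
      have "p \<in> topspace (cobj W)" using p int'[of "fst p"] by (auto simp: mem_cobj fW')
      then show ?thesis unfolding \<Phi>_def using restriction_same_points[OF W fW'(1) p] lab by simp
    qed
    define \<alpha>n where "\<alpha>n n \<beta> = (if \<bar>snd \<beta>\<bar> \<le> int n then \<alpha> \<beta> else \<alpha> (fst \<beta>, 0))" for n \<beta>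
    define B where "B n = fst W \<times> {- int n..int n}" for n
    have B: "finite (B n)" "\<beta> \<in> B n \<Longrightarrow> \<alpha>n n \<beta> = \<alpha> \<beta>" "\<beta> \<in> B n \<Longrightarrow> \<beta> \<in> pieces W" for n \<beta>
      using admissible_point_set[OF W] by (auto simp: B_def \<alpha>n_def pieces_def point_set_def)
    define T where "T n = {f \<in> topspace Loops. \<forall>\<beta>\<in>B n. \<forall>x\<in>{left_end \<beta> - \<epsilon>..right_end (fst W) \<beta> + \<epsilon>}. f (ex x) \<in> U (\<alpha> \<beta>)}" for n
    have T: "openin Loops (T n)" for n
      unfolding T_def by (rule openin_tube[OF B(1)]) (use B(3) sub in \<open>auto simp: subordinate_def\<close>)
    have subT: "subordinate W' (\<alpha>n n) f" if f: "f \<in> T n" for n f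
    proof (rule subordinate_shift[where B = "B n"])
      fix \<beta> assume \<beta>: "\<beta> \<in> B n"
      have "\<forall>x\<in>{left_end \<beta> - \<epsilon>..right_end (fst W) \<beta> + \<epsilon>}. f (ex x) \<in> U (\<alpha> \<beta>)" using f \<beta> unfolding T_def by blast
      then show "\<alpha>n n \<beta> \<in> I \<and> (\<forall>x\<in>interval_of W' \<beta>. f (ex x) \<in> U (\<alpha>n n \<beta>))"
        using int'(2)[of \<beta>] B(2,3)[OF \<beta>] sub by (auto simp: subordinate_def)
    next
      fix \<beta> assume "\<beta> \<in> pieces W'"
      then show "\<beta> \<in> B n \<or> ((fst \<beta>, 0) \<in> B n \<and> \<alpha>n n \<beta> = \<alpha>n n (fst \<beta>, 0))"
        by (auto simp: B_def \<alpha>n_def pieces_def W'_def)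
    qed
    have f0T: "f0 \<in> T n" for n
      unfolding T_def mem_Collect_eq
    proof (intro conjI f0L ballI)
      fix \<beta> x assume \<beta>: "\<beta> \<in> B n" and "x \<in> {left_end \<beta> - \<epsilon>..right_end (fst W) \<beta> + \<epsilon>}"
      then have "x \<in> interval_of W \<beta>" using int'(1)[of \<beta>] by blast
      then show "f0 (ex x) \<in> U (\<alpha> \<beta>)" using sub B(3)[OF \<beta>] unfolding subordinate_def by blast
    qed
    define N where "N = {\<Phi> \<in> obs W'. og W' \<Phi> \<in> V}"
    have "openin (Obj (LG W')) N"
      unfolding N_def by (rule openin_continuous_map_preimage[OF limit.continuous_og[OF W'] V[unfolded Obj_\<L>]])
    moreover from this obtain N' where N': "openin (CO (cobj W') (Obj G)) N'" "N = {\<Psi> \<in> obs W'. fst \<Psi> \<in> N'}"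
      by (rule openin_Obj_LG)
    ultimately have oN: "openin (Obj (LG W')) N" by simp
    have "\<Phi> \<in> N" unfolding N_def using \<Phi> XW' X by simp
    then have "fst \<Phi> \<in> N'" using N' by simp
    have "\<forall>\<^sub>F n in sequentially. fst (obj_of W' (\<alpha>n n) f0) \<in> N'"
    proof (rule compact_open_eventually[OF N'(1) \<open>fst \<Phi> \<in> N'\<close>])
      show "fst (obj_of W' (\<alpha>n n) f0) \<in> continuous_maps (cobj W') (Obj G)" for n
        using obj_of_obs[OF f0L subT[OF f0T]] obs_iff by blast
      fix K assume K: "compactin (cobj W') K"
      \<comment> \<open>The shift is a continuous function to a discrete space, hence bounded on the
        compact \<open>K\<close>. Beyond that bound the modified labels agree with the original ones
        on \<open>K\<close>.\<close>
      have "continuous_map (cobj W') (discrete_topology UNIV) (\<lambda>p. snd (fst p))"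
        by (rule continuous_map_discrete_compose[OF continuous_cobj(1)]) simp
      from image_compactin[OF K this] have "finite ((\<lambda>p. snd (fst p)) ` K)"
        by (simp add: compactin_discrete_topology)
      then have "finite ((\<lambda>p. nat \<bar>snd (fst p)\<bar>) ` K)"
        using finite_imageI[of "(\<lambda>p. snd (fst p)) ` K" "\<lambda>k. nat \<bar>k\<bar>"] by (simp add: image_image)
      then obtain m where m: "\<And>p. p \<in> K \<Longrightarrow> nat \<bar>snd (fst p)\<bar> \<le> m"
        using finite_nat_set_iff_bounded_le[of "(\<lambda>p. nat \<bar>snd (fst p)\<bar>) ` K"] by auto
      have "\<forall>p\<in>K. fst (obj_of W' (\<alpha>n n) f0) p = fst \<Phi> p" if "m \<le> n" for n
      proof
        fix p assume p: "p \<in> K"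
        then have pt: "p \<in> topspace (cobj W')" using compactin_subset_topspace[OF K] by blast
        have "\<bar>snd (fst p)\<bar> \<le> int n" using m[OF p] that by linarith
        then show "fst (obj_of W' (\<alpha>n n) f0) p = fst \<Phi> p" using pt lab'[OF pt] by (simp add: fst_obj_of \<alpha>n_def)
      qed
      then show "\<forall>\<^sub>F n in sequentially. \<forall>p\<in>K. fst (obj_of W' (\<alpha>n n) f0) p = fst \<Phi> p"
        unfolding eventually_sequentially by blast
    qed
    then obtain n where n: "fst (obj_of W' (\<alpha>n n) f0) \<in> N'" unfolding eventually_sequentially by blast
    \<comment> \<open>With \<open>n\<close> and its labels fixed, a loop in the tube determines an
      object continuously. So the loops whose object lands in \<open>N\<close> form an open set, and
      each of them is the image of that object.\<close>
    define R where "R = {f \<in> T n. obj_of W' (\<alpha>n n) f \<in> N}"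
    have Ttop: "topspace (subtopology Loops (T n)) = T n" using openin_subset[OF T] by auto
    have "continuous_map (subtopology Loops (T n)) (Obj (LG W')) (\<lambda>f. obj_of W' (\<alpha>n n) f)"
      by (rule continuous_obj_of) (use subT Ttop in \<open>simp_all add: continuous_map_from_subtopology\<close>)
    from openin_continuous_map_preimage[OF this oN] have "openin (subtopology Loops (T n)) R"
      unfolding R_def by (simp only: Ttop)
    then have "openin Loops R" by (rule openin_trans_full[OF _ T])
    moreover have "f0 \<in> R" unfolding R_def N'(2) using f0T n obj_of_obs[OF f0L subT[OF f0T]] by simp
    moreover have "R \<subseteq> germ_loop ` V"
    proof
      fix f assume f: "f \<in> R"
      then have fT: "f \<in> T n" "og W' (obj_of W' (\<alpha>n n) f) \<in> V" by (simp_all add: R_def N_def)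
      have fL: "f \<in> topspace Loops" using fT(1) by (simp add: T_def)
      have "germ_loop (og W' (obj_of W' (\<alpha>n n) f)) = f"
        using germ_loop[OF W' obj_of_obs[OF fL subT[OF fT(1)]]] loop_of_obj_of[OF W' fL subT[OF fT(1)]] by simp
      then show "f \<in> germ_loop ` V" using fT(2) by force
    qed
    ultimately show ?thesis by blast
  qed
  then show "openin Loops (germ_loop ` V)" by (subst openin_subopen) blast
qed

end

section \<open>Surjectivity and local sections over the loop space\<close>

locale loop_cover = cover_loops +
  assumes covers: "(\<Union>\<alpha>\<in>I. U \<alpha>) = topspace M"
begin

text \<open>The loop, lifted to the unit interval, is cut into steps shorter than a Lebesgue number.
  The containments are obtained on closed intervals so that they remain true for nearby
  loops.\<close>

lemma subordinate_cover_exists: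
  assumes f: "f \<in> topspace Loops"
  obtains W \<alpha> where "W \<in> admissible_covers"
    "\<And>q. q \<in> fst W \<Longrightarrow> \<alpha> q \<in> I \<and> (\<forall>x\<in>{q - snd W..next_point (fst W) q + snd W}. f (ex x) \<in> U (\<alpha> q))"
proof -
  have cf: "continuous_map (top_of_set (sphere 0 1)) M f"
    using f by (simp add: free_loop_space_def continuous_mapsD(1))
  from continuous_map_compose[OF continuous_ex cf]
  have c: "continuous_map euclideanreal M (\<lambda>x. f (ex x))" by (simp add: o_def)
  define S where "S i = {x. f (ex x) \<in> U i}" for i
  have "openin euclideanreal {x \<in> topspace euclideanreal. f (ex x) \<in> U i}" if "i \<in> I" for i
    by (rule openin_continuous_map_preimage[OF c open_U[OF that]])
  then have "open (S i)" if "i \<in> I" for i using that by (simp add: S_def)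
  moreover have "{0..1} \<subseteq> \<Union>(S ` I)"
    using continuous_map_funspace[OF c] covers by (fastforce simp: S_def)
  ultimately have op: "\<And>C. C \<in> S ` I \<Longrightarrow> open C" and sub: "{0..1} \<subseteq> \<Union>(S ` I)" by blast+
  obtain e where e: "0 < e" "\<And>x. x \<in> {0..1} \<Longrightarrow> \<exists>C\<in>S ` I. ball x e \<subseteq> C"
    by (rule Heine_Borel_lemma[OF compact_Icc sub op]) blast+
  \<comment> \<open>An interval reaches at most \<open>1 / real N\<close> to the next point and as
    much again by thickening, so what is used is that \<open>2 / real N\<close> lies below
    \<open>e\<close>; the 3 leaves room.\<close>
  obtain N :: nat where N: "3 / e < real N" using reals_Archimedean2 by blast
  have "0 < real N" using N e(1) by (smt (verit) divide_pos_pos)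
  then have N0: "0 < N" by simp
  have Ne: "3 / real N < e" using N e(1) \<open>0 < real N\<close> by (simp add: field_simps)
  \<comment> \<open>The index starts at 1 because points lie in (0,1]; the last point is 1, and the
    next one after it is the first point moved by one period.\<close>
  define Q where "Q = (\<lambda>j. real j / real N) ` {1..N}"
  have Q: "point_set Q" unfolding point_set_def Q_def using N0 by auto
  have nxt: "next_point Q q \<le> q + 1 / real N" if q: "q \<in> Q" for q
  proof -
    obtain j where j: "1 \<le> j" "j \<le> N" "q = real j / real N" using q by (auto simp: Q_def)
    show ?thesis
    proof (cases "j < N")
      case True
      then have "real (Suc j) / real N \<in> Q" unfolding Q_def by (intro imageI) simp
      then have "next_point Q q \<le> real (Suc j) / real N"
        by (rule next_point_le[OF Q]) (use N0 j in \<open>simp add: divide_strict_right_mono\<close>)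
      then show ?thesis by (simp add: j(3) add_divide_distrib)
    next
      case False
      then have "q = 1" using j N0 by simp
      moreover have "1 / real N \<in> Q" unfolding Q_def using N0 by (intro image_eqI[of _ _ 1]) auto
      then have "Min Q \<le> 1 / real N" by (rule point_set_facts(7)[OF Q])
      ultimately show ?thesis using next_point_le_Min[OF Q, of q] by simp
    qed
  qed
  obtain \<delta> where \<delta>: "0 < \<delta>" "\<And>\<epsilon>. \<lbrakk>0 < \<epsilon>; \<epsilon> \<le> \<delta>\<rbrakk> \<Longrightarrow> (Q, \<epsilon>) \<in> admissible_covers"
    using admissible_margin[OF Q] by blast
  define \<epsilon> where "\<epsilon> = min \<delta> (1 / real N)"
  have \<epsilon>: "0 < \<epsilon>" "\<epsilon> \<le> \<delta>" "\<epsilon> \<le> 1 / real N" using \<delta>(1) N0 by (simp_all add: \<epsilon>_def)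
  have "\<exists>i. i \<in> I \<and> (\<forall>x\<in>{q - \<epsilon>..next_point Q q + \<epsilon>}. f (ex x) \<in> U i)" if q: "q \<in> Q" for q
  proof -
    have "q \<in> {0..1}" using point_set_facts(3,4)[OF Q q] by simp
    then obtain i where i: "i \<in> I" "ball q e \<subseteq> S i" using e(2)[of q] by blast
    have "x \<in> ball q e" if "x \<in> {q - \<epsilon>..next_point Q q + \<epsilon>}" for x
    proof -
      have "\<bar>x - q\<bar> \<le> 2 * (1 / real N)" using that nxt[OF q] \<epsilon> by auto
      also have "\<dots> < e" using Ne \<open>0 < real N\<close> by (simp add: field_simps)
      finally show ?thesis by (simp add: dist_real_def abs_minus_commute)
    qed
    then have "\<forall>x\<in>{q - \<epsilon>..next_point Q q + \<epsilon>}. f (ex x) \<in> U i"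
      using i(2) unfolding S_def by blast
    then show ?thesis using i(1) by blast
  qed
  then obtain \<alpha> where "\<And>q. q \<in> Q \<Longrightarrow> \<alpha> q \<in> I \<and> (\<forall>x\<in>{q - \<epsilon>..next_point Q q + \<epsilon>}. f (ex x) \<in> U (\<alpha> q))"
    by metis
  then show thesis using \<delta>(2)[OF \<epsilon>(1,2)] that[of "(Q, \<epsilon>)" \<alpha>] by simp
qed

text \<open>The labels depend only on the point of the cover and not on the shift, so subordination
  is implied by finitely many containments of compact sets and persists near the given loop.\<close>

lemma local_object_section:
  assumes f0: "f0 \<in> topspace Loops"
  obtains W \<alpha> N where "W \<in> admissible_covers" "openin Loops N" "f0 \<in> N" "\<And>f. f \<in> N \<Longrightarrow> subordinate W \<alpha> f"
proof -
  obtain W a where W: "W \<in> admissible_covers"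
    and a: "\<And>q. q \<in> fst W \<Longrightarrow> a q \<in> I \<and> (\<forall>x\<in>{q - snd W..next_point (fst W) q + snd W}. f0 (ex x) \<in> U (a q))"
    by (rule subordinate_cover_exists[OF f0]) blast
  define N where "N = {f \<in> topspace Loops. \<forall>q\<in>fst W. \<forall>x\<in>{q - snd W..next_point (fst W) q + snd W}. f (ex x) \<in> U (a q)}"
  have "openin Loops N"
    unfolding N_def
  proof -
    let ?B = "(\<lambda>q. (q, 0 :: int)) ` fst W"
    have "openin Loops {f \<in> topspace Loops. \<forall>\<beta>\<in>?B. \<forall>x\<in>{fst \<beta> - snd W..next_point (fst W) (fst \<beta>) + snd W}. f (ex x) \<in> U (a (fst \<beta>))}"
    proof (rule openin_tube)
      show "finite ?B" using point_set_facts(1)[OF admissible_point_set[OF W]] by (rule finite_imageI)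
      show "a (fst \<beta>) \<in> I" if "\<beta> \<in> ?B" for \<beta> using that a by auto
    qed
    then show "openin Loops {f \<in> topspace Loops. \<forall>q\<in>fst W. \<forall>x\<in>{q - snd W..next_point (fst W) q + snd W}. f (ex x) \<in> U (a q)}"
      by simp
  qed
  moreover have "f0 \<in> N" using a f0 by (simp add: N_def)
  moreover have "subordinate W (\<lambda>\<beta>. a (fst \<beta>)) f" if f: "f \<in> N" for f
  proof (rule subordinate_shift[where B = "fst W \<times> {0}"])
    fix \<beta> assume \<beta>: "\<beta> \<in> fst W \<times> {0 :: int}"
    have "f (ex x) \<in> U (a (fst \<beta>))" if "x \<in> interval_of W \<beta>" for x
    proof -
      have "x \<in> {fst \<beta> - snd W..next_point (fst W) (fst \<beta>) + snd W}"
        using that \<beta> by (auto simp: interval_of_eq left_end_def right_end_def)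
      moreover have "fst \<beta> \<in> fst W" using \<beta> by auto
      ultimately show ?thesis using f unfolding N_def by blast
    qed
    then show "a (fst \<beta>) \<in> I \<and> (\<forall>x\<in>interval_of W \<beta>. f (ex x) \<in> U (a (fst \<beta>)))" using a \<beta> by auto
  qed (auto simp: pieces_def)
  ultimately show thesis using that[OF W] by blast
qed

lemma germ_loop_surj: "germ_loop ` topspace (Obj \<L>) = topspace Loops"
proof
  show "germ_loop ` topspace (Obj \<L>) \<subseteq> topspace Loops"
    using continuous_map_funspace[OF continuous_germ_loop] by blast
  show "topspace Loops \<subseteq> germ_loop ` topspace (Obj \<L>)"
  proof
    fix f assume f: "f \<in> topspace Loops"
    obtain W \<alpha> where W: "W \<in> admissible_covers" and sub: "subordinate W \<alpha> f"
      by (rule local_object_section[OF f]) blast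
    have "germ_loop (og W (obj_of W \<alpha> f)) = f"
      using germ_loop[OF W obj_of_obs[OF f sub]] loop_of_obj_of[OF W f sub] by simp
    then show "f \<in> germ_loop ` topspace (Obj \<L>)"
      using obj_\<L>I[OF W obj_of_obs[OF f sub]] by (intro image_eqI[of _ _ "og W (obj_of W \<alpha> f)"]) simp_all
  qed
qed

text \<open>The common target of the arrows over a loop is the germ of the object that the fixed
  labelling assigns to it. Continuity of the choice of arrows comes from finality of the object
  topology.\<close>

lemma local_arrow_section:
  assumes f0: "f0 \<in> topspace Loops"
  shows "\<exists>N c. openin Loops N \<and> f0 \<in> N \<and>
          continuous_map (subtopology (Obj \<L>) {X. germ_loop X \<in> N}) (Arr \<L>) c \<and>
          (\<forall>X\<in>topspace (Obj \<L>). germ_loop X \<in> N \<longrightarrow> src \<L> (c X) = X) \<and>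
          (\<forall>X\<in>topspace (Obj \<L>). \<forall>Y\<in>topspace (Obj \<L>). germ_loop X \<in> N \<and> germ_loop X = germ_loop Y \<longrightarrow> tgt \<L> (c X) = tgt \<L> (c Y))"
proof -
  obtain W \<alpha> N where W: "W \<in> admissible_covers" and N: "openin Loops N" "f0 \<in> N" and sub: "\<And>f. f \<in> N \<Longrightarrow> subordinate W \<alpha> f"
    by (rule local_object_section[OF f0]) blast
  have NL: "f \<in> N \<Longrightarrow> f \<in> topspace Loops" for f using openin_subset[OF N(1)] by blast
  define s where "s f = obj_of W \<alpha> f" for f
  have s: "s f \<in> obs W" "loop_of W (s f) = f" if "f \<in> N" for f
    unfolding s_def using obj_of_obs[OF NL sub] loop_of_obj_of[OF W NL sub] that by simp_all
  \<comment> \<open>A germ has no preferred representative, so the arrow is chosen by its ends;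
    uniqueness of arrows then gives it a formula over every cover.\<close>
  define c where "c X = (SOME A. A \<in> topspace (Arr \<L>) \<and> src \<L> A = X \<and> tgt \<L> A = og W (s (germ_loop X)))" for X
  \<comment> \<open>That formula: the given object lives over \<open>W'\<close> and the section over
    \<open>W\<close>, and both are restricted to a common refinement \<open>k\<close>.\<close>
  define C where "C W' k \<Psi> = arr k (fst (\<tau> W' k) \<Psi>) (fst (\<tau> W k) (s (loop_of W' \<Psi>)))" for W' k \<Psi>
  have C: "ag k (C W' k \<Psi>) \<in> topspace (Arr \<L>) \<and> src \<L> (ag k (C W' k \<Psi>)) = og W' \<Psi> \<and>
       tgt \<L> (ag k (C W' k \<Psi>)) = og W (s (germ_loop (og W' \<Psi>)))"
    if k: "W' \<in> admissible_covers" "k \<in> admissible_covers" "cover_refines k W'" "cover_refines k W"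
      and \<Psi>: "\<Psi> \<in> obs W'" "loop_of W' \<Psi> \<in> N" for W' k \<Psi>
  proof -
    note 1 = restriction_obs[OF k(1,2,3) \<Psi>(1)] and 2 = restriction_obs[OF W k(2,4) s(1)[OF \<Psi>(2)]]
    have eq: "loop_of k (fst (\<tau> W' k) \<Psi>) = loop_of k (fst (\<tau> W k) (s (loop_of W' \<Psi>)))"
      using 1(2) 2(2) s(2)[OF \<Psi>(2)] by simp
    show ?thesis
      unfolding C_def germ_loop[OF k(1) \<Psi>(1)]
      using arr_\<L>[OF k(2) 1(1) 2(1) eq] limit.og_push[OF k(1) \<Psi>(1) k(2,3)]
        limit.og_push[OF W s(1)[OF \<Psi>(2)] k(2,4)] by simp
  qed
  have c: "c X \<in> topspace (Arr \<L>) \<and> src \<L> (c X) = X \<and> tgt \<L> (c X) = og W (s (germ_loop X))"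
    if X: "X \<in> topspace (Obj \<L>)" "germ_loop X \<in> N" for X
  proof -
    obtain W' \<Psi> where W': "W' \<in> admissible_covers" "\<Psi> \<in> obs W'" "X = og W' \<Psi>" using X(1) by (rule obj_\<L>E)
    obtain k where k: "k \<in> admissible_covers" "cover_refines k W'" "cover_refines k W"
      using covers_directed[OF W'(1) W] by blast
    have "loop_of W' \<Psi> \<in> N" using X(2) W' germ_loop by simp
    from C[OF W'(1) k W'(2) this] show ?thesis
      unfolding c_def W'(3)
      by (rule someI[where P = "\<lambda>A. A \<in> topspace (Arr \<L>) \<and> src \<L> A = og W' \<Psi> \<and>
             tgt \<L> A = og W (s (germ_loop (og W' \<Psi>)))"])
  qed
  have cC: "c (og W' \<Psi>) = ag k (C W' k \<Psi>)"
    if k: "W' \<in> admissible_covers" "k \<in> admissible_covers" "cover_refines k W'" "cover_refines k W"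
      and \<Psi>: "\<Psi> \<in> obs W'" "loop_of W' \<Psi> \<in> N" for W' k \<Psi>
  proof -
    have "germ_loop (og W' \<Psi>) \<in> N" using germ_loop[OF k(1) \<Psi>(1)] \<Psi>(2) by simp
    from c[OF obj_\<L>I[OF k(1) \<Psi>(1)] this] C[OF k \<Psi>] show ?thesis
      by (intro arrows_\<L>_determined) simp_all
  qed
  let ?D = "{X. germ_loop X \<in> N}"
  have "continuous_map (subtopology (Obj \<L>) ?D) (Arr \<L>) c"
    unfolding continuous_map_def
  proof (intro conjI allI impI)
    show "c \<in> topspace (subtopology (Obj \<L>) ?D) \<rightarrow> topspace (Arr \<L>)" using c by auto
    fix V assume V: "openin (Arr \<L>) V"
    define E where "E = {X \<in> topspace (subtopology (Obj \<L>) ?D). c X \<in> V}"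
    \<comment> \<open>By finality it is enough to treat representatives over one cover
      \<open>W'\<close> at a time. There a single \<open>k\<close> serves all of them, and the arrow
      is a continuous family over \<open>k\<close> followed by the germ map.\<close>
    have "openin limit.limO E"
    proof (rule limit.openin_limO)
      have "E \<subseteq> topspace (Obj \<L>)" by (auto simp: E_def)
      then show "E \<subseteq> limit.lim_obj" unfolding Obj_\<L> limit.topspace_lim .
      fix W' assume W': "W' \<in> admissible_covers"
      obtain k where k: "k \<in> admissible_covers" "cover_refines k W'" "cover_refines k W"
        using covers_directed[OF W' W] by blast
      define F where "F = {\<Psi> \<in> obs W'. loop_of W' \<Psi> \<in> N}"
      have F: "openin (Obj (LG W')) F"
        unfolding F_def by (rule openin_continuous_map_preimage[OF continuous_loop_of[OF W'] N(1)])
      let ?P = "subtopology (Obj (LG W')) F"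
      have P: "topspace ?P = F" using openin_subset[OF F] by auto
      have loopc: "continuous_map ?P Loops (loop_of W')" by (rule continuous_map_from_subtopology[OF continuous_loop_of[OF W']])
      have sc: "continuous_map ?P (Obj (LG W)) (\<lambda>\<Psi>. s (loop_of W' \<Psi>))"
        unfolding s_def by (rule continuous_obj_of[OF loopc]) (use sub P in \<open>simp add: F_def\<close>)
      have "continuous_map ?P (Arr (LG k)) (C W' k)"
        unfolding C_def[abs_def]
      proof (rule continuous_into_ars[OF k(1)])
        show "continuous_map ?P (Obj (LG k)) (fst (\<tau> W' k))"
          by (rule continuous_map_from_subtopology[OF continuous_restriction[OF W' k(1,2)]])
        show "continuous_map ?P (Obj (LG k)) (\<lambda>\<Psi>. fst (\<tau> W k) (s (loop_of W' \<Psi>)))"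
          using continuous_map_compose[OF sc continuous_restriction[OF W k(1,3)]] by (simp add: o_def)
        fix \<Psi> assume "\<Psi> \<in> topspace ?P"
        then have "\<Psi> \<in> obs W'" "loop_of W' \<Psi> \<in> N" unfolding P F_def by simp_all
        then show "loop_of k (fst (\<tau> W' k) \<Psi>) = loop_of k (fst (\<tau> W k) (s (loop_of W' \<Psi>)))"
          using restriction_obs(2)[OF W' k(1,2)] restriction_obs(2)[OF W k(1,3)] s by simp
      qed
      from continuous_map_compose[OF this limit.continuous_ag[OF k(1)]]
      have agc: "continuous_map ?P (Arr \<L>) (\<lambda>\<Psi>. ag k (C W' k \<Psi>))" unfolding Arr_\<L> by (simp add: o_def)
      have "openin ?P {\<Psi> \<in> topspace ?P. ag k (C W' k \<Psi>) \<in> V}" by (rule openin_continuous_map_preimage[OF agc V])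
      then have "openin (Obj (LG W')) {\<Psi> \<in> topspace ?P. ag k (C W' k \<Psi>) \<in> V}" by (rule openin_trans_full[OF _ F])
      moreover have "{\<Psi> \<in> topspace ?P. ag k (C W' k \<Psi>) \<in> V} = {\<Psi> \<in> obs W'. og W' \<Psi> \<in> E}"
      proof -
        have "\<Psi> \<in> obs W' \<and> loop_of W' \<Psi> \<in> N \<and> ag k (C W' k \<Psi>) \<in> V \<longleftrightarrow> \<Psi> \<in> obs W' \<and> og W' \<Psi> \<in> E" for \<Psi>
          using cC[OF W' k, of \<Psi>] obj_\<L>I[OF W', of \<Psi>] germ_loop[OF W', of \<Psi>] by (auto simp: E_def)
        then show ?thesis unfolding P unfolding F_def mem_Collect_eq conj_assoc by (rule Collect_cong)
      qed
      ultimately show "openin (Obj (LG W')) {\<Psi> \<in> obs W'. og W' \<Psi> \<in> E}" by simp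
    qed
    then have "openin (Obj \<L>) E" unfolding Obj_\<L> .
    moreover have "E = E \<inter> ?D" by (auto simp: E_def)
    ultimately show "openin (subtopology (Obj \<L>) ?D) {X \<in> topspace (subtopology (Obj \<L>) ?D). c X \<in> V}"
      unfolding openin_subtopology E_def[symmetric] by blast
  qed
  moreover have "tgt \<L> (c X) = tgt \<L> (c Y)"
    if "X \<in> topspace (Obj \<L>)" "Y \<in> topspace (Obj \<L>)" "germ_loop X \<in> N" "germ_loop X = germ_loop Y" for X Y
    using c[of X] c[of Y] that by simp
  ultimately show ?thesis using N c by (intro exI[of _ N] exI[of _ c]) blast
qed

theorem morita_equivalent_free_loop_space: "morita_equivalent \<L> (unit_groupoid Loops)"
proof -
  interpret groupoid_over_space \<L> Loops germ_loop
  proof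
    show "topological_groupoid \<L>" by (rule topological_groupoid_\<L>)
    show "continuous_map (Obj \<L>) Loops germ_loop" by (rule continuous_germ_loop)
    show "open_map (Obj \<L>) Loops germ_loop" by (rule open_map_germ_loop)
    show "germ_loop ` topspace (Obj \<L>) = topspace Loops" by (rule germ_loop_surj)
  qed (rule germ_loop_arrow arrows_\<L>_determined local_arrow_section; assumption)+
  show ?thesis by (rule morita_equivalent_unit_groupoid)
qed

end

theorem proposition5p1p3:
  fixes n :: nat
    and M :: "'m topology"
    and A :: "('m set \<times> ('m \<Rightarrow> nat \<Rightarrow> real)) set"
    and I :: "'i set"
    and U :: "'i \<Rightarrow> 'm set"
  assumes "smooth_manifold n M A"
    and "\<And>\<alpha>. \<alpha> \<in> I \<Longrightarrow> openin M (U \<alpha>)"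
    and "(\<Union>\<alpha>\<in>I. U \<alpha>) = topspace M"
  shows "morita_equivalent (loop_groupoid (cover_groupoid M I U)) (unit_groupoid (free_loop_space M))"
proof -
  interpret loop_cover M I U by unfold_locales (use assms in auto)
  show ?thesis by (rule morita_equivalent_free_loop_space)
qed

end
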